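(* Let $d\ge2$. There is a constant $K_d>0$ depending only on $d$ such that for every $R>0$, with $R':=2R$, and every $f\in W^{1,\infty}_0(B(R))$, $$d\Big(\int_{B(R)}f(x)(\gamma(dx)-\lambda(dx)),\ \mathcal N\Big)\le\big|1-\|f\|^2_{L^2(B(R))}\big|+\Big|\int_{B(R)}f^3(x)\,\lambda(dx)\Big|+2(K_dv_dR')^2\,\|f\|_{L^2(B(R))}\,\|\nabla^{\mathbb R^d}f\|^2_{L^\infty(B(R);\mathbb R^d)}.$$
   Context: $B(R)$ is the closed ball of radius $R$ centred at $0$ in $\mathbb R^d$, $v_d$ is the volume of the unit ball of $\mathbb R^d$, $\lambda$ is Lebesgue measure, and $\gamma(dx)$ is a Poisson random measure on $\mathbb R^d$ with intensity $\lambda$. $\nabla^{\mathbb R^d}$ is the Euclidean gradient. $W^{1,p}_0(B(R))$ is the completion of $\mathcal C_0^\infty(B(R))$ (smooth functions compactly supported in the interior of $B(R)$) under the norm $\|f\|_{L^p(B(R))}+\|\nabla^{\mathbb R^d}f\|_{L^p(B(R);\mathbb R^d)}$, here with $p=\infty$. $d(F,G):=\sup_h|E[h(F)]-E[h(G)]|$, the supremum being over all $1$-Lipschitz functions $h$ on $\mathbb R$ (Wasserstein distance between laws), and $\mathcal N$ is a standard Gaussian random variable. (The letter $d$ denotes both the dimension and, when applied to two random variables, this distance.) *)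

theory Defs
  imports "HOL-Probability.Probability"
begin

definition gradient :: "('a::euclidean_space \<Rightarrow> real) \<Rightarrow> 'a \<Rightarrow> 'a"
  where "gradient f x = (\<Sum>b\<in>Basis. frechet_derivative f (at x) b *\<^sub>R b)"

fun continuously_differentiable :: "nat \<Rightarrow> ('a::euclidean_space \<Rightarrow> real) \<Rightarrow> bool"
  where
    "continuously_differentiable 0 f \<longleftrightarrow> continuous_on UNIV f"
  | "continuously_differentiable (Suc k) f \<longleftrightarrow>
       (\<forall>x. f differentiable (at x)) \<and>
       (\<forall>b\<in>Basis. continuously_differentiable k (\<lambda>x. frechet_derivative f (at x) b))"

definition test_functions :: "real \<Rightarrow> ('a::euclidean_space \<Rightarrow> real) set"
  where "test_functions R = {\<phi>. (\<forall>k. continuously_differentiable k \<phi>) \<and>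
    compact (closure (support_on UNIV \<phi>)) \<and>
    closure (support_on UNIV \<phi>) \<subseteq> interior (cball 0 R)}"

definition L2_norm :: "real \<Rightarrow> ('a::euclidean_space \<Rightarrow> real) \<Rightarrow> real"
  where "L2_norm R f = sqrt (LINT x:cball 0 R|lborel. (f x)\<^sup>2)"

definition Linf_norm :: "real \<Rightarrow> ('a::euclidean_space \<Rightarrow> 'b::real_normed_vector) \<Rightarrow> ennreal"
  where "Linf_norm R f = esssup (restrict_space lborel (cball 0 R)) (\<lambda>x. ennreal (norm (f x)))"

text \<open>
  The completion of the test functions \<open>\<phi>\<close> under the norm \<open>\<parallel>\<phi>\<parallel>\<^sub>\<infinity> + \<parallel>\<nabla>\<phi>\<parallel>\<^sub>\<infinity>\<close> is realised as the
  closure of the set of pairs \<open>(\<phi>, \<nabla>\<phi>)\<close> in the Banach space of pairs of essentially bounded maps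
  on the ball: \<open>f\<close> is (a Borel representative of) an element of the completion and \<open>g\<close> is (a Borel
  representative of) its gradient. Values of \<open>f\<close> and \<open>g\<close> outside the ball are irrelevant.
\<close>

definition sobolev0_inf_gradient ::
    "real \<Rightarrow> ('a::euclidean_space \<Rightarrow> real) \<Rightarrow> ('a \<Rightarrow> 'a) \<Rightarrow> bool"
  where "sobolev0_inf_gradient R f g \<longleftrightarrow>
    set_borel_measurable borel (cball 0 R) f \<and> set_borel_measurable borel (cball 0 R) g \<and>
    (\<exists>\<phi>. (\<forall>n::nat. \<phi> n \<in> test_functions R) \<and>
      (\<lambda>n. Linf_norm R (\<lambda>x. \<phi> n x - f x) + Linf_norm R (\<lambda>x. gradient (\<phi> n) x - g x))
        \<longlonglongrightarrow> 0)"

text \<open>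
  The Poisson probabilities are written out because the library's \<^const>\<open>poisson_pmf\<close> requires a
  positive rate, whereas null sets need rate \<open>0\<close>; on sets of infinite intensity the
  Poisson law is the point mass at infinity.
\<close>

definition poisson_random_measure ::
    "'w measure \<Rightarrow> 'a measure \<Rightarrow> ('w \<Rightarrow> 'a measure) \<Rightarrow> bool"
  where "poisson_random_measure M \<mu> \<gamma> \<longleftrightarrow>
    prob_space M \<and>
    (\<forall>\<omega>\<in>space M. sets (\<gamma> \<omega>) = sets \<mu>) \<and>
    (\<forall>A\<in>sets \<mu>. (\<lambda>\<omega>. emeasure (\<gamma> \<omega>) A) \<in> borel_measurable M) \<and>
    (\<forall>A\<in>sets \<mu>. emeasure \<mu> A < \<infinity> \<longrightarrow>
      (\<forall>k::nat. measure M {\<omega> \<in> space M. emeasure (\<gamma> \<omega>) A = of_nat k} =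
        measure \<mu> A ^ k / fact k * exp (- measure \<mu> A))) \<and>
    (\<forall>A\<in>sets \<mu>. emeasure \<mu> A = \<infinity> \<longrightarrow> (AE \<omega> in M. emeasure (\<gamma> \<omega>) A = \<infinity>)) \<and>
    (\<forall>(A :: nat \<Rightarrow> 'a set) I. finite I \<longrightarrow> A ` I \<subseteq> sets \<mu> \<longrightarrow> disjoint_family_on A I \<longrightarrow>
      prob_space.indep_vars M (\<lambda>_. borel) (\<lambda>i \<omega>. emeasure (\<gamma> \<omega>) (A i)) I)"

definition compensated_integral ::
    "real \<Rightarrow> ('a::euclidean_space \<Rightarrow> real) \<Rightarrow> ('w \<Rightarrow> 'a measure) \<Rightarrow> 'w \<Rightarrow> real"
  where "compensated_integral R f \<gamma> \<omega> =
    (LINT x:cball 0 R|\<gamma> \<omega>. f x) - (LINT x:cball 0 R|lborel. f x)"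

text \<open>
  \<open>X\<close> and \<open>Y\<close> are (integrable) random variables, possibly on different probability spaces; only
  their laws matter.
\<close>

definition wasserstein_dist ::
    "'w measure \<Rightarrow> ('w \<Rightarrow> real) \<Rightarrow> 'v measure \<Rightarrow> ('v \<Rightarrow> real) \<Rightarrow> ennreal"
  where "wasserstein_dist M X N Y =
    (SUP h\<in>{h :: real \<Rightarrow> real. 1-lipschitz_on UNIV h}.
      ennreal \<bar>(LINT \<omega>|M. h (X \<omega>)) - (LINT \<omega>|N. h (Y \<omega>))\<bar>)"

end

theory Submission
  imports Defs "HOL-Real_Asymp.Real_Asymp"
begin

text \<open>
  Write \<open>F\<close> for the compensated integral of \<open>f\<close>. Stein's method turns \<open>E h(F) - E h(N)\<close> into
  \<open>E (\<phi>'(F) - F \<phi>(F))\<close>, where \<open>\<phi>\<close> solves Stein's equation for \<open>h\<close> and satisfies \<open>|\<phi>'| \<le> 1\<close> and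
  \<open>|\<phi>''| \<le> 2\<close> (theorem \<open>stein_solution\<close>). The Mecke formula (theorem \<open>mecke_formula\<close>), which says how a
  Poisson configuration reacts to the addition of one point, gives
  \<open>E F \<phi>(F) = E \<integral> f(x) (\<phi>(F + f(x)) - \<phi>(F)) dx\<close>. A Taylor expansion of the increment would now lead to
  \<open>\<integral> |f|\<^sup>3\<close>, which is too large. The cancellation in \<open>\<integral> f\<^sup>3\<close> is kept by integrating by parts in
  space instead.

  Fix a unit vector \<open>e\<close>, let \<open>\<partial>\<close> be the derivative along \<open>e\<close>, and let \<open>V k\<close> be the antiderivative of
  \<open>k\<close> along \<open>e\<close>. Since \<open>f\<close> vanishes on the sphere,
  \<open>\<integral> k \<Psi>(f) = - \<integral> (V k) \<Psi>'(f) \<partial>f\<close> whenever \<open>\<Psi>(0) = 0\<close>. Put \<open>a = (V f) \<partial>f\<close> and \<open>b = (V a) \<partial>f\<close>. Two such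
  integrations by parts give, for every real \<open>r\<close>,
  \<open>\<integral> f(x) (\<phi>(r + f(x)) - \<phi>(r)) dx = \<phi>'(r) \<parallel>f\<parallel>\<^sup>2 + \<integral> b(x) \<phi>''(r + f(x)) dx\<close>,
  because \<open>\<integral> a = - \<parallel>f\<parallel>\<^sup>2\<close>. The Mecke formula, read backwards, turns the last term, taken at \<open>r = F\<close>, into
  \<open>E \<phi>''(F) \<integral> b d\<gamma>\<close>. Its mean part is governed by \<open>\<integral> b = (\<integral> f\<^sup>3) / 2\<close>, and its fluctuation by
  \<open>E |\<integral> b d(\<gamma> - \<lambda>)| \<le> \<parallel>b\<parallel>\<close>. The operator \<open>V\<close> integrates over segments of length \<open>2 R\<close>, so it has norm at
  most \<open>2 R\<close> on \<open>L\<^sup>2\<close> and \<open>\<parallel>b\<parallel> \<le> (2 R L)\<^sup>2 \<parallel>f\<parallel>\<close> for any essential bound \<open>L\<close> of the gradient. With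
  \<open>|\<phi>'| \<le> 1\<close> and \<open>|\<phi>''| \<le> 2\<close> this is the asserted inequality with \<open>K\<close> equal to the inverse of the volume
  of the unit ball.

  The calculation is carried out for test functions \<open>f\<close> and for continuously differentiable \<open>h\<close> (theorem
  \<open>stein_bound\<close> already has all Lipschitz \<open>h\<close>). Both sides are continuous under the approximation by
  which the Sobolev space is defined, since a perturbation of \<open>f\<close> by at most \<open>\<delta>\<close> on the ball moves \<open>F\<close>
  by at most \<open>2 \<delta> \<lambda>(B(R))\<close> in mean.
\<close>

section \<open>The Gaussian tail and its Mills ratio\<close>

abbreviation (input) gauss :: "real \<Rightarrow> real" where "gauss \<equiv> std_normal_density"

definition gauss_tail :: "real \<Rightarrow> real"
  where "gauss_tail w = (LINT t:{w..}|lborel. gauss t)"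

text \<open>
  The iterated tail, that is the integral of \<open>gauss_tail\<close> over \<open>{w..}\<close>, in closed form. It is also the mean
  of \<open>max 0 (N - w)\<close> for a standard Gaussian \<open>N\<close>.
\<close>

definition gauss_tail2 :: "real \<Rightarrow> real"
  where "gauss_tail2 w = gauss w - w * gauss_tail w"

lemma tail_integral_deriv:
  fixes g :: "real \<Rightarrow> real"
  assumes cont: "continuous_on UNIV g" and int: "\<And>a. set_integrable lborel {a..} g"
  shows "((\<lambda>w. LINT t:{w..}|lborel. g t) has_real_derivative - g w) (at w)"
proof -
  let ?J = "\<lambda>w. LINT t:{w..}|lborel. g t"
  let ?a = "w - 1"
  have split: "?J v = ?J ?a - integral {?a..v} g" if v: "?a < v" for v
  proof -
    have fin: "set_integrable lborel {?a..v} g"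
      by (rule set_integrable_subset[OF int[of ?a]]) auto
    have "AE x in lborel. x \<noteq> v" by (rule AE_lborel_singleton)
    then have "AE x in lborel. \<not> (x \<in> {?a..v} \<and> x \<in> {v..})"
      by eventually_elim auto
    from set_integral_Un_AE[OF this _ _ fin int[of v]]
    have "(LINT x:{?a..v} \<union> {v..}|lborel. g x) = (LINT x:{?a..v}|lborel. g x) + ?J v" by simp
    moreover have "{?a..v} \<union> {v..} = {?a..}" using v by auto
    ultimately show ?thesis using set_borel_integral_eq_integral(2)[OF fin] by simp
  qed
  have "((\<lambda>x. integral {?a..x} g) has_real_derivative g w) (at w within {?a..w+1})"
    by (rule integral_has_real_derivative) (auto intro: continuous_on_subset[OF cont])
  then have "((\<lambda>x. integral {?a..x} g) has_real_derivative g w) (at w)"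
    using at_within_Icc_at[of ?a w "w+1"] by simp
  then have "((\<lambda>x. ?J ?a - integral {?a..x} g) has_real_derivative - g w) (at w)"
    by (auto intro!: derivative_eq_intros)
  then show ?thesis
    by (rule has_field_derivative_transform_within_open[where S="{?a<..}"]) (auto simp: split)
qed

text \<open>
  Most of the tail estimates below are proved with this principle: the difference of the two sides
  decreases and tends to zero at infinity.
\<close>

lemma nonneg_if_antimono_vanishing:
  fixes f :: "real \<Rightarrow> real"
  assumes "\<And>x. a \<le> x \<Longrightarrow> DERIV f x :> f' x" "\<And>x. a \<le> x \<Longrightarrow> f' x \<le> 0"
    and lim: "(f \<longlongrightarrow> 0) at_top"
  shows "0 \<le> f a"
proof (rule tendsto_upperbound[OF lim])
  show "\<forall>\<^sub>F x in at_top. f x \<le> f a"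
    using eventually_ge_at_top[of a]
  proof eventually_elim
    case (elim x)
    show ?case by (rule DERIV_nonpos_imp_nonincreasing[OF elim]) (use assms in blast)
  qed
qed auto

lemma tail_integral_FTC:
  fixes g F :: "real \<Rightarrow> real"
  assumes [measurable]: "g \<in> borel_measurable borel"
    and "\<And>x. w \<le> x \<Longrightarrow> DERIV F x :> - g x" "\<And>x. w \<le> x \<Longrightarrow> 0 \<le> g x"
    and lim: "(F \<longlongrightarrow> 0) at_top"
  shows "set_integrable lborel {w..} g" "(LINT t:{w..}|lborel. g t) = F w"
proof -
  have "((\<lambda>x. - F x) \<longlongrightarrow> 0) at_top" using tendsto_minus[OF lim] by simp
  moreover have "DERIV (\<lambda>x. - F x) x :> g x" if "w \<le> x" for x
    using DERIV_minus[OF assms(2)[OF that]] by simp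
  ultimately have "(\<integral>\<^sup>+x. ennreal (g x) * indicator {w..} x \<partial>lborel) = 0 - (- F w)"
    by (intro nn_integral_FTC_atLeast[where F="\<lambda>x. - F x"]) (use assms in auto)
  moreover have "ennreal (g x) * indicator {w..} x = ennreal (indicator {w..} x *\<^sub>R g x)" for x
    by (auto split: split_indicator)
  ultimately have nn: "(\<integral>\<^sup>+x. ennreal (indicator {w..} x *\<^sub>R g x) \<partial>lborel) = ennreal (F w)" by simp
  have F: "0 \<le> F w"
    by (rule nonneg_if_antimono_vanishing[where f'="\<lambda>x. - g x"]) (use assms in auto)
  have "has_bochner_integral lborel (\<lambda>x. indicator {w..} x *\<^sub>R g x) (F w)"
    by (rule has_bochner_integral_nn_integral) (use nn F assms(3) in \<open>auto split: split_indicator\<close>)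
  then show "set_integrable lborel {w..} g" "(LINT t:{w..}|lborel. g t) = F w"
    by (auto simp: set_integrable_def set_lebesgue_integral_def has_bochner_integral_iff)
qed

lemma gauss_pos: "0 < gauss x" by (simp add: normal_density_pos)

lemma gauss_deriv [derivative_intros]: "DERIV gauss x :> - x * gauss x"
  unfolding std_normal_density_def[abs_def]
  by (auto intro!: derivative_eq_intros simp: field_simps power2_eq_square)

lemma gauss_cont: "continuous_on A gauss"
  using gauss_deriv by (meson DERIV_isCont continuous_at_imp_continuous_on)

lemma gauss_even: "gauss (- x) = gauss x" by (simp add: normal_density_def)

lemma gauss_le_half: "gauss x \<le> 1 / 2"
proof -
  have "2 \<le> sqrt (2 * pi)" using pi_gt3 by (intro real_le_rsqrt) auto
  then have "1 / sqrt (2 * pi) \<le> 1 / 2" by (intro divide_left_mono) auto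
  moreover have "exp (- x\<^sup>2 / 2) \<le> 1" by simp
  ultimately have "1 / sqrt (2 * pi) * exp (- x\<^sup>2 / 2) \<le> 1 / 2 * 1" by (intro mult_mono) auto
  then show ?thesis by (simp add: std_normal_density_def)
qed

lemma gauss_times_id_tendsto: "((\<lambda>x. x * gauss x) \<longlongrightarrow> 0) at_top"
  unfolding std_normal_density_def by real_asymp

lemma gauss_tendsto: "(gauss \<longlongrightarrow> 0) at_top"
  unfolding std_normal_density_def[abs_def] by real_asymp

lemma gauss_set_integrable: "A \<in> sets borel \<Longrightarrow> set_integrable lborel A gauss"
  by (rule set_integrable_subset[where A=UNIV]) (auto simp: set_integrable_def)

lemma gauss_tail_deriv: "DERIV gauss_tail x :> - gauss x"
  unfolding gauss_tail_def[abs_def]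
  by (rule tail_integral_deriv) (auto simp: gauss_cont gauss_set_integrable)

lemma gauss_tail_nonneg: "0 \<le> gauss_tail w"
  unfolding gauss_tail_def set_lebesgue_integral_def by (intro Bochner_Integration.integral_nonneg) auto

text \<open>
  For positive \<open>w\<close> this is the classical upper bound for the Mills ratio: on \<open>{w..}\<close> the factor \<open>w\<close> is at
  most \<open>t\<close>, and \<open>t * gauss t\<close> has the explicit antiderivative \<open>- gauss t\<close>.
\<close>

lemma gauss_tail2_nonneg: "0 \<le> gauss_tail2 w"
proof (cases "0 \<le> w")
  case False
  then have "w * gauss_tail w \<le> 0" using gauss_tail_nonneg[of w] by (simp add: mult_nonpos_nonneg)
  then show ?thesis using gauss_pos[of w] by (simp add: gauss_tail2_def)
next
  case True
  have D: "DERIV gauss x :> - (x * gauss x)" for x using gauss_deriv[of x] by simp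
  note F = tail_integral_FTC[where F=gauss and g="\<lambda>x. x * gauss x" and w=w, OF _ D _ gauss_tendsto]
  have int: "set_integrable lborel {w..} (\<lambda>x. x * gauss x)" "(LINT x:{w..}|lborel. x * gauss x) = gauss w"
    using F True gauss_pos by (auto simp: less_imp_le)
  have "w * gauss_tail w = (LINT x:{w..}|lborel. w * gauss x)" by (simp add: gauss_tail_def)
  also have "\<dots> \<le> (LINT x:{w..}|lborel. x * gauss x)"
    by (intro set_integral_mono int set_integrable_mult_right gauss_set_integrable)
       (auto intro: mult_right_mono simp: less_imp_le gauss_pos)
  finally show ?thesis by (simp add: int gauss_tail2_def)
qed

lemma gauss_tail_bound: "w * gauss_tail w \<le> gauss w"
  using gauss_tail2_nonneg[of w] by (simp add: gauss_tail2_def)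

lemma gauss_tail_moments_tendsto:
  "(gauss_tail \<longlongrightarrow> 0) at_top" "((\<lambda>w. w * gauss_tail w) \<longlongrightarrow> 0) at_top"
  "((\<lambda>w. w * (w * gauss_tail w)) \<longlongrightarrow> 0) at_top"
proof -
  show 1: "((\<lambda>w. w * gauss_tail w) \<longlongrightarrow> 0) at_top"
    by (rule tendsto_sandwich[OF _ _ tendsto_const gauss_tendsto])
       (auto simp: gauss_tail_nonneg gauss_tail_bound intro!: eventually_at_top_linorderI[of 0])
  show "((\<lambda>w. w * (w * gauss_tail w)) \<longlongrightarrow> 0) at_top"
    by (rule tendsto_sandwich[OF _ _ tendsto_const gauss_times_id_tendsto])
       (auto simp: gauss_tail_nonneg gauss_tail_bound intro!: eventually_at_top_linorderI[of 0] mult_left_mono)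
  show "(gauss_tail \<longlongrightarrow> 0) at_top"
  proof (rule tendsto_sandwich[OF _ _ tendsto_const 1])
    show "\<forall>\<^sub>F w in at_top. gauss_tail w \<le> w * gauss_tail w"
      by (intro eventually_at_top_linorderI[of 1]) (use mult_right_mono[OF _ gauss_tail_nonneg] in force)
  qed (auto simp: gauss_tail_nonneg)
qed

lemma gauss_tail2_tendsto: "(gauss_tail2 \<longlongrightarrow> 0) at_top"
  unfolding gauss_tail2_def[abs_def]
  using tendsto_diff[OF gauss_tendsto gauss_tail_moments_tendsto(2)] by simp

lemma gauss_tail2_deriv: "DERIV gauss_tail2 x :> - gauss_tail x"
  unfolding gauss_tail2_def[abs_def]
  by (auto intro!: derivative_eq_intros gauss_tail_deriv gauss_deriv)

lemma gauss_tail_cont: "continuous_on A gauss_tail"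
  using gauss_tail_deriv by (meson DERIV_isCont continuous_at_imp_continuous_on)

lemma gauss_tail_measurable [measurable]: "gauss_tail \<in> borel_measurable borel"
  by (rule borel_measurable_continuous_onI[OF gauss_tail_cont])

lemma gauss_tail_integral:
  "set_integrable lborel {w..} gauss_tail" "(LINT t:{w..}|lborel. gauss_tail t) = gauss_tail2 w"
  using tail_integral_FTC[where F=gauss_tail2 and g=gauss_tail and w=w, OF _ gauss_tail2_deriv _ gauss_tail2_tendsto]
  by (auto simp: gauss_tail_nonneg)

lemma gauss_tail_reflect: "gauss_tail w + gauss_tail (- w) = 1"
proof -
  have D: "((\<lambda>w. gauss_tail w + gauss_tail (- w)) has_real_derivative 0) (at x)" for x
    by (rule derivative_eq_intros refl gauss_tail_deriv DERIV_chain2[where f=gauss_tail and g=uminus])+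
       (simp add: gauss_even)
  have "AE x::real in lborel. x \<noteq> 0" by (rule AE_lborel_singleton)
  then have ae: "AE x::real in lborel. \<not> (x \<in> {..0} \<and> x \<in> {0..})"
    by eventually_elim auto
  have "(1::real) = (LINT x:UNIV|lborel. gauss x)" by (simp add: set_lebesgue_integral_def)
  also have "UNIV = {..0::real} \<union> {0..}" by auto
  also have "(LINT x:\<dots>|lborel. gauss x) = (LINT x:{..0}|lborel. gauss x) + gauss_tail 0"
    unfolding gauss_tail_def by (intro set_integral_Un_AE gauss_set_integrable ae) auto
  also have "(LINT x:{..0}|lborel. gauss x) = gauss_tail 0"
    unfolding gauss_tail_def set_lebesgue_integral_def
    by (subst lborel_integral_real_affine[where c="-1" and t=0])
       (auto simp: gauss_even indicator_def intro!: Bochner_Integration.integral_cong)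
  finally have "gauss_tail 0 + gauss_tail (- 0) = 1" by simp
  moreover have "gauss_tail w + gauss_tail (- w) = gauss_tail 0 + gauss_tail (- 0)"
    using DERIV_isconst_all[of "\<lambda>w. gauss_tail w + gauss_tail (- w)" w 0] D by blast
  ultimately show ?thesis by simp
qed


text \<open>
  The rational function is chosen so that the derivative of the difference has a sign and so that the
  polynomial which arises in \<open>gauss_tail2_product\<close> factorises.
\<close>

lemma gauss_tail_lower_bound:
  assumes "0 \<le> w"
  shows "gauss w * ((w + 2) / (w\<^sup>2 + 2 * w + 2)) \<le> gauss_tail w"
proof -
  let ?D = "\<lambda>w::real. w\<^sup>2 + 2 * w + 2"
  let ?f = "\<lambda>w. gauss_tail w - gauss w * ((w + 2) / ?D w)"
  have D: "?D x > 0" for x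
    using zero_le_power2[of "x + 1"] by (simp add: power2_eq_square algebra_simps)
  have "0 \<le> ?f w"
  proof (rule nonneg_if_antimono_vanishing[where f="?f" and a=w])
    show "DERIV ?f x :> gauss x * - (x\<^sup>2 + 2) / (?D x)\<^sup>2" for x
    proof -
      have 0: "DERIV (\<lambda>x. (x + 2) / ?D x) x :> (?D x - (x + 2) * (2 * x + 2)) / (?D x)\<^sup>2"
        using D[of x] by (auto intro!: derivative_eq_intros simp: power2_eq_square)
      have 1: "DERIV ?f x :> - gauss x - (- x * gauss x * ((x + 2) / ?D x) + (?D x - (x + 2) * (2 * x + 2)) / (?D x)\<^sup>2 * gauss x)"
        by (rule DERIV_diff[OF gauss_tail_deriv DERIV_mult[OF gauss_deriv 0]])
      have "(- x * gauss x * ((x + 2) / ?D x)) = gauss x * (- x * (x + 2) * ?D x) / (?D x)\<^sup>2"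
        using D[of x] by (simp add: power2_eq_square)
      moreover have "gauss x = gauss x * (?D x)\<^sup>2 / (?D x)\<^sup>2"
        using D[of x] by simp
      ultimately have "- gauss x - (- x * gauss x * ((x + 2) / ?D x) + (?D x - (x + 2) * (2 * x + 2)) / (?D x)\<^sup>2 * gauss x)
         = gauss x * (- (?D x)\<^sup>2 + x * (x + 2) * ?D x - (?D x - (x + 2) * (2 * x + 2))) / (?D x)\<^sup>2"
        by (simp add: diff_divide_distrib add_divide_distrib right_diff_distrib distrib_left mult_ac)
      also have "- (?D x)\<^sup>2 + x * (x + 2) * ?D x - (?D x - (x + 2) * (2 * x + 2)) = - (x\<^sup>2 + 2)"
        by (simp add: power2_eq_square algebra_simps)
      finally show ?thesis using 1 by metis
    qed
    show "gauss x * - (x\<^sup>2 + 2) / (?D x)\<^sup>2 \<le> 0" for x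
    proof -
      have "- (x\<^sup>2 + 2) \<le> 0" using zero_le_power2[of x] by linarith
      then show ?thesis
        using gauss_pos[of x] by (intro divide_nonpos_nonneg mult_nonneg_nonpos less_imp_le[OF gauss_pos]) auto
    qed
    have "((\<lambda>w. (w + 2) / ?D w) \<longlongrightarrow> 0) at_top" by real_asymp
    from tendsto_diff[OF gauss_tail_moments_tendsto(1) tendsto_mult[OF gauss_tendsto this]]
    show "(?f \<longlongrightarrow> 0) at_top" by simp
  qed
  then show ?thesis by simp
qed

lemma gauss_tail2_reflect: "gauss_tail2 (- w) = w + gauss_tail2 w"
  using gauss_tail_reflect[of w] by (simp add: gauss_tail2_def gauss_even algebra_simps) (metis distrib_left mult.right_neutral)

text \<open>
  This is the bound \<open>|\<phi>'| \<le> 1\<close> for the solution of Stein's equation in disguise: the worst right-hand side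
  has slopes of opposite sign on the two sides of \<open>w\<close>, and then both parts of the representation of \<open>\<phi>'\<close>
  add up to this product. For \<open>w \<ge> 0\<close> the lower bound for the tail reduces the claim to
  \<open>8 * gauss w \<le> w ^ 4 + 4\<close>, and the general case follows because the claim is symmetric in \<open>w\<close> and \<open>- w\<close>.
\<close>

lemma gauss_tail2_product: "2 * gauss_tail2 w * gauss_tail2 (- w) \<le> gauss w"
proof -
  have pos: "2 * gauss_tail2 w * gauss_tail2 (- w) \<le> gauss w" if w: "0 \<le> w" for w
  proof -
    let ?n = "gauss w" and ?D = "w\<^sup>2 + 2 * w + 2"
    have D: "?D > 0" using w by (simp add: add_nonneg_pos)
    have "w * (?n * ((w + 2) / ?D)) \<le> w * gauss_tail w"
      by (intro mult_left_mono gauss_tail_lower_bound w)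
    then have "gauss_tail2 w \<le> ?n - w * (?n * ((w + 2) / ?D))"
      by (simp add: gauss_tail2_def)
    also have "\<dots> = 2 * ?n / ?D"
      using D by (simp add: field_simps power2_eq_square)
    finally have q: "gauss_tail2 w \<le> 2 * ?n / ?D" .
    have "2 * gauss_tail2 w * gauss_tail2 (- w) \<le> 2 * (2 * ?n / ?D) * (w + 2 * ?n / ?D)"
      unfolding gauss_tail2_reflect using q gauss_tail2_nonneg[of w] w by (intro mult_mono) auto
    also have "\<dots> = ?n * ((4 * w * ?D + 8 * ?n) / ?D\<^sup>2)"
      using D by (simp add: field_simps power2_eq_square)
    also have "(4 * w * ?D + 8 * ?n) / ?D\<^sup>2 \<le> 1"
    proof -
      \<comment> \<open>Sophie Germain's identity, as \<open>?D - 4 * w = w\<^sup>2 - 2 * w + 2\<close>\<close>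
      have "?D\<^sup>2 - 4 * w * ?D = w ^ 4 + 4"
        by (simp add: power2_eq_square algebra_simps numeral_eq_Suc)
      moreover have "0 \<le> w ^ 4" by simp
      ultimately have "4 * w * ?D + 8 * ?n \<le> ?D\<^sup>2" using gauss_le_half[of w] by linarith
      then show ?thesis using D by simp
    qed
    finally show ?thesis using gauss_pos[of w] by (simp add: mult_left_mono)
  qed
  show ?thesis using pos[of w] pos[of "- w"] by (cases "0 \<le> w") (auto simp: gauss_even mult_ac)
qed

text \<open>
  The difference of the two sides is twice the integral of \<open>gauss_tail2\<close> over \<open>{w..}\<close>. Its sign makes the
  kernel of \<open>\<phi>'' - g\<close> negative and so gives the constant 2 in \<open>stein_solution\<close>.
\<close>

lemma gauss_tail_ge_tail2: "w * gauss_tail2 w \<le> gauss_tail w"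
proof -
  let ?f = "\<lambda>w. gauss_tail w - w * gauss_tail2 w"
  have "0 \<le> ?f w"
  proof (rule nonneg_if_antimono_vanishing[where f="?f" and a=w])
    show "DERIV ?f x :> - 2 * gauss_tail2 x" for x
      by (auto intro!: derivative_eq_intros gauss_tail_deriv gauss_tail2_deriv simp: gauss_tail2_def)
    show "- 2 * gauss_tail2 x \<le> 0" for x using gauss_tail2_nonneg[of x] by simp
    from tendsto_add[OF tendsto_diff[OF gauss_tail_moments_tendsto(1) gauss_times_id_tendsto] gauss_tail_moments_tendsto(3)]
    show "(?f \<longlongrightarrow> 0) at_top" by (simp add: gauss_tail2_def algebra_simps)
  qed
  then show ?thesis by simp
qed

section \<open>Stein's equation\<close>

definition tail_average :: "(real \<Rightarrow> real) \<Rightarrow> real \<Rightarrow> real"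
  where "tail_average g w = (LINT t:{w..}|lborel. g t * gauss_tail t)"

lemma tail_average_integrable:
  assumes "continuous_on UNIV g" "\<And>t. \<bar>g t\<bar> \<le> 1"
  shows "set_integrable lborel {w..} (\<lambda>t. g t * gauss_tail t)"
proof (rule set_integrable_bound[OF gauss_tail_integral(1)])
  have [measurable]: "g \<in> borel_measurable borel" by (rule borel_measurable_continuous_onI[OF assms(1)])
  show "set_borel_measurable lborel {w..} (\<lambda>t. g t * gauss_tail t)"
    unfolding set_borel_measurable_def by measurable
  show "AE x in lborel. x \<in> {w..} \<longrightarrow> norm (g x * gauss_tail x) \<le> norm (gauss_tail x)"
    by (intro always_eventually allI impI) (simp add: abs_mult mult_left_le_one_le assms)
qed

lemma tail_average_deriv:
  assumes "continuous_on UNIV g" "\<And>t. \<bar>g t\<bar> \<le> 1"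
  shows "DERIV (tail_average g) w :> - (g w * gauss_tail w)"
  unfolding tail_average_def[abs_def]
  by (rule tail_integral_deriv[where g="\<lambda>t. g t * gauss_tail t"])
     (intro continuous_intros assms gauss_tail_cont tail_average_integrable)+

lemma tail_average_bound:
  assumes "continuous_on UNIV g" "\<And>t. \<bar>g t\<bar> \<le> 1"
  shows "\<bar>tail_average g w\<bar> \<le> gauss_tail2 w"
proof -
  have "\<bar>tail_average g w\<bar> \<le> (LINT t:{w..}|lborel. norm (g t * gauss_tail t))"
    unfolding tail_average_def using set_integral_norm_bound[OF tail_average_integrable[OF assms]] by simp
  also have "\<dots> \<le> (LINT t:{w..}|lborel. gauss_tail t)"
    by (intro set_integral_mono set_integrable_norm tail_average_integrable assms gauss_tail_integral)
       (simp add: abs_mult gauss_tail_nonneg mult_left_le_one_le assms)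
  finally show ?thesis by (simp add: gauss_tail_integral)
qed

text \<open>
  The representations of \<open>\<phi>\<close>, \<open>\<phi>'\<close> and \<open>\<phi>'' - g\<close> below are combinations with nonnegative coefficients of
  two integrals of \<open>g\<close> (up to sign), which are largest when \<open>|g| = 1\<close>.
\<close>

lemma abs_combination_le:
  assumes "\<bar>p::real\<bar> \<le> p'" "\<bar>q\<bar> \<le> q'" "0 \<le> x" "0 \<le> y"
  shows "\<bar>p * x + q * y\<bar> \<le> p' * x + q' * y"
proof -
  have "\<bar>p * x + q * y\<bar> \<le> \<bar>p\<bar> * x + \<bar>q\<bar> * y"
    using assms by (metis abs_mult abs_of_nonneg abs_triangle_ineq)
  also have "\<dots> \<le> p' * x + q' * y" by (intro add_mono mult_right_mono assms)
  finally show ?thesis .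
qed

lemma gaussian_expectation_eq:
  assumes "continuous_on UNIV f"
  shows "(LINT x|std_normal_distribution. f x) = (LINT x|lborel. f x * gauss x)"
  by (subst integral_density) (auto intro: borel_measurable_continuous_onI[OF assms] simp: mult_ac)

lemma integral_derivative_eq_0:
  fixes F :: "real \<Rightarrow> real"
  assumes "\<And>x. DERIV F x :> f x" "continuous_on UNIV f" "integrable lborel f"
    and "(F \<longlongrightarrow> 0) at_top" "(F \<longlongrightarrow> 0) at_bot"
  shows "(LINT x|lborel. f x) = 0"
proof -
  have "(LBINT x=-\<infinity>..\<infinity>. f x) = 0 - 0"
  proof (rule interval_integral_FTC_integrable[where F=F])
    show "((F \<circ> real_of_ereal) \<longlongrightarrow> 0) (at_right (- \<infinity>))" "((F \<circ> real_of_ereal) \<longlongrightarrow> 0) (at_left \<infinity>)"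
      using assms by (auto simp: ereal_tendsto_simps)
  qed (use assms in \<open>auto simp: has_real_derivative_iff_has_vector_derivative[symmetric] einterval_def set_integrable_def continuous_on_eq_continuous_at\<close>)
  then show ?thesis by (simp add: interval_integral_to_infinity_eq interval_lebesgue_integral_def einterval_def set_lebesgue_integral_def)
qed

text \<open>
  With \<open>T\<close> the Gaussian tail, put \<open>U(w) = \<integral>\<^sub>w\<^sup>\<infinity> g(t) T(t) dt\<close> and let \<open>L(w)\<close> be its mirror image, the integral
  of \<open>g(t) T(-t)\<close> over \<open>{..w}\<close>. Then \<open>L - U\<close> is an antiderivative of \<open>g\<close>, hence equal to \<open>h\<close> up to a constant,
  and the explicit formula for \<open>\<phi>\<close> solves \<open>\<phi>'(w) = w \<phi>(w) + L(w) - U(w)\<close>. So \<open>\<phi>\<close>, \<open>\<phi>'\<close> and \<open>\<phi>'' - g\<close> are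
  integrals of \<open>g\<close> against explicit kernels. The kernels of \<open>\<phi>\<close> and of \<open>\<phi>'' - g\<close> are negative with integral
  -1, as the right-hand side \<open>h(t) = t\<close> with solution \<open>-1\<close> shows; this gives \<open>|\<phi>| \<le> 1\<close> and
  \<open>|\<phi>''| \<le> |g| + 1 \<le> 2\<close>. The constant is the Gaussian mean of \<open>h\<close> because
  \<open>gauss * \<phi>' - gauss * id * \<phi>\<close> is the derivative of \<open>gauss * \<phi>\<close>, which vanishes at both ends.
\<close>

theorem stein_solution:
  fixes h g :: "real \<Rightarrow> real"
  assumes h: "\<And>x. DERIV h x :> g x" and g: "continuous_on UNIV g" and g1: "\<And>x. \<bar>g x\<bar> \<le> 1"
  obtains \<phi> \<phi>' \<phi>'' where
    "\<And>x. DERIV \<phi> x :> \<phi>' x" "\<And>x. DERIV \<phi>' x :> \<phi>'' x" "continuous_on UNIV \<phi>''"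
    "\<And>x. \<bar>\<phi> x\<bar> \<le> 1" "\<And>x. \<bar>\<phi>' x\<bar> \<le> 1" "\<And>x. \<bar>\<phi>'' x\<bar> \<le> 2"
    "\<And>x. \<phi>' x - x * \<phi> x = h x - (LINT x|std_normal_distribution. h x)"
proof -
  let ?g = "\<lambda>x. g (- x)"
  have g': "continuous_on UNIV ?g" "\<And>x. \<bar>?g x\<bar> \<le> 1"
    by (auto intro!: continuous_on_compose2[OF g] continuous_intros simp: g1)
  define U where "U = (\<lambda>w. tail_average g w)"
  define L where "L = (\<lambda>w. tail_average ?g (- w))"
  have U: "\<bar>U w\<bar> \<le> gauss_tail2 w" and L: "\<bar>L w\<bar> \<le> gauss_tail2 (- w)" for w
    unfolding U_def L_def by (intro tail_average_bound g g' g1)+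
  have dU: "DERIV U w :> - (g w * gauss_tail w)" for w
    unfolding U_def by (intro tail_average_deriv g g1)
  have dL: "DERIV L w :> g w * gauss_tail (- w)" for w
    unfolding L_def using DERIV_chain2[OF tail_average_deriv[OF g'] DERIV_minus[OF DERIV_ident]] by simp
  have dT: "DERIV (\<lambda>w. gauss_tail (- w)) w :> gauss w" for w
    using DERIV_chain2[OF gauss_tail_deriv DERIV_minus[OF DERIV_ident]] by (simp add: gauss_even)
  define \<phi> where "\<phi> = (\<lambda>w. - ((L w * gauss_tail w + U w * gauss_tail (- w)) / gauss w))"
  define \<phi>' where "\<phi>' = (\<lambda>w. w * \<phi> w + (L w - U w))"
  define \<phi>'' where "\<phi>'' = (\<lambda>w. \<phi> w + w * \<phi>' w + g w)"
  note nz = gauss_pos[THEN less_imp_neq, symmetric]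
  have d\<phi>: "DERIV \<phi> w :> \<phi>' w" for w
    unfolding \<phi>_def \<phi>'_def using nz[of w]
    by (auto intro!: derivative_eq_intros dU dL dT gauss_deriv gauss_tail_deriv simp: field_simps)
  have d\<phi>': "DERIV \<phi>' w :> \<phi>'' w" for w
  proof -
    have "g w * gauss_tail (- w) + g w * gauss_tail w = g w"
      using gauss_tail_reflect[of w] by (metis add.commute distrib_left mult.right_neutral)
    then show ?thesis
      unfolding \<phi>'_def[abs_def] \<phi>''_def
      by (auto intro!: derivative_eq_intros d\<phi> dU dL simp: \<phi>'_def)
  qed
  have c\<phi>: "continuous_on UNIV \<phi>" and c\<phi>': "continuous_on UNIV \<phi>'"
    using d\<phi> d\<phi>' by (meson DERIV_isCont continuous_at_imp_continuous_on)+
  have c\<phi>'': "continuous_on UNIV \<phi>''"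
    unfolding \<phi>''_def by (intro continuous_intros c\<phi> c\<phi>' g)
  have b\<phi>: "\<bar>\<phi> w\<bar> \<le> 1" for w
  proof -
    have "\<bar>\<phi> w\<bar> \<le> (gauss_tail2 (- w) * gauss_tail w + gauss_tail2 w * gauss_tail (- w)) / gauss w"
      unfolding \<phi>_def using abs_combination_le[OF L[of w] U[of w] gauss_tail_nonneg[of w] gauss_tail_nonneg[of "- w"]] gauss_pos[of w]
      by (simp add: divide_right_mono)
    also have "gauss_tail2 (- w) * gauss_tail w + gauss_tail2 w * gauss_tail (- w) = gauss w * (gauss_tail w + gauss_tail (- w))"
      by (simp add: gauss_tail2_def gauss_even algebra_simps)
    finally show ?thesis using nz by (simp add: gauss_tail_reflect)
  qed
  have e\<phi>': "\<phi>' w = (L w * gauss_tail2 w + (- U w) * gauss_tail2 (- w)) / gauss w" for w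
  proof -
    have "\<phi>' w * gauss w = - w * (L w * gauss_tail w + U w * gauss_tail (- w)) + (L w - U w) * gauss w"
      unfolding \<phi>'_def \<phi>_def using nz[of w] by (simp add: field_simps)
    also have "\<dots> = L w * gauss_tail2 w + (- U w) * gauss_tail2 (- w)"
      by (simp add: gauss_tail2_def gauss_even algebra_simps)
    finally show ?thesis using nz by (simp add: field_simps)
  qed
  have b\<phi>': "\<bar>\<phi>' w\<bar> \<le> 1" for w
  proof -
    have "\<bar>\<phi>' w\<bar> \<le> (gauss_tail2 (- w) * gauss_tail2 w + gauss_tail2 w * gauss_tail2 (- w)) / gauss w"
      unfolding e\<phi>' using abs_combination_le[OF L[of w] _ gauss_tail2_nonneg[of w] gauss_tail2_nonneg[of "- w"], of "- U w" "gauss_tail2 w"]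
        U[of w] gauss_pos[of w] by (simp add: divide_right_mono)
    also have "\<dots> \<le> 1" using gauss_tail2_product[of w] gauss_pos[of w] by (simp add: mult_ac)
    finally show ?thesis .
  qed
  have b\<phi>'': "\<bar>\<phi>'' w\<bar> \<le> 2" for w
  proof -
    let ?l = "gauss_tail w - w * gauss_tail2 w" and ?u = "gauss_tail (- w) - (- w) * gauss_tail2 (- w)"
    have "(\<phi> w + w * \<phi>' w) = - ((L w * ?l + U w * ?u) / gauss w)"
      unfolding e\<phi>' \<phi>_def using nz[of w] by (simp add: field_simps)
    also have "\<bar>\<dots>\<bar> \<le> (gauss_tail2 (- w) * ?l + gauss_tail2 w * ?u) / gauss w"
      using abs_combination_le[OF L[of w] U[of w], of ?l ?u] gauss_tail_ge_tail2[of w] gauss_tail_ge_tail2[of "- w"] gauss_pos[of w]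
      by (simp add: divide_right_mono)
    also have "gauss_tail2 (- w) * ?l + gauss_tail2 w * ?u = gauss w * (gauss_tail w + gauss_tail (- w))"
      by (simp add: gauss_tail2_def gauss_even algebra_simps)
    finally have "\<bar>\<phi> w + w * \<phi>' w\<bar> \<le> 1" using nz by (simp add: gauss_tail_reflect)
    then show ?thesis unfolding \<phi>''_def using g1[of w] by linarith
  qed
  obtain c where c: "\<phi>' x - x * \<phi> x = h x - c" for x
  proof -
    have D: "DERIV (\<lambda>x. h x - (L x - U x)) x :> 0" for x
    proof -
      have "g x * gauss_tail (- x) + g x * gauss_tail x = g x"
        using gauss_tail_reflect[of x] by (metis add.commute distrib_left mult.right_neutral)
      then show ?thesis by (auto intro!: derivative_eq_intros dU dL h)
    qed
    have "h x - (L x - U x) = h 0 - (L 0 - U 0)" for x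
      using DERIV_isconst_all[of "\<lambda>x. h x - (L x - U x)" x 0] D by blast
    then show ?thesis by (intro that[of "h 0 - (L 0 - U 0)"]) (simp add: \<phi>'_def algebra_simps)
  qed
  have ch: "continuous_on UNIV h" using h by (meson DERIV_isCont continuous_at_imp_continuous_on)
  have "c = (LINT x|std_normal_distribution. h x)"
  proof -
    have [measurable]: "\<phi> \<in> borel_measurable borel" "\<phi>' \<in> borel_measurable borel"
      by (auto intro: borel_measurable_continuous_onI c\<phi> c\<phi>')
    have i1: "integrable lborel (\<lambda>x. gauss x * \<phi>' x)"
      by (rule Bochner_Integration.integrable_bound[OF integrable_normal_density[of 1 0]])
         (auto simp: abs_mult mult_right_le_one_le b\<phi>' gauss_pos less_imp_le)
    have i2: "integrable lborel (\<lambda>x. (gauss x * x) * \<phi> x)"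
      by (rule Bochner_Integration.integrable_bound[OF integrable_std_normal_moment[of 1]])
         (auto simp: abs_mult mult_right_le_one_le b\<phi>)
    have t0: "((\<lambda>x. gauss x * \<phi> x) \<longlongrightarrow> 0) F" if "(gauss \<longlongrightarrow> 0) F" for F
      by (rule tendsto_rabs_zero_cancel, rule tendsto_sandwich[OF _ _ tendsto_const that])
         (auto simp: abs_mult mult_right_le_one_le b\<phi> gauss_pos less_imp_le)
    have tb: "(gauss \<longlongrightarrow> 0) at_bot"
      unfolding at_bot_mirror filterlim_filtermap using gauss_tendsto by (simp add: gauss_even)
    have "(LINT x|lborel. gauss x * \<phi>' x - (gauss x * x) * \<phi> x) = 0"
    proof (rule integral_derivative_eq_0[where F="\<lambda>x. gauss x * \<phi> x"])
      show "DERIV (\<lambda>x. gauss x * \<phi> x) x :> gauss x * \<phi>' x - (gauss x * x) * \<phi> x" for x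
        by (auto intro!: derivative_eq_intros gauss_deriv d\<phi>)
    qed (intro continuous_intros gauss_cont c\<phi> c\<phi>' Bochner_Integration.integrable_diff i1 i2 t0 tb gauss_tendsto)+
    moreover have eq: "gauss x * \<phi>' x - (gauss x * x) * \<phi> x = h x * gauss x - c * gauss x" for x
      using c[of x] by (metis (no_types, opaque_lifting) left_diff_distrib mult.assoc mult.commute right_diff_distrib)
    moreover have "integrable lborel (\<lambda>x. gauss x * \<phi>' x - (gauss x * x) * \<phi> x)"
      by (intro Bochner_Integration.integrable_diff i1 i2)
    then have "integrable lborel (\<lambda>x. (gauss x * \<phi>' x - (gauss x * x) * \<phi> x) + c * gauss x)"
      by (intro Bochner_Integration.integrable_add) auto
    then have "integrable lborel (\<lambda>x. h x * gauss x)" by (simp add: eq)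
    ultimately show ?thesis by (simp add: gaussian_expectation_eq[OF ch])
  qed
  with c d\<phi> d\<phi>' c\<phi>'' b\<phi> b\<phi>' b\<phi>'' show ?thesis by (intro that) auto
qed

section \<open>Integration by parts along segments\<close>

text \<open>
  If \<open>k\<close> vanishes outside the ball of radius \<open>R\<close> and \<open>e\<close> is a unit vector, then on the ball, for \<open>T = 2 * R\<close>, this
  is the antiderivative of \<open>k\<close> in direction \<open>e\<close> which vanishes far behind the ball. The finite length
  of the segments makes it a bounded operator.
\<close>

definition segment_integral :: "real \<Rightarrow> 'a::euclidean_space \<Rightarrow> ('a \<Rightarrow> real) \<Rightarrow> 'a \<Rightarrow> real"
  where "segment_integral T e k y = (LINT t:{0..T}|lborel. k (y - t *\<^sub>R e))"

lemma integrable_bounded_support: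
  fixes f :: "'a \<Rightarrow> real"
  assumes "f \<in> borel_measurable M" "A \<in> sets M" "emeasure M A < \<infinity>"
    and "\<And>x. x \<in> space M \<Longrightarrow> \<bar>f x\<bar> \<le> C" "\<And>x. x \<in> space M \<Longrightarrow> x \<notin> A \<Longrightarrow> f x = 0"
  shows "integrable M f"
proof (rule Bochner_Integration.integrable_bound[of M "\<lambda>x. C * indicator A x"])
  show "integrable M (\<lambda>x. C * indicator A x)" using assms by (simp add: integrable_real_indicator)
  show "AE x in M. norm (f x) \<le> norm (C * indicator A x :: real)"
    using assms(4,5) by (intro AE_I2) (fastforce simp: indicator_def)
qed (use assms in auto)

lemma lborel_integral_shift:
  fixes f :: "'a::euclidean_space \<Rightarrow> real"
  assumes [measurable]: "f \<in> borel_measurable borel"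
  shows "(LINT x|lborel. f (x + c)) = (LINT x|lborel. f x)"
proof -
  have "(LINT x|lborel. f x) = (LINT x|distr lborel borel ((+) c). f x)"
    by (simp add: lborel_distr_plus)
  also have "\<dots> = (LINT x|lborel. f (x + c))"
    by (subst integral_distr) (auto simp: add.commute)
  finally show ?thesis by simp
qed

lemma segment_integral_measurable [measurable]:
  fixes k :: "'a::euclidean_space \<Rightarrow> real"
  assumes [measurable]: "k \<in> borel_measurable borel"
  shows "segment_integral T e k \<in> borel_measurable borel"
proof -
  have "(\<lambda>y. LINT t|lborel. indicator {0..T} t *\<^sub>R k (y - t *\<^sub>R e)) \<in> borel_measurable lborel"
    by measurable
  then show ?thesis by (simp add: segment_integral_def[abs_def] set_lebesgue_integral_def)
qed

lemma segment_integrable: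
  fixes k :: "'a::euclidean_space \<Rightarrow> real"
  assumes [measurable]: "k \<in> borel_measurable borel" and "\<And>x. \<bar>k x\<bar> \<le> C"
  shows "set_integrable lborel {0..T::real} (\<lambda>t. k (y - t *\<^sub>R e))"
  unfolding set_integrable_def
  by (rule integrable_bounded_support[where A="{0..T}" and C=C])
     (use assms order_trans[OF abs_ge_zero assms(2)]
        emeasure_bounded_finite[OF bounded_closed_interval, of "0::real" T] in \<open>auto simp: indicator_def\<close>)

lemma segment_integral_bound:
  fixes k :: "'a::euclidean_space \<Rightarrow> real"
  assumes k: "k \<in> borel_measurable borel" "\<And>x. \<bar>k x\<bar> \<le> C" and "0 \<le> T"
  shows "\<bar>segment_integral T e k y\<bar> \<le> T * C"
proof -
  have "\<bar>segment_integral T e k y\<bar> \<le> (LINT t:{0..T}|lborel. norm (k (y - t *\<^sub>R e)))"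
    unfolding segment_integral_def using set_integral_norm_bound[OF segment_integrable[OF k, of T y e]] by simp
  also have "\<dots> \<le> (LINT t:{0..T}|lborel. C)"
    by (intro set_integral_mono set_integrable_norm segment_integrable[where C=C] k) (use k order_trans[OF abs_ge_zero k(2)] in \<open>auto simp: set_integrable_def\<close>)
  finally show ?thesis using \<open>0 \<le> T\<close> by (simp add: set_lebesgue_integral_def)
qed

lemma product_integrable_bounded:
  fixes f :: "'a::euclidean_space \<Rightarrow> real \<Rightarrow> real"
  assumes "case_prod f \<in> borel_measurable (lborel \<Otimes>\<^sub>M lborel)" "\<And>x t. \<bar>f x t\<bar> \<le> C"
    and "\<And>x t. x \<notin> cball 0 R \<or> t \<notin> {0..T} \<Longrightarrow> f x t = 0"
  shows "integrable (lborel \<Otimes>\<^sub>M lborel) (case_prod f)"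
proof (rule integrable_bounded_support[where A="cball 0 R \<times> {0..T}" and C=C])
  show "emeasure (lborel \<Otimes>\<^sub>M lborel) (cball (0::'a) R \<times> {0..T}) < \<infinity>"
    using emeasure_bounded_finite[OF bounded_cball, of "0::'a" R]
      emeasure_bounded_finite[OF bounded_closed_interval, of "0::real" T]
    by (subst lborel.emeasure_pair_measure_Times) (auto simp: ennreal_mult_less_top)
  show "\<And>z. z \<notin> cball 0 R \<times> {0..T} \<Longrightarrow> case_prod f z = 0"
    using assms(3) by force
qed (use assms in auto)

text \<open>
  For \<open>x\<close> in the ball the point \<open>x + 2 * R *\<^sub>R e\<close> has norm at least \<open>R\<close>, so \<open>u(x)\<close> is minus the integral of \<open>du\<close>
  along the segment between them. Inserting this and substituting \<open>y = x + t *\<^sub>R e\<close> moves the shift to \<open>k\<close>.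
  In this form \<open>k\<close> may be discontinuous, and its antiderivative is never differentiated.
\<close>

lemma integral_by_parts_along_segments:
  fixes k u du :: "'a::euclidean_space \<Rightarrow> real"
  assumes e: "norm e = 1" and R: "0 < R"
    and [measurable]: "k \<in> borel_measurable borel" and k: "\<And>x. \<bar>k x\<bar> \<le> C" "\<And>x. x \<notin> cball 0 R \<Longrightarrow> k x = 0"
    and u: "\<And>x t. ((\<lambda>s. u (x + s *\<^sub>R e)) has_real_derivative du (x + t *\<^sub>R e)) (at t)"
    and u0: "\<And>x. R \<le> norm x \<Longrightarrow> u x = 0"
    and du: "continuous_on UNIV du" "\<And>x. \<bar>du x\<bar> \<le> D" "\<And>x. x \<notin> cball 0 R \<Longrightarrow> du x = 0"
  shows "(LINT x|lborel. k x * u x) = - (LINT x|lborel. segment_integral (2 * R) e k x * du x)"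
proof -
  let ?T = "2 * R"
  have [measurable]: "du \<in> borel_measurable borel" by (rule borel_measurable_continuous_onI[OF du(1)])
  have CD: "0 \<le> C" "0 \<le> D" using order_trans[OF abs_ge_zero k(1)] order_trans[OF abs_ge_zero du(2)] by auto
  let ?p = "\<lambda>x t. k x * (indicator {0..?T} t * du (x + t *\<^sub>R e))"
  let ?q = "\<lambda>y t. (indicator {0..?T} t * k (y - t *\<^sub>R e)) * du y"
  have u_eq: "k x * u x = - (LINT t|lborel. ?p x t)" for x
  proof (cases "x \<in> cball 0 R")
    case True
    have "integral\<^sup>L lborel (\<lambda>t. indicator {0..?T} t *\<^sub>R du (x + t *\<^sub>R e)) = u (x + ?T *\<^sub>R e) - u (x + 0 *\<^sub>R e)"
    proof (rule integral_FTC_atLeastAtMost)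
      show "((\<lambda>t. u (x + t *\<^sub>R e)) has_vector_derivative du (x + t *\<^sub>R e)) (at t within {0..?T})" for t
        using u[of x t] by (simp add: has_real_derivative_iff_has_vector_derivative has_vector_derivative_at_within)
      show "continuous_on {0..?T} (\<lambda>t. du (x + t *\<^sub>R e))"
        by (intro continuous_on_compose2[OF du(1)] continuous_intros) auto
    qed (use R in auto)
    moreover have "u (x + ?T *\<^sub>R e) = 0"
    proof (rule u0)
      have "norm (?T *\<^sub>R e) \<le> norm (x + ?T *\<^sub>R e) + norm x"
        using norm_triangle_ineq4[of "x + ?T *\<^sub>R e" x] by simp
      then show "R \<le> norm (x + ?T *\<^sub>R e)" using e R True by simp
    qed
    ultimately show ?thesis by simp
  qed (use k in simp)
  have bp: "\<bar>?p x t\<bar> \<le> C * D" "\<bar>?q x t\<bar> \<le> C * D" for x t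
    using CD by (auto simp: abs_mult indicator_def intro!: mult_mono k du)
  have "integrable (lborel \<Otimes>\<^sub>M lborel) (case_prod ?p)"
    by (rule product_integrable_bounded[OF _ bp(1)]) (use k in \<open>auto simp: indicator_def\<close>)
  note F1 = lborel_pair.Fubini_integral[OF this]
  have "integrable (lborel \<Otimes>\<^sub>M lborel) (case_prod ?q)"
    by (rule product_integrable_bounded[OF _ bp(2)]) (use du in \<open>auto simp: indicator_def\<close>)
  note F2 = lborel_pair.Fubini_integral[OF this]
  have "(LINT x|lborel. k x * u x) = - (LINT x|lborel. LINT t|lborel. ?p x t)"
    by (simp add: u_eq)
  also have "(LINT x|lborel. LINT t|lborel. ?p x t) = (LINT t|lborel. LINT x|lborel. ?p x t)"
    using F1 by simp
  also have "\<dots> = (LINT t|lborel. LINT y|lborel. ?q y t)"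
  proof (rule Bochner_Integration.integral_cong[OF refl])
    fix t :: real
    have "(LINT y|lborel. ?q y t) = (LINT y|lborel. ?q (y + t *\<^sub>R e) t)"
      by (rule lborel_integral_shift[symmetric]) measurable
    then show "(LINT x|lborel. ?p x t) = (LINT y|lborel. ?q y t)" by (simp add: mult_ac)
  qed
  also have "\<dots> = (LINT y|lborel. LINT t|lborel. ?q y t)" using F2 by simp
  also have "\<dots> = (LINT y|lborel. segment_integral ?T e k y * du y)"
    by (simp add: segment_integral_def set_lebesgue_integral_def)
  finally show ?thesis .
qed

lemma square_set_integral_le:
  fixes g :: "real \<Rightarrow> real"
  assumes "0 < T" and g: "set_integrable lborel {0..T} g" "set_integrable lborel {0..T} (\<lambda>t. (g t)\<^sup>2)"
  shows "(LINT t:{0..T}|lborel. g t)\<^sup>2 \<le> T * (LINT t:{0..T}|lborel. (g t)\<^sup>2)"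
proof -
  define I where "I = (LINT t:{0..T}|lborel. g t)"
  define m where "m = I / T"
  have c: "set_integrable lborel {0..T} (\<lambda>t. c)" "(LINT t:{0..T}|lborel. c) = T * c" for c :: real
    using assms(1) by (auto simp: set_integrable_def set_lebesgue_integral_def)
  have "0 \<le> (LINT t:{0..T}|lborel. (g t - m)\<^sup>2)"
    unfolding set_lebesgue_integral_def by (intro Bochner_Integration.integral_nonneg) auto
  also have "\<dots> = (LINT t:{0..T}|lborel. ((g t)\<^sup>2 - (2 * m) * g t) + m\<^sup>2)"
    by (simp add: power2_diff algebra_simps)
  also have "\<dots> = (LINT t:{0..T}|lborel. (g t)\<^sup>2) - (2 * m) * I + T * m\<^sup>2"
    unfolding I_def by (simp add: set_integral_add set_integral_diff g c)
  also have "\<dots> = (LINT t:{0..T}|lborel. (g t)\<^sup>2) - I\<^sup>2 / T"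
    using assms(1) by (simp add: m_def field_simps power2_eq_square)
  finally show ?thesis using assms(1) by (simp add: I_def field_simps)
qed

text \<open>
  Cauchy--Schwarz on each segment, then Fubini and translation invariance: the operator has norm at
  most \<open>T\<close> on \<open>L\<^sup>2\<close>.
\<close>

lemma segment_integral_L2:
  fixes k :: "'a::euclidean_space \<Rightarrow> real"
  assumes R: "0 < T" and [measurable]: "k \<in> borel_measurable borel"
    and k: "\<And>x. \<bar>k x\<bar> \<le> C" "\<And>x. x \<notin> cball 0 R \<Longrightarrow> k x = 0"
  shows "integrable lborel (\<lambda>y. (segment_integral T e k y)\<^sup>2)"
    and "(LINT y|lborel. (segment_integral T e k y)\<^sup>2) \<le> T\<^sup>2 * (LINT x|lborel. (k x)\<^sup>2)"
proof -
  let ?r = "\<lambda>y t. indicator {0..T} t * (k (y - t *\<^sub>R e))\<^sup>2"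
  let ?S = "R + T * norm e"
  have C: "0 \<le> C" using order_trans[OF abs_ge_zero k(1)] by auto
  have k2: "\<bar>(k x)\<^sup>2\<bar> \<le> C\<^sup>2" for x using abs_le_square_iff[of "k x" C] k(1)[of x] C by simp
  have far: "k (y - t *\<^sub>R e) = 0" if "y \<notin> cball 0 ?S" "t \<in> {0..T}" for y t
  proof (rule k(2))
    have "norm y \<le> norm (y - t *\<^sub>R e) + norm (t *\<^sub>R e)" by (metis diff_add_cancel norm_triangle_ineq)
    moreover have "norm (t *\<^sub>R e) \<le> T * norm e" using that by (simp add: mult_right_mono)
    ultimately show "y - t *\<^sub>R e \<notin> cball 0 R" using that by simp
  qed
  have "integrable (lborel \<Otimes>\<^sub>M lborel) (case_prod ?r)"
    by (rule product_integrable_bounded[where C="C\<^sup>2" and R="?S" and T=T])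
       (use k2 far in \<open>auto simp: indicator_def\<close>)
  note Fub = lborel_pair.Fubini_integral[OF this] lborel_pair.integrable_fst'[OF this]
  have sq: "(segment_integral T e k y)\<^sup>2 \<le> T * (LINT t|lborel. ?r y t)" for y
  proof -
    have "set_integrable lborel {0..T} (\<lambda>t. (k (y - t *\<^sub>R e))\<^sup>2)"
      by (rule segment_integrable[of "\<lambda>x. (k x)\<^sup>2" "C\<^sup>2"]) (use k2 in auto)
    from square_set_integral_le[OF R segment_integrable[of k C] this] k(1)
    show ?thesis by (simp add: segment_integral_def set_lebesgue_integral_def)
  qed
  have int: "integrable lborel (\<lambda>y. T * (LINT t|lborel. ?r y t))"
    using Fub(2) by simp
  show i: "integrable lborel (\<lambda>y. (segment_integral T e k y)\<^sup>2)"
    by (rule Bochner_Integration.integrable_bound[OF int]) (use sq in \<open>auto intro!: always_eventually order_trans[OF _ abs_ge_self]\<close>)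
  have "(LINT y|lborel. (segment_integral T e k y)\<^sup>2) \<le> (LINT y|lborel. T * (LINT t|lborel. ?r y t))"
    by (intro integral_mono i int sq)
  also have "\<dots> = T * (LINT t|lborel. LINT y|lborel. ?r y t)"
    using Fub(1) by simp
  also have "\<dots> = T * (LINT t|lborel. indicator {0..T} t * (LINT x|lborel. (k x)\<^sup>2))"
  proof -
    have "(LINT y|lborel. ?r y t) = indicator {0..T} t * (LINT x|lborel. (k x)\<^sup>2)" for t
      using lborel_integral_shift[of "\<lambda>y. (k (y - t *\<^sub>R e))\<^sup>2" "t *\<^sub>R e"] by simp
    then show ?thesis by (simp only:)
  qed
  also have "\<dots> = T * (T * (LINT x|lborel. (k x)\<^sup>2))" using R by simp
  finally show "(LINT y|lborel. (segment_integral T e k y)\<^sup>2) \<le> T\<^sup>2 * (LINT x|lborel. (k x)\<^sup>2)"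
    by (simp add: power2_eq_square mult_ac)
qed

section \<open>Poisson random measures\<close>

locale poisson_process =
  fixes M :: "'w measure" and \<mu> :: "'a measure" and \<gamma> :: "'w \<Rightarrow> 'a measure"
  assumes poisson: "poisson_random_measure M \<mu> \<gamma>"
begin

sublocale prob_space M using poisson by (simp add: poisson_random_measure_def)

lemma sets_config: "\<omega> \<in> space M \<Longrightarrow> sets (\<gamma> \<omega>) = sets \<mu>"
  using poisson by (simp add: poisson_random_measure_def)

lemma space_config: "\<omega> \<in> space M \<Longrightarrow> space (\<gamma> \<omega>) = space \<mu>"
  using sets_config by (rule sets_eq_imp_space_eq)

lemma emeasure_config_measurable [measurable]: "A \<in> sets \<mu> \<Longrightarrow> (\<lambda>\<omega>. emeasure (\<gamma> \<omega>) A) \<in> borel_measurable M"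
  using poisson by (simp add: poisson_random_measure_def)

lemma prob_count:
  "A \<in> sets \<mu> \<Longrightarrow> emeasure \<mu> A < \<infinity> \<Longrightarrow>
    prob {\<omega> \<in> space M. emeasure (\<gamma> \<omega>) A = of_nat k} = measure \<mu> A ^ k / fact k * exp (- measure \<mu> A)"
  using poisson by (simp add: poisson_random_measure_def)

text \<open>
  The Poisson weights add up to one, so no mass is left for other values, in particular for infinity.
\<close>

lemma AE_count_nat:
  assumes A: "A \<in> sets \<mu>" "emeasure \<mu> A < \<infinity>"
  shows "AE \<omega> in M. \<exists>k::nat. emeasure (\<gamma> \<omega>) A = of_nat k"
proof -
  let ?D = "\<lambda>k::nat. {\<omega> \<in> space M. emeasure (\<gamma> \<omega>) A = of_nat k}"
  have [measurable]: "?D k \<in> events" for k using A by measurable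
  have "(\<lambda>k. prob (?D k)) sums prob (\<Union>k. ?D k)"
    by (rule finite_measure_UNION) (auto simp: disjoint_family_on_def)
  moreover have "(\<lambda>k. prob (?D k)) sums 1"
  proof -
    have "(\<lambda>k. measure \<mu> A ^ k / fact k * exp (- measure \<mu> A)) sums (exp (measure \<mu> A) * exp (- measure \<mu> A))"
      using exp_converges[of "measure \<mu> A"] by (intro sums_mult2) (simp add: divide_inverse mult.commute)
    then show ?thesis by (simp add: prob_count[OF A] exp_minus)
  qed
  ultimately have "prob (\<Union>k. ?D k) = 1" by (rule sums_unique2)
  then have "AE \<omega> in M. \<omega> \<in> (\<Union>k. ?D k)" by (subst AE_in_set_eq_1) auto
  then show ?thesis by eventually_elim auto
qed

lemma AE_null_config:
  assumes A: "A \<in> sets \<mu>" "emeasure \<mu> A = 0"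
  shows "AE \<omega> in M. emeasure (\<gamma> \<omega>) A = 0"
proof -
  have "prob {\<omega> \<in> space M. emeasure (\<gamma> \<omega>) A = of_nat 0} = 1"
    using A by (subst prob_count) (auto simp: measure_def)
  then show ?thesis using A by (subst (asm) prob_Collect_eq_1) auto
qed

lemma prob_count_real:
  assumes A: "A \<in> sets \<mu>" "emeasure \<mu> A < \<infinity>"
  shows "prob {\<omega> \<in> space M. measure (\<gamma> \<omega>) A = real k} = measure \<mu> A ^ k / fact k * exp (- measure \<mu> A)"
proof -
  have [measurable]: "A \<in> sets \<mu>" by fact
  have [measurable]: "(\<lambda>\<omega>. measure (\<gamma> \<omega>) A) \<in> borel_measurable M"
    unfolding measure_def by measurable
  have "prob {\<omega> \<in> space M. measure (\<gamma> \<omega>) A = real k} = prob {\<omega> \<in> space M. emeasure (\<gamma> \<omega>) A = of_nat k}"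
  proof (rule finite_measure_eq_AE)
    show "AE \<omega> in M. \<omega> \<in> {\<omega> \<in> space M. measure (\<gamma> \<omega>) A = real k} \<longleftrightarrow> \<omega> \<in> {\<omega> \<in> space M. emeasure (\<gamma> \<omega>) A = of_nat k}"
      using AE_count_nat[OF A] by eventually_elim (auto simp: measure_def)
  qed measurable
  then show ?thesis by (simp add: prob_count[OF A])
qed

lemma nn_integral_config_measurable:
  assumes "u \<in> borel_measurable \<mu>"
  shows "(\<lambda>\<omega>. \<integral>\<^sup>+x. u x \<partial>\<gamma> \<omega>) \<in> borel_measurable M"
  using assms
proof (induction rule: borel_measurable_induct)
  case (cong u v)
  then have "(\<integral>\<^sup>+x. u x \<partial>\<gamma> \<omega>) = (\<integral>\<^sup>+x. v x \<partial>\<gamma> \<omega>)" if "\<omega> \<in> space M" for \<omega>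
    using that by (intro nn_integral_cong) (simp add: space_config)
  with cong show ?case by (simp cong: measurable_cong)
next
  case (set A)
  then have "(\<integral>\<^sup>+x. indicator A x \<partial>\<gamma> \<omega>) = emeasure (\<gamma> \<omega>) A" if "\<omega> \<in> space M" for \<omega>
    using that by (intro nn_integral_indicator) (simp add: sets_config)
  with set show ?case by (simp cong: measurable_cong)
next
  case (mult u c)
  then have "(\<integral>\<^sup>+x. c * u x \<partial>\<gamma> \<omega>) = c * (\<integral>\<^sup>+x. u x \<partial>\<gamma> \<omega>)" if "\<omega> \<in> space M" for \<omega>
    using that by (intro nn_integral_cmult) (simp cong: measurable_cong_sets add: sets_config)
  with mult show ?case by (simp cong: measurable_cong)
next
  case (add u v)
  then have "(\<integral>\<^sup>+x. v x + u x \<partial>\<gamma> \<omega>) = (\<integral>\<^sup>+x. v x \<partial>\<gamma> \<omega>) + (\<integral>\<^sup>+x. u x \<partial>\<gamma> \<omega>)" if "\<omega> \<in> space M" for \<omega>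
    using that by (intro nn_integral_add) (simp_all cong: measurable_cong_sets add: sets_config)
  with add show ?case by (simp cong: measurable_cong)
next
  case (seq U)
  then have "(\<integral>\<^sup>+x. (SUP i. U i) x \<partial>\<gamma> \<omega>) = (SUP i. \<integral>\<^sup>+x. U i x \<partial>\<gamma> \<omega>)" if "\<omega> \<in> space M" for \<omega>
    unfolding SUP_apply using that
    by (intro nn_integral_monotone_convergence_SUP) (simp_all cong: measurable_cong_sets add: sets_config)
  with seq show ?case by (simp cong: measurable_cong)
qed

text \<open>
  The integral is defined to be 0 where \<open>b\<close> is not integrable, and \<open>M\<close> need not be complete. So measurability
  is proved for every \<open>\<omega>\<close>, from the measurability of the integrals of nonnegative functions.
\<close>

lemma integral_config_measurable [measurable (raw)]:
  fixes b :: "'a \<Rightarrow> real"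
  assumes b: "b \<in> borel_measurable \<mu>"
  shows "(\<lambda>\<omega>. LINT x|\<gamma> \<omega>. b x) \<in> borel_measurable M"
proof -
  let ?N = "\<lambda>\<omega>. \<integral>\<^sup>+x. ennreal (norm (b x)) \<partial>\<gamma> \<omega>"
  let ?P = "\<lambda>\<omega>. \<integral>\<^sup>+x. ennreal (b x) \<partial>\<gamma> \<omega>"
  let ?Q = "\<lambda>\<omega>. \<integral>\<^sup>+x. ennreal (- b x) \<partial>\<gamma> \<omega>"
  have [measurable]: "?N \<in> borel_measurable M" "?P \<in> borel_measurable M" "?Q \<in> borel_measurable M"
    using b by (intro nn_integral_config_measurable; measurable)+
  have "(LINT x|\<gamma> \<omega>. b x) = (if ?N \<omega> < \<infinity> then enn2real (?P \<omega>) - enn2real (?Q \<omega>) else 0)"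
    if "\<omega> \<in> space M" for \<omega>
  proof -
    have "b \<in> borel_measurable (\<gamma> \<omega>)" using b by (simp cong: measurable_cong_sets add: sets_config that)
    then show ?thesis
      by (auto simp: integrable_iff_bounded real_lebesgue_integral_def not_integrable_integral_eq)
  qed
  then show ?thesis by (subst measurable_cong) (assumption, measurable)
qed

end

section \<open>The Mecke formula\<close>

context prob_space
begin

text \<open>
  Conditioning on the value of an almost surely integer variable: \<open>F\<close> is the sum over \<open>k\<close> of the
  products of the indicator of \<open>X = k\<close> with \<open>a k Y\<close>, whose expectations factorise by independence.
\<close>

lemma expectation_over_nat_values:
  fixes X Y F :: "'a \<Rightarrow> real" and a :: "nat \<Rightarrow> real \<Rightarrow> real"
  assumes indep: "indep_var borel X borel Y" and X: "AE \<omega> in M. X \<omega> \<in> \<nat>"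
    and [measurable]: "\<And>k. a k \<in> borel_measurable borel" and a: "\<And>k y. \<bar>a k y\<bar> \<le> w k"
    and sm: "summable (\<lambda>k. prob {\<omega> \<in> space M. X \<omega> = real k} * w k)"
    and [measurable]: "F \<in> borel_measurable M"
    and F: "\<And>\<omega> k. X \<omega> = real k \<Longrightarrow> F \<omega> = a k (Y \<omega>)"
  shows "integrable M F"
    and "(\<lambda>k. prob {\<omega> \<in> space M. X \<omega> = real k} * expectation (\<lambda>\<omega>. a k (Y \<omega>))) sums expectation F"
proof -
  have [measurable]: "random_variable borel X" "random_variable borel Y"
    using indep indep_var_rv1 indep_var_rv2 by auto
  let ?p = "\<lambda>k. prob {\<omega> \<in> space M. X \<omega> = real k}"
  let ?f = "\<lambda>k \<omega>. indicator {real k} (X \<omega>) * a k (Y \<omega>)"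
  have [measurable]: "{\<omega> \<in> space M. X \<omega> = real k} \<in> events" for k by measurable
  have ind: "indicator {real k} (X \<omega>) = (indicator {\<omega> \<in> space M. X \<omega> = real k} \<omega> :: real)" if "\<omega> \<in> space M" for \<omega> k
    using that by (auto simp: indicator_def)
  have i1: "integrable M (\<lambda>\<omega>. indicator {real k} (X \<omega>) :: real)" "expectation (\<lambda>\<omega>. indicator {real k} (X \<omega>)) = ?p k" for k
  proof -
    have "has_bochner_integral M (indicator {\<omega> \<in> space M. X \<omega> = real k}) (?p k)"
      by (rule has_bochner_integral_real_indicator) (auto simp: emeasure_eq_measure)
    then have "has_bochner_integral M (\<lambda>\<omega>. indicator {real k} (X \<omega>) :: real) (?p k)"
      by (simp add: ind cong: has_bochner_integral_cong)
    then show "integrable M (\<lambda>\<omega>. indicator {real k} (X \<omega>) :: real)" "expectation (\<lambda>\<omega>. indicator {real k} (X \<omega>)) = ?p k"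
      by (auto simp: has_bochner_integral_iff)
  qed
  have i2: "integrable M (\<lambda>\<omega>. a k (Y \<omega>))" for k
    by (rule integrable_const_bound[where B="w k"]) (auto simp: a)
  have prod: "integrable M (?f k)" "expectation (?f k) = ?p k * expectation (\<lambda>\<omega>. a k (Y \<omega>))" for k
  proof -
    have "indep_var borel (indicator {real k} \<circ> X) borel (a k \<circ> Y)"
      by (rule indep_var_compose[OF indep]) auto
    then have ind: "indep_var borel (\<lambda>\<omega>. indicator {real k} (X \<omega>) :: real) borel (\<lambda>\<omega>. a k (Y \<omega>))"
      by (simp add: comp_def)
    from indep_var_lebesgue_integral[OF ind i1(1) i2] indep_var_integrable[OF ind i1(1) i2]
    show "integrable M (?f k)" "expectation (?f k) = ?p k * expectation (\<lambda>\<omega>. a k (Y \<omega>))"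
      by (simp_all add: i1(2))
  qed
  have sums: "(\<lambda>k. ?f k \<omega>) sums F \<omega>" "(\<lambda>k. norm (?f k \<omega>)) sums norm (F \<omega>)" if "X \<omega> = real j" for \<omega> j
  proof -
    have eq: "?f k \<omega> = (if k = j then F \<omega> else 0)" for k using that F[OF that] by (auto simp: indicator_def)
    show "(\<lambda>k. ?f k \<omega>) sums F \<omega>" unfolding eq by (rule sums_single)
    show "(\<lambda>k. norm (?f k \<omega>)) sums norm (F \<omega>)"
      unfolding eq using sums_single[of j "\<lambda>_. norm (F \<omega>)"] by (simp add: if_distrib[of abs] cong: if_cong)
  qed
  have AEsm: "AE \<omega> in M. summable (\<lambda>k. norm (?f k \<omega>))"
    using X
  proof eventually_elim
    case (elim \<omega>)
    then obtain n where "X \<omega> = real n" by (auto elim: Nats_cases)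
    from sums(2)[OF this] show ?case by (rule sums_summable)
  qed
  have sm': "summable (\<lambda>k. expectation (\<lambda>\<omega>. norm (?f k \<omega>)))"
  proof (rule summable_comparison_test'[OF sm])
    fix k
    have "expectation (\<lambda>\<omega>. norm (?f k \<omega>)) \<le> expectation (\<lambda>\<omega>. indicator {real k} (X \<omega>) * w k)"
      by (intro integral_mono integrable_norm prod Bochner_Integration.integrable_mult_left i1)
         (auto simp: abs_mult indicator_def a)
    also have "\<dots> = ?p k * w k" by (simp add: i1)
    finally show "norm (expectation (\<lambda>\<omega>. norm (?f k \<omega>))) \<le> ?p k * w k"
      by (simp add: Bochner_Integration.integral_nonneg)
  qed
  have FAE: "AE \<omega> in M. (\<Sum>k. ?f k \<omega>) = F \<omega>"
    using X
  proof eventually_elim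
    case (elim \<omega>)
    then obtain n where "X \<omega> = real n" by (auto elim: Nats_cases)
    from sums(1)[OF this] show ?case by (rule sums_unique[symmetric])
  qed
  show "integrable M F"
    using integrable_suminf[OF prod(1) AEsm sm'] FAE by (subst integrable_cong_AE[symmetric]) auto
  have "expectation (\<lambda>\<omega>. \<Sum>k. ?f k \<omega>) = expectation F"
    using FAE by (intro integral_cong_AE) auto
  then show "(\<lambda>k. ?p k * expectation (\<lambda>\<omega>. a k (Y \<omega>))) sums expectation F"
    using sums_integral[OF prod(1) AEsm sm'] by (simp add: prod(2))
qed

text \<open>
  The identity \<open>(k + 1) p\<^sub>k\<^sub>+\<^sub>1 = r p\<^sub>k\<close> for the Poisson weights says that weighting a Poisson variable by its
  value amounts to adding 1 to it. This is the Mecke formula on a single cell.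
\<close>

lemma poisson_size_bias:
  fixes X Y :: "'a \<Rightarrow> real"
  assumes indep: "indep_var borel X borel Y" and X: "AE \<omega> in M. X \<omega> \<in> \<nat>"
    and p: "\<And>k. prob {\<omega> \<in> space M. X \<omega> = real k} = r ^ k / fact k * exp (- r)"
    and [measurable]: "G \<in> borel_measurable borel" and G: "\<And>y. \<bar>G y\<bar> \<le> C"
  shows "integrable M (\<lambda>\<omega>. X \<omega> * G (c * X \<omega> + Y \<omega>))"
    and "expectation (\<lambda>\<omega>. X \<omega> * G (c * X \<omega> + Y \<omega>)) = r * expectation (\<lambda>\<omega>. G (c * X \<omega> + c + Y \<omega>))"
proof -
  have [measurable]: "random_variable borel X" "random_variable borel Y"
    using indep indep_var_rv1 indep_var_rv2 by auto
  let ?p = "\<lambda>k. prob {\<omega> \<in> space M. X \<omega> = real k}"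
  let ?E = "\<lambda>k. expectation (\<lambda>\<omega>. G (c * real k + c + Y \<omega>))"
  have shift: "?p (Suc k) * real (Suc k) = r * ?p k" for k
  proof -
    have "r * r ^ k / (real (Suc k) * fact k) * z * real (Suc k) = r * (r ^ k / fact k * z)" for z :: real
      by (simp del: of_nat_Suc)
    then show ?thesis unfolding p by (simp only: power_Suc fact_Suc of_nat_mult)
  qed
  have sp: "summable ?p"
    unfolding p using summable_exp[of r] by (intro summable_mult2) (simp add: divide_inverse mult.commute)
  have s1: "summable (\<lambda>k. ?p k * (real k * C))"
  proof (subst summable_Suc_iff[symmetric])
    have "?p (Suc k) * (real (Suc k) * C) = r * C * ?p k" for k
    proof -
      have "?p (Suc k) * (real (Suc k) * C) = (?p (Suc k) * real (Suc k)) * C" by (simp only: mult.assoc)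
      then show ?thesis unfolding shift by (simp only: mult_ac)
    qed
    then show "summable (\<lambda>k. ?p (Suc k) * (real (Suc k) * C))"
      using sp by (simp only: summable_mult)
  qed
  have b1: "\<bar>real k * G (c * real k + y)\<bar> \<le> real k * C" for k y
    by (simp add: abs_mult mult_left_mono G)
  note L = expectation_over_nat_values[OF indep X, of "\<lambda>k y. real k * G (c * real k + y)" "\<lambda>k. real k * C" "\<lambda>\<omega>. X \<omega> * G (c * X \<omega> + Y \<omega>)", OF _ b1 s1]
  show "integrable M (\<lambda>\<omega>. X \<omega> * G (c * X \<omega> + Y \<omega>))" by (rule L(1)) auto
  have "(\<lambda>k. ?p k * expectation (\<lambda>\<omega>. real k * G (c * real k + Y \<omega>))) sums expectation (\<lambda>\<omega>. X \<omega> * G (c * X \<omega> + Y \<omega>))"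
    by (rule L(2)) auto
  then have "(\<lambda>k. ?p (Suc k) * expectation (\<lambda>\<omega>. real (Suc k) * G (c * real (Suc k) + Y \<omega>))) sums expectation (\<lambda>\<omega>. X \<omega> * G (c * X \<omega> + Y \<omega>))"
    by (subst sums_Suc_iff) simp
  moreover have "?p (Suc k) * expectation (\<lambda>\<omega>. real (Suc k) * G (c * real (Suc k) + Y \<omega>)) = r * (?p k * ?E k)" for k
  proof -
    have "?p (Suc k) * expectation (\<lambda>\<omega>. real (Suc k) * G (c * real (Suc k) + Y \<omega>))
        = (?p (Suc k) * real (Suc k)) * ?E k"
      by (simp add: algebra_simps del: of_nat_Suc) (simp add: algebra_simps)
    then show ?thesis by (simp only: shift mult.assoc)
  qed
  ultimately have 1: "(\<lambda>k. r * (?p k * ?E k)) sums expectation (\<lambda>\<omega>. X \<omega> * G (c * X \<omega> + Y \<omega>))"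
    by (simp only:)
  have "(\<lambda>k. ?p k * ?E k) sums expectation (\<lambda>\<omega>. G (c * X \<omega> + c + Y \<omega>))"
    by (rule expectation_over_nat_values(2)[OF indep X, of "\<lambda>k y. G (c * real k + c + y)" "\<lambda>_. C"])
       (auto simp: G intro: summable_mult2 sp)
  from sums_unique2[OF 1 sums_mult[OF this, of r]]
  show "expectation (\<lambda>\<omega>. X \<omega> * G (c * X \<omega> + Y \<omega>)) = r * expectation (\<lambda>\<omega>. G (c * X \<omega> + c + Y \<omega>))" .
qed

end

context poisson_process
begin

text \<open>
  The Mecke formula for simple functions \<open>\<Sum> c\<^sub>i 1\<^bsub>A i\<^esub>\<close> and \<open>\<Sum> \<beta>\<^sub>i 1\<^bsub>A i\<^esub>\<close>. By linearity it is enough to weight with a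
  single count; the remaining counts are independent of it.
\<close>

lemma mecke_simple:
  fixes A :: "nat \<Rightarrow> 'a set" and c \<beta> :: "nat \<Rightarrow> real"
  assumes I: "finite I" "A ` I \<subseteq> sets \<mu>" "disjoint_family_on A I" "\<And>i. i \<in> I \<Longrightarrow> emeasure \<mu> (A i) < \<infinity>"
    and [measurable]: "G \<in> borel_measurable borel" and G: "\<And>y. \<bar>G y\<bar> \<le> C"
  shows "expectation (\<lambda>\<omega>. (\<Sum>i\<in>I. \<beta> i * measure (\<gamma> \<omega>) (A i)) * G (\<Sum>j\<in>I. c j * measure (\<gamma> \<omega>) (A j)))
    = expectation (\<lambda>\<omega>. \<Sum>i\<in>I. \<beta> i * measure \<mu> (A i) * G ((\<Sum>j\<in>I. c j * measure (\<gamma> \<omega>) (A j)) + c i))"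
proof -
  let ?X = "\<lambda>i \<omega>. measure (\<gamma> \<omega>) (A i)"
  let ?S = "\<lambda>\<omega>. \<Sum>j\<in>I. c j * ?X j \<omega>"
  have X: "indep_vars (\<lambda>_. borel) ?X I"
  proof -
    have "indep_vars (\<lambda>_. borel) (\<lambda>i \<omega>. emeasure (\<gamma> \<omega>) (A i)) I"
      using poisson I unfolding poisson_random_measure_def by blast
    from indep_vars_compose2[OF this, of "\<lambda>_. enn2real" "\<lambda>_. borel"]
    show ?thesis by (simp add: measure_def)
  qed
  then have Xm: "i \<in> I \<Longrightarrow> ?X i \<in> borel_measurable M" for i
    by (simp add: indep_vars_def)
  have [measurable]: "?S \<in> borel_measurable M"
    by (intro borel_measurable_sum borel_measurable_times Xm) auto
  have one: "integrable M (\<lambda>\<omega>. ?X i \<omega> * G (?S \<omega>))"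
    "expectation (\<lambda>\<omega>. ?X i \<omega> * G (?S \<omega>)) = measure \<mu> (A i) * expectation (\<lambda>\<omega>. G (?S \<omega> + c i))"
    if i: "i \<in> I" for i
  proof -
    let ?Y = "\<lambda>\<omega>. \<Sum>j\<in>I - {i}. c j * ?X j \<omega>"
    have Ai: "A i \<in> sets \<mu>" "emeasure \<mu> (A i) < \<infinity>" using I i by auto
    have "indep_vars (\<lambda>_. borel) (\<lambda>j \<omega>. (if j = i then 1 else c j) * ?X j \<omega>) I"
      by (rule indep_vars_compose2[OF X, of "\<lambda>j x. (if j = i then 1 else c j) * x"]) simp
    then have "indep_vars (\<lambda>_. borel) (\<lambda>j \<omega>. (if j = i then 1 else c j) * ?X j \<omega>) (insert i (I - {i}))"
      using i by (simp add: insert_absorb)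
    from indep_vars_sum[OF _ _ this] I(1)
    have "indep_var borel (\<lambda>\<omega>. (if i = i then 1 else c i) * ?X i \<omega>)
        borel (\<lambda>\<omega>. \<Sum>j\<in>I - {i}. (if j = i then 1 else c j) * ?X j \<omega>)"
      by blast
    moreover have "(\<lambda>\<omega>. \<Sum>j\<in>I - {i}. (if j = i then 1 else c j) * ?X j \<omega>) = ?Y"
      by (intro ext sum.cong) auto
    ultimately have ind: "indep_var borel (?X i) borel ?Y" by simp
    have nat: "AE \<omega> in M. ?X i \<omega> \<in> \<nat>"
      using AE_count_nat[OF Ai] by eventually_elim (auto simp: measure_def)
    have S: "?S \<omega> = c i * ?X i \<omega> + ?Y \<omega>" for \<omega> using I(1) i by (simp add: sum.remove)
    note b = poisson_size_bias[OF ind nat prob_count_real[OF Ai] _ G, where c="c i"]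
    show "integrable M (\<lambda>\<omega>. ?X i \<omega> * G (?S \<omega>))" unfolding S by (rule b(1)) auto
    have "?S \<omega> + c i = c i * ?X i \<omega> + c i + ?Y \<omega>" for \<omega> using S by simp
    then show "expectation (\<lambda>\<omega>. ?X i \<omega> * G (?S \<omega>)) = measure \<mu> (A i) * expectation (\<lambda>\<omega>. G (?S \<omega> + c i))"
      unfolding S by (subst b(2)) (auto simp: add_ac)
  qed
  have int: "integrable M (\<lambda>\<omega>. G (?S \<omega> + c i))" for i
    by (rule integrable_const_bound[where B=C]) (auto simp: G)
  have "expectation (\<lambda>\<omega>. (\<Sum>i\<in>I. \<beta> i * ?X i \<omega>) * G (?S \<omega>)) = expectation (\<lambda>\<omega>. \<Sum>i\<in>I. \<beta> i * (?X i \<omega> * G (?S \<omega>)))"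
    by (simp add: sum_distrib_right mult.assoc)
  also have "\<dots> = (\<Sum>i\<in>I. \<beta> i * (measure \<mu> (A i) * expectation (\<lambda>\<omega>. G (?S \<omega> + c i))))"
    using one by (subst Bochner_Integration.integral_sum) auto
  also have "\<dots> = expectation (\<lambda>\<omega>. \<Sum>i\<in>I. \<beta> i * measure \<mu> (A i) * G (?S \<omega> + c i))"
    using int by (subst Bochner_Integration.integral_sum) (auto simp: mult.assoc)
  finally show ?thesis .
qed

end

lemma integral_over_cells:
  fixes s :: "'a \<Rightarrow> nat" and \<beta> :: "nat \<Rightarrow> real"
  assumes B: "B \<in> sets M" "emeasure M B < \<infinity>" and s: "s \<in> measurable M (count_space UNIV)"
    and I: "finite I" "\<And>x. x \<in> B \<Longrightarrow> s x \<in> I"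
  shows "(LINT x|M. indicator B x * \<beta> (s x)) = (\<Sum>i\<in>I. \<beta> i * measure M {x \<in> B. s x = i})"
proof -
  have set: "{x \<in> B. s x = i} \<in> sets M" for i
  proof -
    have "{x \<in> B. s x = i} = (s -` {i} \<inter> space M) \<inter> B" using sets.sets_into_space[OF B(1)] by auto
    also have "\<dots> \<in> sets M" using measurable_sets[OF s] B by auto
    finally show ?thesis .
  qed
  have fin: "emeasure M {x \<in> B. s x = i} < \<infinity>" for i
    using emeasure_mono[of "{x \<in> B. s x = i}" B M] B by (auto intro: le_less_trans)
  have "indicator B x * \<beta> (s x) = (\<Sum>i\<in>I. \<beta> i * indicator {x \<in> B. s x = i} x)" for x
  proof (cases "x \<in> B")
    case True
    have "(\<Sum>i\<in>I. \<beta> i * indicator {x \<in> B. s x = i} x) = (\<Sum>i\<in>I. if i = s x then \<beta> i else 0)"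
      using True by (intro sum.cong) (auto simp: indicator_def)
    then show ?thesis using True I by (simp add: sum.delta')
  qed (simp add: indicator_def)
  then have "(LINT x|M. indicator B x * \<beta> (s x)) = (LINT x|M. (\<Sum>i\<in>I. \<beta> i * indicator {x \<in> B. s x = i} x))"
    by simp
  also have "\<dots> = (\<Sum>i\<in>I. \<beta> i * measure M {x \<in> B. s x = i})"
    using set fin by (subst Bochner_Integration.integral_sum) (auto simp: integrable_real_indicator)
  finally show ?thesis .
qed

text \<open>
  Rounding down to a multiple of \<open>1 / Suc m\<close>. It makes a bounded function simple, with a uniform error.
\<close>

definition discretize :: "nat \<Rightarrow> real \<Rightarrow> real"
  where "discretize m y = of_int \<lfloor>real (Suc m) * y\<rfloor> / real (Suc m)"

lemma discretize_dist: "\<bar>discretize m y - y\<bar> \<le> 1 / real (Suc m)"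
proof -
  have "\<bar>of_int \<lfloor>real (Suc m) * y\<rfloor> - real (Suc m) * y\<bar> \<le> 1" by linarith
  then have "\<bar>of_int \<lfloor>real (Suc m) * y\<rfloor> - real (Suc m) * y\<bar> / real (Suc m) \<le> 1 / real (Suc m)"
    by (rule divide_right_mono) simp
  moreover have "discretize m y - y = (of_int \<lfloor>real (Suc m) * y\<rfloor> - real (Suc m) * y) / real (Suc m)"
    by (simp add: discretize_def diff_divide_distrib del: of_nat_Suc)
  ultimately show ?thesis by (simp add: abs_divide del: of_nat_Suc)
qed

lemma discretize_tendsto: "(\<lambda>m. discretize m y) \<longlonglongrightarrow> y"
proof (rule LIM_zero_cancel, rule tendsto_rabs_zero_cancel, rule tendsto_sandwich[OF _ _ tendsto_const])
  show "(\<lambda>m. 1 / real (Suc m)) \<longlonglongrightarrow> 0" using LIMSEQ_inverse_real_of_nat by (simp add: inverse_eq_divide)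
qed (auto simp: discretize_dist simp del: of_nat_Suc)

lemma discretize_bound:
  assumes "\<bar>y\<bar> \<le> C"
  shows "\<bar>discretize m y\<bar> \<le> C + 1"
proof -
  have "1 / real (Suc m) \<le> 1" by simp
  then show ?thesis using discretize_dist[of m y] assms by linarith
qed

lemma discretize_measurable [measurable]: "discretize m \<in> borel_measurable borel"
  unfolding discretize_def by measurable

lemma integral_discretize_tendsto:
  fixes b :: "'a \<Rightarrow> real"
  assumes B: "B \<in> sets M" "emeasure M B < \<infinity>" and [measurable]: "b \<in> borel_measurable M"
    and b: "\<And>x. \<bar>b x\<bar> \<le> C" "\<And>x. x \<notin> B \<Longrightarrow> b x = 0"
  shows "(\<lambda>m. LINT x|M. indicator B x * discretize m (b x)) \<longlonglongrightarrow> (LINT x|M. b x)"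
proof (rule integral_dominated_convergence[where w="\<lambda>x. (C + 1) * indicator B x"])
  have [measurable]: "B \<in> sets M" by fact
  show "(\<lambda>x. indicator B x * discretize m (b x)) \<in> borel_measurable M" for m by measurable
  show "integrable M (\<lambda>x. (C + 1) * indicator B x)" using B by (simp add: integrable_real_indicator)
  show "AE x in M. (\<lambda>m. indicator B x * discretize m (b x)) \<longlonglongrightarrow> b x"
  proof (rule AE_I2)
    fix x
    have "(\<lambda>m. indicator B x * discretize m (b x)) \<longlonglongrightarrow> indicator B x * b x"
      by (intro tendsto_mult tendsto_const discretize_tendsto)
    then show "(\<lambda>m. indicator B x * discretize m (b x)) \<longlonglongrightarrow> b x"
      using b(2)[of x] by (cases "x \<in> B") auto
  qed
  show "AE x in M. norm (indicator B x * discretize m (b x)) \<le> (C + 1) * indicator B x" for m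
    by (intro AE_I2) (auto simp: indicator_def discretize_bound[OF b(1)])
qed auto

lemma integral_supported_bound:
  fixes b :: "'a \<Rightarrow> real"
  assumes B: "B \<in> sets M" "emeasure M B < \<infinity>" and b0: "b \<in> borel_measurable M"
    and b: "\<And>x. \<bar>b x\<bar> \<le> C" "\<And>x. x \<notin> B \<Longrightarrow> b x = 0"
  shows "integrable M b" "\<bar>LINT x|M. b x\<bar> \<le> C * measure M B"
proof -
  have i: "integrable M (\<lambda>x. C * indicator B x)" using B by (simp add: integrable_real_indicator)
  have le: "\<bar>b x\<bar> \<le> C * indicator B x" for x using b[of x] by (cases "x \<in> B") auto
  show 1: "integrable M b"
    by (rule Bochner_Integration.integrable_bound[OF i b0]) (use le in \<open>auto intro: always_eventually order_trans[OF _ abs_ge_self]\<close>)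
  have "\<bar>LINT x|M. b x\<bar> \<le> (LINT x|M. \<bar>b x\<bar>)" by simp
  also have "\<dots> \<le> (LINT x|M. C * indicator B x)"
    by (intro integral_mono i integrable_abs 1 le)
  finally show "\<bar>LINT x|M. b x\<bar> \<le> C * measure M B" using B sets.sets_into_space[OF B(1)]
    by (simp add: Int_absorb2)
qed

context poisson_process
begin

lemma integrable_count:
  assumes B: "B \<in> sets \<mu>" "emeasure \<mu> B < \<infinity>"
  shows "integrable M (\<lambda>\<omega>. measure (\<gamma> \<omega>) B)" "expectation (\<lambda>\<omega>. measure (\<gamma> \<omega>) B) = measure \<mu> B"
proof -
  have "indep_vars (\<lambda>_. borel) (\<lambda>i \<omega>. emeasure (\<gamma> \<omega>) ((\<lambda>_::nat. B) i)) {0}"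
    using poisson B(1) unfolding poisson_random_measure_def by (fastforce simp: disjoint_family_on_def)
  from indep_vars_compose2[OF this, of "\<lambda>_. enn2real" "\<lambda>_. borel"]
  have "indep_vars (\<lambda>_. borel) (\<lambda>(i::nat) \<omega>. measure (\<gamma> \<omega>) B) (insert 0 {})"
    by (simp add: measure_def)
  from indep_vars_sum[OF _ _ this]
  have ind: "indep_var borel (\<lambda>\<omega>. measure (\<gamma> \<omega>) B) borel (\<lambda>\<omega>. 0::real)" by simp
  have nat: "AE \<omega> in M. measure (\<gamma> \<omega>) B \<in> \<nat>"
    using AE_count_nat[OF B] by eventually_elim (auto simp: measure_def)
  from poisson_size_bias[OF ind nat prob_count_real[OF B], of "\<lambda>_. 1" 1 0]
  show "integrable M (\<lambda>\<omega>. measure (\<gamma> \<omega>) B)" "expectation (\<lambda>\<omega>. measure (\<gamma> \<omega>) B) = measure \<mu> B"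
    by (simp_all add: prob_space)
qed

lemma AE_count_finite:
  assumes B: "B \<in> sets \<mu>" "emeasure \<mu> B < \<infinity>"
  shows "AE \<omega> in M. emeasure (\<gamma> \<omega>) B < \<infinity>"
  using AE_count_nat[OF B] by eventually_elim (auto simp: less_top[symmetric])

lemma measurable_config: "\<omega> \<in> space M \<Longrightarrow> b \<in> borel_measurable \<mu> \<Longrightarrow> b \<in> borel_measurable (\<gamma> \<omega>)"
  by (simp cong: measurable_cong_sets add: sets_config)

lemma integrable_config_integral:
  fixes b :: "'a \<Rightarrow> real"
  assumes B: "B \<in> sets \<mu>" "emeasure \<mu> B < \<infinity>" and b0: "b \<in> borel_measurable \<mu>"
    and b: "\<And>x. \<bar>b x\<bar> \<le> C" "\<And>x. x \<notin> B \<Longrightarrow> b x = 0"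
  shows "AE \<omega> in M. \<bar>LINT x|\<gamma> \<omega>. b x\<bar> \<le> C * measure (\<gamma> \<omega>) B"
    and "integrable M (\<lambda>\<omega>. LINT x|\<gamma> \<omega>. b x)"
proof -
  show *: "AE \<omega> in M. \<bar>LINT x|\<gamma> \<omega>. b x\<bar> \<le> C * measure (\<gamma> \<omega>) B"
    using AE_count_finite[OF B] AE_space
  proof eventually_elim
    case (elim \<omega>)
    then show ?case
      using B b b0 by (intro integral_supported_bound) (auto simp: sets_config measurable_config)
  qed
  show "integrable M (\<lambda>\<omega>. LINT x|\<gamma> \<omega>. b x)"
  proof (rule Bochner_Integration.integrable_bound)
    show "integrable M (\<lambda>\<omega>. C * measure (\<gamma> \<omega>) B)" using integrable_count[OF B] by simp
    show "AE \<omega> in M. norm (LINT x|\<gamma> \<omega>. b x) \<le> norm (C * measure (\<gamma> \<omega>) B)"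
      using * by eventually_elim auto
  qed (rule integral_config_measurable[OF b0])
qed

text \<open>
  After discretisation \<open>f\<close> and \<open>b\<close> are constant on the cells on which the pair of rounded values is constant.
  On a bounded range there are finitely many cells. The pairs are coded by natural numbers, because
  the definition of a Poisson random measure states independence for families indexed by them.
\<close>

lemma mecke_discretized:
  fixes f b :: "'a \<Rightarrow> real" and m :: nat
  assumes B: "B \<in> sets \<mu>" "emeasure \<mu> B < \<infinity>"
    and [measurable]: "f \<in> borel_measurable \<mu>" "b \<in> borel_measurable \<mu>"
    and f: "\<And>x. \<bar>f x\<bar> \<le> C" and b: "\<And>x. \<bar>b x\<bar> \<le> C"
    and G0 [measurable]: "G \<in> borel_measurable borel" and G: "\<And>y. \<bar>G y\<bar> \<le> D"
  defines "S \<equiv> \<lambda>\<omega>. LINT x|\<gamma> \<omega>. indicator B x * discretize m (f x)"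
  defines "H \<equiv> \<lambda>r. LINT x|\<mu>. indicator B x * (discretize m (b x) * G (r + discretize m (f x)))"
  shows "expectation (\<lambda>\<omega>. (LINT x|\<gamma> \<omega>. indicator B x * discretize m (b x)) * G (S \<omega>)) = expectation (\<lambda>\<omega>. H (S \<omega>))"
    and "H \<in> borel_measurable borel"
proof -
  let ?k = "real (Suc m)"
  let ?cell = "\<lambda>x. (\<lfloor>?k * f x\<rfloor>, \<lfloor>?k * b x\<rfloor>)"
  define s where "s = (\<lambda>x. to_nat (?cell x))"
  define c where "c = (\<lambda>i. of_int (fst (from_nat i :: int \<times> int)) / ?k)"
  define \<beta> where "\<beta> = (\<lambda>i. of_int (snd (from_nat i :: int \<times> int)) / ?k)"
  have cs: "discretize m (f x) = c (s x)" "discretize m (b x) = \<beta> (s x)" for x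
    by (simp_all add: c_def \<beta>_def s_def discretize_def)
  \<comment> \<open>all rounded values of functions bounded by \<open>C\<close> lie between \<open>- N\<close> and \<open>N\<close>\<close>
  define N where "N = \<lceil>?k * C\<rceil>"
  define I where "I = to_nat ` ({- N..N} \<times> {- N..N})"
  have floor_bd: "\<lfloor>?k * y\<rfloor> \<in> {- N..N}" if "\<bar>y\<bar> \<le> C" for y
  proof -
    have "\<bar>?k * y\<bar> \<le> ?k * C" using that by (simp add: abs_mult mult_left_mono del: of_nat_Suc)
    then show ?thesis unfolding N_def atLeastAtMost_iff by linarith
  qed
  have I: "finite I" "\<And>x. s x \<in> I"
    using floor_bd[OF f] floor_bd[OF b] by (auto simp: I_def s_def simp del: atLeastAtMost_iff of_nat_Suc)
  have s: "s \<in> measurable \<mu> (count_space UNIV)"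
  proof (subst measurable_count_space_eq2_countable, safe)
    fix i
    have "s -` {i} \<inter> space \<mu> = {x \<in> space \<mu>. to_nat (from_nat i :: int \<times> int) = i
      \<and> \<lfloor>?k * f x\<rfloor> = fst (from_nat i :: int \<times> int) \<and> \<lfloor>?k * b x\<rfloor> = snd (from_nat i :: int \<times> int)}"
      by (auto simp: s_def simp del: of_nat_Suc)
    also have "\<dots> \<in> sets \<mu>" by measurable
    finally show "s -` {i} \<inter> space \<mu> \<in> sets \<mu>" .
  qed auto
  let ?A = "\<lambda>i. {x \<in> B. s x = i}"
  have A: "?A i \<in> sets \<mu>" "emeasure \<mu> (?A i) < \<infinity>" for i
  proof -
    have "?A i = (s -` {i} \<inter> space \<mu>) \<inter> B" using sets.sets_into_space[OF B(1)] by auto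
    then show "?A i \<in> sets \<mu>" using measurable_sets[OF s] B by auto
    then show "emeasure \<mu> (?A i) < \<infinity>"
      using emeasure_mono[of "?A i" B \<mu>] B by (auto intro: le_less_trans)
  qed
  have H: "H r = (\<Sum>i\<in>I. \<beta> i * measure \<mu> (?A i) * G (r + c i))" for r
    unfolding H_def cs using integral_over_cells[OF B s I(1), of "\<lambda>i. \<beta> i * G (r + c i)"] I(2)
    by (simp add: mult_ac)
  show H': "H \<in> borel_measurable borel" unfolding H by measurable
  have AES: "AE \<omega> in M. S \<omega> = (\<Sum>i\<in>I. c i * measure (\<gamma> \<omega>) (?A i)) \<and>
      (LINT x|\<gamma> \<omega>. indicator B x * discretize m (b x)) = (\<Sum>i\<in>I. \<beta> i * measure (\<gamma> \<omega>) (?A i))"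
    using AE_count_finite[OF B] AE_space
  proof eventually_elim
    case (elim \<omega>)
    then have "B \<in> sets (\<gamma> \<omega>)" "s \<in> measurable (\<gamma> \<omega>) (count_space UNIV)"
      using B s by (auto simp: sets_config measurable_cong_sets[OF sets_config[OF elim(2)] refl])
    then show ?case
      unfolding S_def cs using elim I by (intro conjI integral_over_cells) auto
  qed
  have [measurable]: "B \<in> sets \<mu>" by fact
  have Sm [measurable]: "S \<in> borel_measurable M" "(\<lambda>\<omega>. LINT x|\<gamma> \<omega>. indicator B x * discretize m (b x)) \<in> borel_measurable M"
    unfolding S_def by (intro integral_config_measurable; measurable)+
  have Am [measurable]: "(\<lambda>\<omega>. measure (\<gamma> \<omega>) (?A i)) \<in> borel_measurable M" for i
    unfolding measure_def using emeasure_config_measurable[OF A(1)] by measurable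
  let ?T = "\<lambda>w \<omega>. \<Sum>i\<in>I. w i * measure (\<gamma> \<omega>) (?A i)"
  have T: "?T w \<in> borel_measurable M" for w
    by (intro borel_measurable_sum borel_measurable_times borel_measurable_const Am)
  have GT: "(\<lambda>\<omega>. G (?T c \<omega> + r)) \<in> borel_measurable M" for r
    by (intro measurable_compose[OF _ G0] borel_measurable_add borel_measurable_const T)
  have "expectation (\<lambda>\<omega>. (LINT x|\<gamma> \<omega>. indicator B x * discretize m (b x)) * G (S \<omega>))
    = expectation (\<lambda>\<omega>. (\<Sum>i\<in>I. \<beta> i * measure (\<gamma> \<omega>) (?A i)) * G (\<Sum>j\<in>I. c j * measure (\<gamma> \<omega>) (?A j)))"
  proof (rule integral_cong_AE)
    show "(\<lambda>\<omega>. ?T \<beta> \<omega> * G (?T c \<omega>)) \<in> borel_measurable M"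
      using T GT[of 0] by (intro borel_measurable_times) auto
    show "(\<lambda>\<omega>. (LINT x|\<gamma> \<omega>. indicator B x * discretize m (b x)) * G (S \<omega>)) \<in> borel_measurable M"
      by (intro borel_measurable_times Sm measurable_compose[OF _ G0])
    show "AE \<omega> in M. (LINT x|\<gamma> \<omega>. indicator B x * discretize m (b x)) * G (S \<omega>) = ?T \<beta> \<omega> * G (?T c \<omega>)"
      using AES by eventually_elim simp
  qed
  also have "\<dots> = expectation (\<lambda>\<omega>. \<Sum>i\<in>I. \<beta> i * measure \<mu> (?A i) * G ((\<Sum>j\<in>I. c j * measure (\<gamma> \<omega>) (?A j)) + c i))"
    by (rule mecke_simple) (use I A G in \<open>auto simp: disjoint_family_on_def\<close>)
  also have "\<dots> = expectation (\<lambda>\<omega>. H (S \<omega>))"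
  proof (rule integral_cong_AE)
    show "(\<lambda>\<omega>. \<Sum>i\<in>I. \<beta> i * measure \<mu> (?A i) * G (?T c \<omega> + c i)) \<in> borel_measurable M"
      by (intro borel_measurable_sum borel_measurable_times borel_measurable_const GT)
    show "(\<lambda>\<omega>. H (S \<omega>)) \<in> borel_measurable M" by (intro measurable_compose[OF _ H'] Sm)
    show "AE \<omega> in M. (\<Sum>i\<in>I. \<beta> i * measure \<mu> (?A i) * G (?T c \<omega> + c i)) = H (S \<omega>)"
      using AES by eventually_elim (simp add: H)
  qed
  finally show "expectation (\<lambda>\<omega>. (LINT x|\<gamma> \<omega>. indicator B x * discretize m (b x)) * G (S \<omega>)) = expectation (\<lambda>\<omega>. H (S \<omega>))" .
qed

text \<open>
  The discretised formula passes to the limit by dominated convergence: on the left the integrand is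
  at most a constant times the number of points in \<open>B\<close>, on the right at most a constant. Continuity of \<open>G\<close>
  is what makes both integrands converge.
\<close>

theorem mecke_formula:
  fixes f b :: "'a \<Rightarrow> real"
  assumes B: "B \<in> sets \<mu>" "emeasure \<mu> B < \<infinity>"
    and fm [measurable]: "f \<in> borel_measurable \<mu>" and bm [measurable]: "b \<in> borel_measurable \<mu>"
    and f: "\<And>x. \<bar>f x\<bar> \<le> C" "\<And>x. x \<notin> B \<Longrightarrow> f x = 0" and b: "\<And>x. \<bar>b x\<bar> \<le> C" "\<And>x. x \<notin> B \<Longrightarrow> b x = 0"
    and Gc: "continuous_on UNIV G" and G: "\<And>y. \<bar>G y\<bar> \<le> D"
  shows "expectation (\<lambda>\<omega>. (LINT x|\<gamma> \<omega>. b x) * G (LINT x|\<gamma> \<omega>. f x))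
    = expectation (\<lambda>\<omega>. LINT x|\<mu>. b x * G ((LINT x|\<gamma> \<omega>. f x) + f x))" 
    and "integrable M (\<lambda>\<omega>. (LINT x|\<gamma> \<omega>. b x) * G (LINT x|\<gamma> \<omega>. f x))"
    and "(\<lambda>r. LINT x|\<mu>. b x * G (r + f x)) \<in> borel_measurable borel"
proof -
  have Gm [measurable]: "G \<in> borel_measurable borel" by (rule borel_measurable_continuous_onI[OF Gc])
  have [measurable]: "B \<in> sets \<mu>" by fact
  have CD: "0 \<le> C" "0 \<le> D" using order_trans[OF abs_ge_zero f(1)] order_trans[OF abs_ge_zero G] by auto
  let ?S = "\<lambda>\<omega>. LINT x|\<gamma> \<omega>. f x"
  let ?L = "\<lambda>\<omega>. (LINT x|\<gamma> \<omega>. b x) * G (?S \<omega>)"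
  let ?H = "\<lambda>r. LINT x|\<mu>. b x * G (r + f x)"
  let ?Sm = "\<lambda>m \<omega>. LINT x|\<gamma> \<omega>. indicator B x * discretize m (f x)"
  let ?Bm = "\<lambda>m \<omega>. LINT x|\<gamma> \<omega>. indicator B x * discretize m (b x)"
  let ?h = "\<lambda>m r x. indicator B x * (discretize m (b x) * G (r + discretize m (f x)))"
  let ?Hm = "\<lambda>m r. LINT x|\<mu>. ?h m r x"
  have Sm [measurable]: "?S \<in> borel_measurable M" "?Sm m \<in> borel_measurable M" "?Bm m \<in> borel_measurable M"
    "(\<lambda>\<omega>. LINT x|\<gamma> \<omega>. b x) \<in> borel_measurable M" for m
    by (intro integral_config_measurable; measurable)+
  have conv: "AE \<omega> in M. (\<lambda>m. ?Sm m \<omega>) \<longlonglongrightarrow> ?S \<omega> \<and> (\<lambda>m. ?Bm m \<omega>) \<longlonglongrightarrow> (LINT x|\<gamma> \<omega>. b x)"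
    using AE_count_finite[OF B] AE_space
  proof eventually_elim
    case (elim \<omega>)
    then show ?case using B f b fm bm
      by (intro conjI integral_discretize_tendsto[where C=C]) (auto simp: sets_config measurable_config)
  qed
  have Gt: "(\<lambda>m. G (X m)) \<longlonglongrightarrow> G x" if "X \<longlonglongrightarrow> x" for X x
    by (rule continuous_on_tendsto_compose[OF Gc that]) auto
  have hb: "\<bar>?h m r x\<bar> \<le> (C + 1) * D" for m r x
  proof -
    have "\<bar>discretize m (b x) * G (r + discretize m (f x))\<bar> \<le> (C + 1) * D"
      unfolding abs_mult using CD by (intro mult_mono discretize_bound b G) auto
    then show ?thesis using CD by (auto simp: indicator_def)
  qed
  have Hm_bound: "\<bar>?Hm m r\<bar> \<le> (C + 1) * D * measure \<mu> B" for m r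
  proof (rule integral_supported_bound(2)[OF B _ hb])
    have "(\<lambda>x. G (r + discretize m (f x))) \<in> borel_measurable \<mu>"
      by (intro measurable_compose[OF _ Gm] borel_measurable_add borel_measurable_const
          measurable_compose[OF fm discretize_measurable])
    then show "?h m r \<in> borel_measurable \<mu>" by measurable
  qed simp
  have Hconv: "(\<lambda>m. ?Hm m (r m)) \<longlonglongrightarrow> ?H r0" if r: "r \<longlonglongrightarrow> r0" for r r0
  proof (rule integral_dominated_convergence[where w="\<lambda>x. ((C + 1) * D) * indicator B x"])
    show "integrable \<mu> (\<lambda>x. ((C + 1) * D) * indicator B x)" using B by (simp add: integrable_real_indicator)
    show "AE x in \<mu>. (\<lambda>m. ?h m (r m) x) \<longlonglongrightarrow> b x * G (r0 + f x)"
    proof (rule AE_I2)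
      fix x
      have "(\<lambda>m. ?h m (r m) x) \<longlonglongrightarrow> indicator B x * (b x * G (r0 + f x))"
        by (intro tendsto_mult tendsto_const discretize_tendsto Gt tendsto_add r)
      then show "(\<lambda>m. ?h m (r m) x) \<longlonglongrightarrow> b x * G (r0 + f x)" using b(2)[of x] by (cases "x \<in> B") auto
    qed
    show "AE x in \<mu>. norm (?h m (r m) x) \<le> ((C + 1) * D) * indicator B x" for m
    proof (rule AE_I2)
      fix x
      have "norm (?h m (r m) x) \<le> (C + 1) * D" unfolding real_norm_def by (rule hb)
      then show "norm (?h m (r m) x) \<le> ((C + 1) * D) * indicator B x" by (cases "x \<in> B") auto
    qed
  qed measurable
  have Hm [measurable]: "?Hm m \<in> borel_measurable borel" for m
    by (rule mecke_discretized(2)[OF B fm bm f(1) b(1) Gm G])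
  show Hmeas [measurable]: "?H \<in> borel_measurable borel"
    by (rule borel_measurable_LIMSEQ_real[OF Hconv[OF tendsto_const] Hm])
  have eq: "expectation (\<lambda>\<omega>. ?Bm m \<omega> * G (?Sm m \<omega>)) = expectation (\<lambda>\<omega>. ?Hm m (?Sm m \<omega>))" for m
    by (rule mecke_discretized(1)[OF B fm bm f(1) b(1) Gm G])
  have dom: "AE \<omega> in M. norm (?Bm m \<omega> * G (?Sm m \<omega>)) \<le> ((C + 1) * D) * measure (\<gamma> \<omega>) B" for m
  proof -
    have "AE \<omega> in M. \<bar>?Bm m \<omega>\<bar> \<le> (C + 1) * measure (\<gamma> \<omega>) B"
      by (rule integrable_config_integral[OF B]) (use CD in \<open>auto simp: indicator_def intro: discretize_bound[OF b(1)]\<close>)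
    then show ?thesis
    proof eventually_elim
      case (elim \<omega>)
      have "\<bar>?Bm m \<omega> * G (?Sm m \<omega>)\<bar> \<le> ((C + 1) * measure (\<gamma> \<omega>) B) * D"
        unfolding abs_mult using CD by (intro mult_mono elim G) auto
      then show ?case by (simp add: mult_ac)
    qed
  qed
  have w: "integrable M (\<lambda>\<omega>. ((C + 1) * D) * measure (\<gamma> \<omega>) B)" using integrable_count[OF B] by simp
  have limL: "AE \<omega> in M. (\<lambda>m. ?Bm m \<omega> * G (?Sm m \<omega>)) \<longlonglongrightarrow> ?L \<omega>"
    using conv by eventually_elim (auto intro: tendsto_mult Gt)
  show "integrable M ?L"
    by (rule integrable_dominated_convergence[OF _ _ w limL dom]) measurable
  have "(\<lambda>m. expectation (\<lambda>\<omega>. ?Bm m \<omega> * G (?Sm m \<omega>))) \<longlonglongrightarrow> expectation ?L"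
    by (rule integral_dominated_convergence[OF _ _ w limL dom]) measurable
  moreover have "(\<lambda>m. expectation (\<lambda>\<omega>. ?Hm m (?Sm m \<omega>))) \<longlonglongrightarrow> expectation (\<lambda>\<omega>. ?H (?S \<omega>))"
  proof (rule integral_dominated_convergence[where w="\<lambda>_. (C + 1) * D * measure \<mu> B"])
    show "AE \<omega> in M. (\<lambda>m. ?Hm m (?Sm m \<omega>)) \<longlonglongrightarrow> ?H (?S \<omega>)"
      using conv by eventually_elim (auto intro: Hconv)
    show "AE \<omega> in M. norm (?Hm m (?Sm m \<omega>)) \<le> (C + 1) * D * measure \<mu> B" for m
      unfolding real_norm_def by (intro AE_I2 Hm_bound)
  qed measurable
  ultimately show "expectation ?L = expectation (\<lambda>\<omega>. ?H (?S \<omega>))"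
    unfolding eq by (rule LIMSEQ_unique)
qed

end

section \<open>Compensated integrals in mean\<close>

text \<open>
  A truncated form of \<open>|y| \<le> c / 2 + y\<^sup>2 / (2 * c)\<close>. The truncation level \<open>2 * c\<close> is the smallest one for which
  the inequality survives for large \<open>y\<close>.
\<close>

lemma truncation_bound:
  fixes y c :: real
  assumes "0 < c"
  shows "\<bar>y\<bar> \<le> c / 2 + y * max (- 2 * c) (min y (2 * c)) / (2 * c)"
proof -
  consider "y > 2 * c" | "y < - 2 * c" | "- 2 * c \<le> y" "y \<le> 2 * c" by linarith
  then show ?thesis
  proof cases
    case 3
    have "0 \<le> (\<bar>y\<bar> - c)\<^sup>2" by simp
    then have "2 * c * \<bar>y\<bar> \<le> c\<^sup>2 + y\<^sup>2" by (simp add: power2_diff mult_ac)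
    then show ?thesis using 3 assms by (simp add: field_simps power2_eq_square min_def max_def)
  qed (use assms in \<open>auto simp: min_def max_def field_simps\<close>)
qed

context poisson_process
begin

text \<open>
  The compensated integral \<open>Z\<close> of \<open>b\<close> has second moment \<open>\<integral> b\<^sup>2\<close>. Since \<open>mecke_formula\<close> concerns bounded
  functions \<open>G\<close>, one factor of \<open>Z\<^sup>2\<close> is truncated to \<open>t(Z)\<close>. Then \<open>E Z t(Z)\<close> is the mean of
  \<open>\<integral> b(x) (t(Z + b(x)) - t(Z)) dx\<close>, which is at most \<open>\<integral> b\<^sup>2\<close> as \<open>t\<close> is 1-Lipschitz, and
  \<open>truncation_bound\<close> converts this into a bound for \<open>E |Z|\<close>.
\<close>

lemma compensated_L1_bound:
  fixes b :: "'a \<Rightarrow> real"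
  assumes B: "B \<in> sets \<mu>" "emeasure \<mu> B < \<infinity>" and bm [measurable]: "b \<in> borel_measurable \<mu>"
    and b: "\<And>x. \<bar>b x\<bar> \<le> C" "\<And>x. x \<notin> B \<Longrightarrow> b x = 0"
    and c: "0 < c" "(LINT x|\<mu>. (b x)\<^sup>2) \<le> c\<^sup>2"
  shows "expectation (\<lambda>\<omega>. \<bar>(LINT x|\<gamma> \<omega>. b x) - (LINT x|\<mu>. b x)\<bar>) \<le> c"
proof -
  let ?m = "LINT x|\<mu>. b x"
  define t where "t = (\<lambda>y. max (- 2 * c) (min y (2 * c)))"
  let ?Z = "\<lambda>\<omega>. (LINT x|\<gamma> \<omega>. b x) - ?m"
  have tb: "\<bar>t y\<bar> \<le> 2 * c" for y using c by (auto simp: t_def)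
  have t1: "\<bar>t y - t z\<bar> \<le> \<bar>y - z\<bar>" for y z by (auto simp: t_def min_def max_def)
  have bi: "integrable M (\<lambda>\<omega>. LINT x|\<gamma> \<omega>. b x)" by (rule integrable_config_integral[OF B bm b])
  have Zm [measurable]: "?Z \<in> borel_measurable M" using bi by measurable
  have b\<mu>: "integrable \<mu> b" by (rule integral_supported_bound[OF B bm b])
  have C: "0 \<le> C" using order_trans[OF abs_ge_zero b(1)] by auto
  have b2: "integrable \<mu> (\<lambda>x. (b x)\<^sup>2)"
    by (rule integral_supported_bound[OF B, where C="C\<^sup>2"])
       (use b abs_le_square_iff[of "b _" C] C in auto)
  have [measurable]: "t \<in> borel_measurable borel" unfolding t_def by measurable
  have cont: "continuous_on UNIV (\<lambda>y. t (y - ?m))" unfolding t_def by (intro continuous_intros)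
  have mecke: "expectation (\<lambda>\<omega>. (LINT x|\<gamma> \<omega>. b x) * t (?Z \<omega>)) = expectation (\<lambda>\<omega>. LINT x|\<mu>. b x * t (?Z \<omega> + b x))"
  proof -
    have "expectation (\<lambda>\<omega>. (LINT x|\<gamma> \<omega>. b x) * t (?Z \<omega>)) = expectation (\<lambda>\<omega>. LINT x|\<mu>. b x * t ((LINT x|\<gamma> \<omega>. b x) + b x - ?m))"
      by (rule mecke_formula(1)[OF B bm bm b b cont tb])
    then show ?thesis by (simp only: add_diff_eq diff_add_eq)
  qed
  have mecke_int: "integrable M (\<lambda>\<omega>. (LINT x|\<gamma> \<omega>. b x) * t (?Z \<omega>))"
    by (rule mecke_formula(2)[OF B bm bm b b cont tb])
  have tZ: "integrable M (\<lambda>\<omega>. t (?Z \<omega>))" by (rule integrable_const_bound[where B="2*c"]) (auto simp: tb)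
  have int: "integrable M (\<lambda>\<omega>. ?Z \<omega> * t (?Z \<omega>))"
    using Bochner_Integration.integrable_diff[OF mecke_int integrable_mult_right[OF tZ, of ?m]]
    by (simp add: left_diff_distrib)
  have "expectation (\<lambda>\<omega>. ?Z \<omega> * t (?Z \<omega>))
      = expectation (\<lambda>\<omega>. (LINT x|\<gamma> \<omega>. b x) * t (?Z \<omega>)) - expectation (\<lambda>\<omega>. ?m * t (?Z \<omega>))"
    using Bochner_Integration.integral_diff[OF mecke_int integrable_mult_right[OF tZ, of ?m]]
    by (simp add: left_diff_distrib)
  also have "\<dots> = expectation (\<lambda>\<omega>. LINT x|\<mu>. b x * t (?Z \<omega> + b x)) - expectation (\<lambda>\<omega>. ?m * t (?Z \<omega>))"
    by (simp only: mecke)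
  also have "\<dots> \<le> c\<^sup>2"
  proof -
    have bt: "integrable \<mu> (\<lambda>x. b x * t (r + b x))" "\<bar>LINT x|\<mu>. b x * t (r + b x)\<bar> \<le> (C * (2 * c)) * measure \<mu> B" for r
    proof -
      have 1: "\<bar>b x * t (r + b x)\<bar> \<le> C * (2 * c)" "x \<notin> B \<Longrightarrow> b x * t (r + b x) = 0" for x
        using b C c unfolding abs_mult by (auto intro!: mult_mono tb)
      have 2: "(\<lambda>x. b x * t (r + b x)) \<in> borel_measurable \<mu>" by measurable
      show "integrable \<mu> (\<lambda>x. b x * t (r + b x))" "\<bar>LINT x|\<mu>. b x * t (r + b x)\<bar> \<le> (C * (2 * c)) * measure \<mu> B"
        by (rule integral_supported_bound[OF B 2 1]; assumption)+
    qed
    have bts: "(LINT x|\<mu>. b x * t (r + b x)) \<le> c\<^sup>2 + ?m * t r" for r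
    proof -
      have "b x * t (r + b x) \<le> (b x)\<^sup>2 + b x * t r" for x
      proof -
        have "b x * (t (r + b x) - t r) \<le> \<bar>b x\<bar> * \<bar>t (r + b x) - t r\<bar>" by (metis abs_ge_self abs_mult)
        also have "\<dots> \<le> \<bar>b x\<bar> * \<bar>b x\<bar>" using t1[of "r + b x" r] by (intro mult_left_mono) auto
        finally show ?thesis by (simp add: right_diff_distrib power2_eq_square)
      qed
      then have "(LINT x|\<mu>. b x * t (r + b x)) \<le> (LINT x|\<mu>. (b x)\<^sup>2 + b x * t r)"
        by (intro integral_mono bt Bochner_Integration.integrable_add b2 integrable_mult_left b\<mu>) auto
      also have "\<dots> = (LINT x|\<mu>. (b x)\<^sup>2) + ?m * t r" using b2 b\<mu> by simp
      finally show ?thesis using c by simp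
    qed
    have m2: "(\<lambda>r. LINT x|\<mu>. b x * t (r + b x)) \<in> borel_measurable borel"
    proof -
      have "continuous_on UNIV t" unfolding t_def by (intro continuous_intros)
      from mecke_formula(3)[OF B bm bm b b this tb] show ?thesis by blast
    qed
    have "expectation (\<lambda>\<omega>. LINT x|\<mu>. b x * t (?Z \<omega> + b x)) \<le> expectation (\<lambda>\<omega>. c\<^sup>2 + ?m * t (?Z \<omega>))"
    proof (rule integral_mono)
      show "integrable M (\<lambda>\<omega>. LINT x|\<mu>. b x * t (?Z \<omega> + b x))"
        by (intro integrable_const_bound[where B="(C * (2 * c)) * measure \<mu> B"] AE_I2 measurable_compose[OF Zm m2])
           (simp only: real_norm_def bt)
      show "integrable M (\<lambda>\<omega>. c\<^sup>2 + ?m * t (?Z \<omega>))" using tZ by simp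
    qed (rule bts)
    also have "\<dots> = c\<^sup>2 + expectation (\<lambda>\<omega>. ?m * t (?Z \<omega>))" using tZ by (simp add: prob_space)
    finally show ?thesis by simp
  qed
  finally have *: "expectation (\<lambda>\<omega>. ?Z \<omega> * t (?Z \<omega>)) \<le> c\<^sup>2" .
  have "expectation (\<lambda>\<omega>. \<bar>?Z \<omega>\<bar>) \<le> expectation (\<lambda>\<omega>. c / 2 + ?Z \<omega> * t (?Z \<omega>) / (2 * c))"
    by (intro integral_mono) (use bi int truncation_bound[OF c(1)] in \<open>auto simp: t_def\<close>)
  also have "\<dots> = c / 2 + expectation (\<lambda>\<omega>. ?Z \<omega> * t (?Z \<omega>)) / (2 * c)"
    using int by (simp add: prob_space)
  also have "\<dots> \<le> c / 2 + c\<^sup>2 / (2 * c)" using * c by (intro add_left_mono divide_right_mono) auto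
  also have "\<dots> = c" using c by (simp add: power2_eq_square)
  finally show ?thesis .
qed

end

section \<open>Lipschitz functions of a random variable\<close>

text \<open>
  The average of \<open>h\<close> over \<open>[x, x + \<epsilon>]\<close> is continuously differentiable, and its derivative is a
  difference quotient of \<open>h\<close>.
\<close>

lemma smooth_lipschitz_approx:
  fixes h :: "real \<Rightarrow> real"
  assumes h: "1-lipschitz_on UNIV h" and e: "0 < \<epsilon>"
  obtains k g where "\<And>x. DERIV k x :> g x" "continuous_on UNIV g" "\<And>x. \<bar>g x\<bar> \<le> 1" "\<And>x. \<bar>k x - h x\<bar> \<le> \<epsilon>"
proof -
  have L: "\<bar>h x - h y\<bar> \<le> \<bar>x - y\<bar>" for x y using lipschitz_onD[OF h, of x y] by (simp add: dist_real_def)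
  have hc: "continuous_on UNIV h" by (rule lipschitz_on_continuous_on[OF h])
  obtain H where H: "\<And>x. DERIV H x :> h x"
    using einterval_antiderivative[of "-\<infinity>" "\<infinity>" h] hc
    by (auto simp: continuous_on_eq_continuous_at has_real_derivative_iff_has_vector_derivative)
  let ?k = "\<lambda>x. (H (x + \<epsilon>) - H x) / \<epsilon>" and ?g = "\<lambda>x. (h (x + \<epsilon>) - h x) / \<epsilon>"
  show ?thesis
  proof (rule that[of ?k ?g])
    show "DERIV ?k x :> ?g x" for x
      using DERIV_diff[OF DERIV_shift[THEN iffD1, OF H[of "x + \<epsilon>"]] H[of x]] by (rule DERIV_cdivide)
    show "continuous_on UNIV ?g"
      by (intro continuous_intros continuous_on_compose2[OF hc]) (use e in auto)
    show "\<bar>?g x\<bar> \<le> 1" for x using L[of "x + \<epsilon>" x] e by (simp add: abs_divide)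
    show "\<bar>?k x - h x\<bar> \<le> \<epsilon>" for x
    proof -
      obtain z where z: "x < z" "z < x + \<epsilon>" "H (x + \<epsilon>) - H x = (x + \<epsilon> - x) * h z"
        using MVT2[of x "x + \<epsilon>" H h] H e by auto
      then have "?k x = h z" using e by simp
      then show ?thesis using L[of z x] z by simp
    qed
  qed
qed

lemma lipschitz_integrable:
  fixes X :: "'a \<Rightarrow> real"
  assumes "prob_space M" "integrable M X" and h: "1-lipschitz_on UNIV h"
  shows "integrable M (\<lambda>x. h (X x) :: real)"
proof -
  interpret prob_space M by fact
  have [measurable]: "h \<in> borel_measurable borel"
    by (rule borel_measurable_continuous_onI[OF lipschitz_on_continuous_on[OF h]])
  have X: "X \<in> borel_measurable M" using assms by auto
  have "\<bar>h y\<bar> \<le> \<bar>h 0\<bar> + \<bar>y\<bar>" for y using lipschitz_onD[OF h, of y 0] by (simp add: dist_real_def)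
  then have "AE x in M. norm (h (X x)) \<le> norm (\<bar>h 0\<bar> + \<bar>X x\<bar>)" by simp
  moreover have "integrable M (\<lambda>x. \<bar>h 0\<bar> + \<bar>X x\<bar>)" using assms(2) by simp
  moreover have "(\<lambda>x. h (X x)) \<in> borel_measurable M" using X by measurable
  ultimately show ?thesis using Bochner_Integration.integrable_bound by blast
qed

lemma derivative_bound_lipschitz:
  fixes k :: "real \<Rightarrow> real"
  assumes "\<And>x. DERIV k x :> g x" "\<And>x. \<bar>g x\<bar> \<le> 1"
  shows "1-lipschitz_on UNIV k"
proof (rule lipschitz_onI)
  show "dist (k x) (k y) \<le> 1 * dist x y" for x y
    unfolding dist_norm
    by (rule field_differentiable_bound[of UNIV k g]) (use assms in auto)
qed simp

lemma expectation_diff_le: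
  fixes X Y :: "'a \<Rightarrow> real"
  assumes "prob_space M" "integrable M X" "integrable M Y" and le: "AE x in M. \<bar>X x - Y x\<bar> \<le> c"
  shows "\<bar>(LINT x|M. X x) - (LINT x|M. Y x)\<bar> \<le> c"
proof -
  interpret prob_space M by fact
  have "\<bar>(LINT x|M. X x) - (LINT x|M. Y x)\<bar> = \<bar>LINT x|M. X x - Y x\<bar>" using assms by simp
  also have "\<dots> \<le> (LINT x|M. \<bar>X x - Y x\<bar>)" by simp
  also have "\<dots> \<le> (LINT x|M. c)" using assms by (intro integral_mono_AE) auto
  finally show ?thesis by (simp add: prob_space)
qed

lemma integrable_std_normal_id: "integrable std_normal_distribution (\<lambda>x. x)"
proof -
  have "integrable lborel (\<lambda>x. std_normal_density x *\<^sub>R x)"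
    using integrable_std_normal_moment[of 1] by simp
  then show ?thesis by (subst integrable_density) auto
qed

lemma lipschitz_expectation_diff:
  fixes U V :: "'a \<Rightarrow> real"
  assumes P: "prob_space M" and U: "integrable M U" and V: "integrable M V" and h: "1-lipschitz_on UNIV (h :: real \<Rightarrow> real)"
  shows "\<bar>(LINT x|M. h (U x)) - (LINT x|M. h (V x))\<bar> \<le> (LINT x|M. \<bar>U x - V x\<bar>)"
proof -
  note i = lipschitz_integrable[OF P U h] lipschitz_integrable[OF P V h]
  have "\<bar>(LINT x|M. h (U x)) - (LINT x|M. h (V x))\<bar> = \<bar>LINT x|M. h (U x) - h (V x)\<bar>" using i by simp
  also have "\<dots> \<le> (LINT x|M. \<bar>h (U x) - h (V x)\<bar>)" by simp
  also have "\<dots> \<le> (LINT x|M. \<bar>U x - V x\<bar>)"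
    using i U V lipschitz_onD[OF h] by (intro integral_mono) (auto simp: dist_real_def)
  finally show ?thesis .
qed

section \<open>The bound for smooth functions\<close>

text \<open>
  What the calculation uses of a test function: it vanishes outside the open ball and has a bounded
  continuous derivative \<open>df\<close> in the direction \<open>e\<close>.
\<close>

locale supported_function =
  fixes f df :: "'a::euclidean_space \<Rightarrow> real" and e :: 'a and R C D :: real
  assumes e: "norm e = 1" and R: "0 < R"
    and f_cont: "continuous_on UNIV f" and df_cont: "continuous_on UNIV df"
    and f_deriv: "\<And>x t. ((\<lambda>s. f (x + s *\<^sub>R e)) has_real_derivative df (x + t *\<^sub>R e)) (at t)"
    and f_zero: "\<And>x. R \<le> norm x \<Longrightarrow> f x = 0" and df_zero: "\<And>x. x \<notin> cball 0 R \<Longrightarrow> df x = 0"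
    and f_bound: "\<And>x. \<bar>f x\<bar> \<le> C" and df_bound: "\<And>x. \<bar>df x\<bar> \<le> D"
begin

lemma f_measurable [measurable]: "f \<in> borel_measurable borel"
  by (rule borel_measurable_continuous_onI[OF f_cont])

lemma df_measurable [measurable]: "df \<in> borel_measurable borel"
  by (rule borel_measurable_continuous_onI[OF df_cont])

lemma C_nonneg: "0 \<le> C" and D_nonneg: "0 \<le> D"
  using order_trans[OF abs_ge_zero f_bound] order_trans[OF abs_ge_zero df_bound] by auto

lemma f_zero_off_ball: "x \<notin> cball 0 R \<Longrightarrow> f x = 0" by (rule f_zero) simp

lemma ball_finite: "cball (0::'a) R \<in> sets lborel" "emeasure lborel (cball (0::'a) R) < \<infinity>"
  using emeasure_bounded_finite[OF bounded_cball, of "0::'a" R] by auto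

lemma composition_bounded:
  assumes "continuous_on UNIV \<Psi>"
  obtains E where "\<And>x. \<bar>\<Psi> (f x) :: real\<bar> \<le> E"
proof -
  have "compact (\<Psi> ` {-C..C})"
    by (intro compact_continuous_image continuous_on_subset[OF assms]) auto
  then obtain E where E: "\<And>y. y \<in> {-C..C} \<Longrightarrow> \<bar>\<Psi> y\<bar> \<le> E"
    using compact_imp_bounded bounded_iff by (metis imageI real_norm_def)
  moreover have "f x \<in> {-C..C}" for x using f_bound[of x] by (simp add: abs_le_iff)
  ultimately show ?thesis using that by blast
qed

lemma integral_by_parts_composed:
  assumes k: "k \<in> borel_measurable borel" "\<And>x. \<bar>k x\<bar> \<le> K" "\<And>x. x \<notin> cball 0 R \<Longrightarrow> k x = 0"
    and \<Psi>: "\<And>y. DERIV \<Psi> y :> \<Psi>' y" "continuous_on UNIV \<Psi>'" "\<Psi> 0 = 0"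
  shows "(LINT x|lborel. k x * \<Psi> (f x)) = - (LINT x|lborel. segment_integral (2 * R) e k x * (\<Psi>' (f x) * df x))"
proof -
  obtain E where E: "\<And>x. \<bar>\<Psi>' (f x)\<bar> \<le> E" using composition_bounded[OF \<Psi>(2)] by blast
  have E0: "0 \<le> E" using order_trans[OF abs_ge_zero E] by auto
  show ?thesis
  proof (rule integral_by_parts_along_segments[OF e R k])
    show "((\<lambda>s. \<Psi> (f (x + s *\<^sub>R e))) has_real_derivative \<Psi>' (f (x + t *\<^sub>R e)) * df (x + t *\<^sub>R e)) (at t)" for x t
      by (rule DERIV_chain2[OF \<Psi>(1) f_deriv])
    show "continuous_on UNIV (\<lambda>x. \<Psi>' (f x) * df x)"
      by (intro continuous_intros df_cont continuous_on_compose2[OF \<Psi>(2) f_cont]) auto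
    show "\<bar>\<Psi>' (f x) * df x\<bar> \<le> E * D" for x
      unfolding abs_mult using E E0 df_bound D_nonneg by (intro mult_mono) auto
  qed (simp_all add: f_zero df_zero \<Psi>(3))
qed

text \<open>
  With \<open>V\<close> the segment integral and \<open>\<partial>\<close> the derivative along \<open>e\<close>, the two kernels are \<open>(V f) \<partial>f\<close> and
  \<open>(V ((V f) \<partial>f)) \<partial>f\<close>: the weights that remain after one and after two integrations by parts.
\<close>

definition kernel1 :: "'a \<Rightarrow> real" where "kernel1 x = segment_integral (2 * R) e f x * df x"

definition kernel2 :: "'a \<Rightarrow> real" where "kernel2 x = segment_integral (2 * R) e kernel1 x * df x"

lemma kernel1_measurable [measurable]: "kernel1 \<in> borel_measurable borel"
  unfolding kernel1_def[abs_def] by measurable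

lemma kernel2_measurable [measurable]: "kernel2 \<in> borel_measurable borel"
  unfolding kernel2_def[abs_def] by measurable

lemma kernel1_bound: "\<bar>kernel1 x\<bar> \<le> 2 * R * C * D"
  unfolding kernel1_def abs_mult using R C_nonneg D_nonneg
  by (intro mult_mono segment_integral_bound f_bound df_bound f_measurable) auto

lemma kernel2_bound: "\<bar>kernel2 x\<bar> \<le> 2 * R * (2 * R * C * D) * D"
  unfolding kernel2_def abs_mult using R C_nonneg D_nonneg
  by (intro mult_mono segment_integral_bound kernel1_bound df_bound kernel1_measurable) auto

lemma kernel1_zero: "x \<notin> cball 0 R \<Longrightarrow> kernel1 x = 0"
  unfolding kernel1_def using df_zero by simp

lemma kernel2_zero: "x \<notin> cball 0 R \<Longrightarrow> kernel2 x = 0"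
  unfolding kernel2_def using df_zero by simp

lemma integrable_kernel_times:
  assumes "k \<in> borel_measurable borel" "\<And>x. \<bar>k x\<bar> \<le> K" "\<And>x. x \<notin> cball 0 R \<Longrightarrow> k x = 0"
    and "continuous_on UNIV \<Psi>"
  shows "integrable lborel (\<lambda>x. k x * \<Psi> (f x) :: real)"
proof -
  obtain E where E: "\<And>x. \<bar>\<Psi> (f x)\<bar> \<le> E" using composition_bounded[OF assms(4)] by blast
  have [measurable]: "\<Psi> \<in> borel_measurable borel" "k \<in> borel_measurable borel"
    using borel_measurable_continuous_onI assms by auto
  have 0: "0 \<le> E" "0 \<le> K" using order_trans[OF abs_ge_zero E] order_trans[OF abs_ge_zero assms(2)] by auto
  show ?thesis
  proof (rule integrable_bounded_support[OF _ ball_finite])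
    show "\<bar>k x * \<Psi> (f x)\<bar> \<le> K * E" for x
      unfolding abs_mult using 0 by (intro mult_mono assms E) auto
  qed (use assms(3) in auto)
qed

lemma integrable_f_times: "continuous_on UNIV \<Psi> \<Longrightarrow> integrable lborel (\<lambda>x. f x * \<Psi> (f x))"
  by (rule integrable_kernel_times[OF f_measurable f_bound f_zero_off_ball])

lemma integrable_kernel1_times: "continuous_on UNIV \<Psi> \<Longrightarrow> integrable lborel (\<lambda>x. kernel1 x * \<Psi> (f x))"
  by (rule integrable_kernel_times[OF kernel1_measurable kernel1_bound kernel1_zero])

lemma parts_f:
  assumes "\<And>y. DERIV \<Psi> y :> \<Psi>' y" "continuous_on UNIV \<Psi>'" "\<Psi> 0 = 0"
  shows "(LINT x|lborel. f x * \<Psi> (f x)) = - (LINT x|lborel. kernel1 x * \<Psi>' (f x))"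
proof -
  have "(LINT x|lborel. f x * \<Psi> (f x)) = - (LINT x|lborel. segment_integral (2 * R) e f x * (\<Psi>' (f x) * df x))"
    by (rule integral_by_parts_composed[OF f_measurable f_bound f_zero_off_ball assms])
  then show ?thesis by (simp add: kernel1_def mult_ac)
qed

lemma parts_kernel1:
  assumes "\<And>y. DERIV \<Psi> y :> \<Psi>' y" "continuous_on UNIV \<Psi>'" "\<Psi> 0 = 0"
  shows "(LINT x|lborel. kernel1 x * \<Psi> (f x)) = - (LINT x|lborel. kernel2 x * \<Psi>' (f x))"
proof -
  have "(LINT x|lborel. kernel1 x * \<Psi> (f x)) = - (LINT x|lborel. segment_integral (2 * R) e kernel1 x * (\<Psi>' (f x) * df x))"
    by (rule integral_by_parts_composed[OF kernel1_measurable kernel1_bound kernel1_zero assms])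
  then show ?thesis by (simp add: kernel2_def mult_ac)
qed

lemma integral_kernel1: "(LINT x|lborel. kernel1 x) = - (LINT x|lborel. (f x)\<^sup>2)"
  using parts_f[of "\<lambda>y. y" "\<lambda>_. 1"] by (simp add: power2_eq_square)

text \<open>
  By parts, \<open>\<integral> kernel2 = - \<integral> kernel1 f\<close>. Since \<open>f \<partial>f\<close> is the derivative of \<open>f\<^sup>2 / 2\<close>, a second integration
  by parts, now in the reverse direction, yields \<open>\<integral> f (f\<^sup>2 / 2)\<close>. This is where the third moment
  without absolute values comes from.
\<close>

lemma integral_kernel2: "(LINT x|lborel. kernel2 x) = (LINT x|lborel. (f x) ^ 3) / 2"
proof -
  have "(LINT x|lborel. kernel2 x) = - (LINT x|lborel. kernel1 x * f x)"
    using parts_kernel1[of "\<lambda>y. y" "\<lambda>_. 1"] by simp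
  also have "\<dots> = (LINT x|lborel. f x * ((f x)\<^sup>2 / 2))"
  proof -
    have "DERIV (\<lambda>y::real. y\<^sup>2 / 2) y :> y" for y by (auto intro!: derivative_eq_intros)
    from parts_f[of "\<lambda>y. y\<^sup>2 / 2" "\<lambda>y. y", OF this] show ?thesis by simp
  qed
  finally show ?thesis by (simp add: power2_eq_square power3_eq_cube mult_ac)
qed

text \<open>
  The second-order expansion of the Mecke integrand, for a fixed value \<open>r\<close> of the random variable. Unlike in
  Taylor's formula the remainder has the form \<open>\<integral> b(x) \<phi>''(r + f(x)) dx\<close>, to which the Mecke formula can be
  applied once more. Each integration by parts needs a function vanishing at 0, so \<open>\<phi> r\<close> and then \<open>\<phi>' r\<close> are
  subtracted first.
\<close>

lemma integral_expansion:
  assumes \<phi>: "\<And>y. DERIV \<phi> y :> \<phi>' y" "\<And>y. DERIV \<phi>' y :> \<phi>'' y" "continuous_on UNIV \<phi>''"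
  shows "(LINT x|lborel. f x * \<phi> (r + f x)) =
    \<phi> r * (LINT x|lborel. f x) + \<phi>' r * (LINT x|lborel. (f x)\<^sup>2) + (LINT x|lborel. kernel2 x * \<phi>'' (r + f x))"
proof -
  have c\<phi>: "continuous_on UNIV \<phi>" and c\<phi>': "continuous_on UNIV \<phi>'"
    using \<phi> by (meson DERIV_isCont continuous_at_imp_continuous_on)+
  have shift: "continuous_on UNIV (\<lambda>y. g (r + y))" if "continuous_on UNIV g" for g :: "real \<Rightarrow> real"
    by (intro continuous_on_compose2[OF that] continuous_intros) auto
  have D: "DERIV (\<lambda>y. g (r + y) - g r) y :> g' (r + y)" if "\<And>y. DERIV g y :> g' y" for g g' :: "real \<Rightarrow> real" and y
  proof -
    have "DERIV (\<lambda>y. g (r + y)) y :> g' (r + y)"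
      using that[of "y + r"] by (simp add: DERIV_shift add.commute[of r])
    from DERIV_diff[OF this DERIV_const] show ?thesis by simp
  qed
  have "(LINT x|lborel. f x * (\<phi> (r + f x) - \<phi> r)) = - (LINT x|lborel. kernel1 x * \<phi>' (r + f x))"
    using parts_f[OF D[OF \<phi>(1)] shift[OF c\<phi>']] by simp
  moreover have "(LINT x|lborel. kernel1 x * (\<phi>' (r + f x) - \<phi>' r)) = - (LINT x|lborel. kernel2 x * \<phi>'' (r + f x))"
    using parts_kernel1[OF D[OF \<phi>(2)] shift[OF \<phi>(3)]] by simp
  moreover have "(LINT x|lborel. f x * (\<phi> (r + f x) - \<phi> r)) = (LINT x|lborel. f x * \<phi> (r + f x)) - \<phi> r * (LINT x|lborel. f x)"
    using integrable_f_times[OF shift[OF c\<phi>]] integrable_f_times[of "\<lambda>_. 1"] by (simp add: right_diff_distrib mult.commute)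
  moreover have "(LINT x|lborel. kernel1 x * (\<phi>' (r + f x) - \<phi>' r)) = (LINT x|lborel. kernel1 x * \<phi>' (r + f x)) - \<phi>' r * (LINT x|lborel. kernel1 x)"
    using integrable_kernel1_times[OF shift[OF c\<phi>']] integrable_kernel1_times[of "\<lambda>_. 1"] by (simp add: right_diff_distrib mult.commute)
  ultimately show ?thesis by (simp add: integral_kernel1)
qed

lemma weighted_segment_L2:
  assumes k: "k \<in> borel_measurable borel" "\<And>x. \<bar>k x\<bar> \<le> K" "\<And>x. x \<notin> cball 0 R \<Longrightarrow> k x = 0"
    and L: "AE x in lborel. \<bar>df x\<bar> \<le> L"
  shows "(LINT x|lborel. (segment_integral (2 * R) e k x * df x)\<^sup>2) \<le> (2 * R * L)\<^sup>2 * (LINT x|lborel. (k x)\<^sup>2)"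
proof -
  let ?S = "segment_integral (2 * R) e k"
  have T: "0 < 2 * R" using R by simp
  have [measurable]: "k \<in> borel_measurable borel" by fact
  note S = segment_integral_L2[OF T k, where e=e]
  have ae: "AE x in lborel. (?S x * df x)\<^sup>2 \<le> L\<^sup>2 * (?S x)\<^sup>2"
    using L
  proof eventually_elim
    case (elim x)
    then have "(df x)\<^sup>2 \<le> L\<^sup>2" using power_mono[of "\<bar>df x\<bar>" L 2] by simp
    then show ?case by (simp add: power_mult_distrib mult_right_mono mult.commute)
  qed
  have i: "integrable lborel (\<lambda>x. L\<^sup>2 * (?S x)\<^sup>2)" using S(1) by simp
  have i': "integrable lborel (\<lambda>x. (?S x * df x)\<^sup>2)"
    by (rule Bochner_Integration.integrable_bound[OF i]) (use ae in auto)
  have "(LINT x|lborel. (?S x * df x)\<^sup>2) \<le> (LINT x|lborel. L\<^sup>2 * (?S x)\<^sup>2)"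
    by (rule integral_mono_AE[OF i' i ae])
  also have "\<dots> \<le> L\<^sup>2 * ((2 * R)\<^sup>2 * (LINT x|lborel. (k x)\<^sup>2))"
    using S(2) by (simp add: mult_left_mono)
  finally show ?thesis by (simp add: power_mult_distrib mult_ac)
qed

lemma kernel2_L2:
  assumes L: "AE x in lborel. \<bar>df x\<bar> \<le> L"
  shows "(LINT x|lborel. (kernel2 x)\<^sup>2) \<le> ((2 * R * L)\<^sup>2 * sqrt (LINT x|lborel. (f x)\<^sup>2))\<^sup>2"
proof -
  have "(LINT x|lborel. (kernel2 x)\<^sup>2) \<le> (2 * R * L)\<^sup>2 * (LINT x|lborel. (kernel1 x)\<^sup>2)"
    unfolding kernel2_def by (rule weighted_segment_L2[OF kernel1_measurable kernel1_bound kernel1_zero L])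
  also have "\<dots> \<le> (2 * R * L)\<^sup>2 * ((2 * R * L)\<^sup>2 * (LINT x|lborel. (f x)\<^sup>2))"
    unfolding kernel1_def
    by (intro mult_left_mono weighted_segment_L2[OF f_measurable f_bound f_zero_off_ball L]) auto
  also have "\<dots> = ((2 * R * L)\<^sup>2 * sqrt (LINT x|lborel. (f x)\<^sup>2))\<^sup>2"
  proof -
    have sq: "a * (a * z) = (a * sqrt z)\<^sup>2" if "0 \<le> z" for a z :: real
      using that by (simp add: power_mult_distrib power2_eq_square mult_ac)
    show ?thesis by (rule sq) simp
  qed
  finally show ?thesis .
qed

end

text \<open>
  For \<open>h\<close> continuously differentiable, Stein's equation, the Mecke formula for \<open>f\<close>, the expansion and the
  Mecke formula for \<open>kernel2\<close> give
  \<open>E h(F) - E h(N) = (1 - s) E \<phi>'(F) - (\<integral> kernel2) E \<phi>''(F) - E (\<integral> kernel2 d(\<gamma> - \<lambda>)) \<phi>''(F)\<close>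
  with \<open>s = \<integral> f\<^sup>2\<close>, and the three terms are estimated separately. A general Lipschitz \<open>h\<close> is approximated
  uniformly.
\<close>

lemma stein_bound:
  fixes \<gamma> :: "'w \<Rightarrow> 'a::euclidean_space measure"
  assumes "poisson_process M lborel \<gamma>" and "supported_function f df e R C D"
    and L: "AE x in lborel. \<bar>df x\<bar> \<le> L"
    and h: "1-lipschitz_on UNIV h"
  defines "F \<equiv> \<lambda>\<omega>. (LINT x|\<gamma> \<omega>. f x) - (LINT x|lborel. f x)"
  shows "\<bar>(LINT \<omega>|M. h (F \<omega>)) - (LINT x|std_normal_distribution. h x)\<bar>
    \<le> \<bar>1 - (LINT x|lborel. (f x)\<^sup>2)\<bar> + \<bar>LINT x|lborel. (f x) ^ 3\<bar> + 2 * (2 * R * L)\<^sup>2 * sqrt (LINT x|lborel. (f x)\<^sup>2)" (is "_ \<le> ?bound")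
proof -
  interpret poisson_process M lborel \<gamma> by fact
  interpret supported_function f df e R C D by fact
  define s where "s = (LINT x|lborel. (f x)\<^sup>2)"
  define c where "c = (2 * R * L)\<^sup>2 * sqrt s"
  have "0 \<le> s" unfolding s_def by simp
  then have c0: "0 \<le> c" unfolding c_def by simp
  let ?m = "LINT x|lborel. f x"
  let ?K = "\<lambda>\<omega>. LINT x|\<gamma> \<omega>. kernel2 x"
  let ?k = "LINT x|lborel. kernel2 x"
  let ?KB = "2 * R * (2 * R * C * D) * D"
  have fm: "f \<in> borel_measurable lborel" and km: "kernel2 \<in> borel_measurable lborel" by auto
  have If: "integrable M (\<lambda>\<omega>. LINT x|\<gamma> \<omega>. f x)"
    by (rule integrable_config_integral[OF ball_finite fm f_bound f_zero_off_ball])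
  have Ik: "integrable M ?K"
    by (rule integrable_config_integral[OF ball_finite km kernel2_bound kernel2_zero])
  have IF: "integrable M F" unfolding F_def using If by simp
  then have Fm [measurable]: "F \<in> borel_measurable M" by simp
  \<comment> \<open>the \<open>\<epsilon>\<close> covers the case \<open>c = 0\<close>, where \<open>compensated_L1_bound\<close> does not apply\<close>
  have K1: "expectation (\<lambda>\<omega>. \<bar>?K \<omega> - ?k\<bar>) \<le> c"
  proof (rule field_le_epsilon)
    fix \<epsilon> :: real assume "0 < \<epsilon>"
    have "c\<^sup>2 \<le> (c + \<epsilon>)\<^sup>2" using c0 \<open>0 < \<epsilon>\<close> by (intro power_mono) auto
    then have "(LINT x|lborel. (kernel2 x)\<^sup>2) \<le> (c + \<epsilon>)\<^sup>2"
      using kernel2_L2[OF L] by (simp add: c_def s_def)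
    then show "expectation (\<lambda>\<omega>. \<bar>?K \<omega> - ?k\<bar>) \<le> c + \<epsilon>"
      using c0 \<open>0 < \<epsilon>\<close> by (intro compensated_L1_bound[OF ball_finite km kernel2_bound kernel2_zero]) auto
  qed
  have smooth: "\<bar>(LINT \<omega>|M. k (F \<omega>)) - (LINT x|std_normal_distribution. k x)\<bar> \<le> ?bound"
    if k: "\<And>x. DERIV k x :> g x" and g: "continuous_on UNIV g" "\<And>x. \<bar>g x\<bar> \<le> 1" for k g
  proof -
    obtain \<phi> \<phi>' \<phi>'' where \<phi>: "\<And>x. DERIV \<phi> x :> \<phi>' x" "\<And>x. DERIV \<phi>' x :> \<phi>'' x" "continuous_on UNIV \<phi>''"
      and b: "\<And>x. \<bar>\<phi> x\<bar> \<le> 1" "\<And>x. \<bar>\<phi>' x\<bar> \<le> 1" "\<And>x. \<bar>\<phi>'' x\<bar> \<le> 2"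
      and stein: "\<And>x. \<phi>' x - x * \<phi> x = k x - (LINT x|std_normal_distribution. k x)"
      using stein_solution[OF k g] by metis
    have c: "continuous_on UNIV \<phi>" "continuous_on UNIV \<phi>'" "continuous_on UNIV \<phi>''"
      using \<phi> by (meson DERIV_isCont continuous_at_imp_continuous_on)+
    have [measurable]: "\<phi> \<in> borel_measurable borel" "\<phi>' \<in> borel_measurable borel" "\<phi>'' \<in> borel_measurable borel"
      using c by (auto intro: borel_measurable_continuous_onI)
    have shift: "continuous_on UNIV (\<lambda>y. q (y - ?m))" if "continuous_on UNIV q" for q :: "real \<Rightarrow> real"
      by (intro continuous_on_compose2[OF that] continuous_intros) auto
    have comm: "(LINT x|\<gamma> \<omega>. f x) + f x - ?m = F \<omega> + f x" for \<omega> x by (simp add: F_def)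
    have Feq: "(LINT x|\<gamma> \<omega>. f x) - ?m = F \<omega>" for \<omega> by (simp add: F_def)
    \<comment> \<open>the Mecke formula asks for a common bound of both functions\<close>
    define CC where "CC = max C ?KB"
    have CC: "\<bar>f x\<bar> \<le> CC" "\<bar>kernel2 x\<bar> \<le> CC" for x
      using f_bound[of x] kernel2_bound[of x] unfolding CC_def by linarith+
    have mecke_f: "expectation (\<lambda>\<omega>. (LINT x|\<gamma> \<omega>. f x) * \<phi> (F \<omega>)) = expectation (\<lambda>\<omega>. LINT x|lborel. f x * \<phi> (F \<omega> + f x))"
      using mecke_formula(1)[OF ball_finite fm fm f_bound f_zero_off_ball f_bound f_zero_off_ball shift[OF c(1)] b(1)]
      by (simp add: comm Feq)
    have int_f: "integrable M (\<lambda>\<omega>. (LINT x|\<gamma> \<omega>. f x) * \<phi> (F \<omega>))"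
      using mecke_formula(2)[OF ball_finite fm fm f_bound f_zero_off_ball f_bound f_zero_off_ball shift[OF c(1)] b(1)]
      by (simp add: Feq)
    have mecke_k: "expectation (\<lambda>\<omega>. ?K \<omega> * \<phi>'' (F \<omega>)) = expectation (\<lambda>\<omega>. LINT x|lborel. kernel2 x * \<phi>'' (F \<omega> + f x))"
      using mecke_formula(1)[OF ball_finite fm km CC(1) f_zero_off_ball CC(2) kernel2_zero shift[OF c(3)] b(3)]
      by (simp add: comm Feq)
    have int_k: "integrable M (\<lambda>\<omega>. ?K \<omega> * \<phi>'' (F \<omega>))"
      using mecke_formula(2)[OF ball_finite fm km CC(1) f_zero_off_ball CC(2) kernel2_zero shift[OF c(3)] b(3)]
      by (simp add: Feq)
    have i: "integrable M (\<lambda>\<omega>. \<phi> (F \<omega>))" "integrable M (\<lambda>\<omega>. \<phi>' (F \<omega>))" "integrable M (\<lambda>\<omega>. \<phi>'' (F \<omega>))"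
    proof -
      have q: "integrable M (\<lambda>\<omega>. q (F \<omega>))"
        if q: "q \<in> borel_measurable borel" "\<And>x. \<bar>q x\<bar> \<le> E" for q :: "real \<Rightarrow> real" and E
        by (rule integrable_const_bound[where B=E]) (use q in auto)
      show "integrable M (\<lambda>\<omega>. \<phi> (F \<omega>))" "integrable M (\<lambda>\<omega>. \<phi>' (F \<omega>))" "integrable M (\<lambda>\<omega>. \<phi>'' (F \<omega>))"
        by (rule q[OF _ b(1)] q[OF _ b(2)] q[OF _ b(3)], measurable)+
    qed
    have F\<phi>: "F \<omega> * \<phi> (F \<omega>) = (LINT x|\<gamma> \<omega>. f x) * \<phi> (F \<omega>) - ?m * \<phi> (F \<omega>)" for \<omega>
      by (simp add: F_def left_diff_distrib)
    have iF\<phi>: "integrable M (\<lambda>\<omega>. F \<omega> * \<phi> (F \<omega>))" unfolding F\<phi> using int_f i by simp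
    have int_k': "integrable M (\<lambda>\<omega>. LINT x|lborel. kernel2 x * \<phi>'' (F \<omega> + f x))"
    proof (rule integrable_const_bound[where B="?KB * 2 * measure lborel (cball (0::'a) R)"])
      have KB0: "0 \<le> ?KB" using order_trans[OF abs_ge_zero kernel2_bound] by auto
      have "\<bar>LINT x|lborel. kernel2 x * \<phi>'' (r + f x)\<bar> \<le> ?KB * 2 * measure lborel (cball (0::'a) R)" for r
      proof (rule integral_supported_bound(2)[OF ball_finite])
        show "\<bar>kernel2 x * \<phi>'' (r + f x)\<bar> \<le> ?KB * 2" for x
          unfolding abs_mult using KB0 by (intro mult_mono kernel2_bound b) auto
      qed (simp_all add: kernel2_zero)
      then show "AE \<omega> in M. norm (LINT x|lborel. kernel2 x * \<phi>'' (F \<omega> + f x)) \<le> ?KB * 2 * measure lborel (cball (0::'a) R)"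
        by (intro AE_I2) simp
      have "(\<lambda>r. LINT x|lborel. kernel2 x * \<phi>'' (r + f x)) \<in> borel_measurable borel" by measurable
      then show "(\<lambda>\<omega>. LINT x|lborel. kernel2 x * \<phi>'' (F \<omega> + f x)) \<in> borel_measurable M"
        by (rule measurable_compose[OF Fm])
    qed
    have "expectation (\<lambda>\<omega>. F \<omega> * \<phi> (F \<omega>)) = expectation (\<lambda>\<omega>. LINT x|lborel. f x * \<phi> (F \<omega> + f x)) - ?m * expectation (\<lambda>\<omega>. \<phi> (F \<omega>))"
      unfolding F\<phi> using int_f i by (simp add: mecke_f)
    also have "expectation (\<lambda>\<omega>. LINT x|lborel. f x * \<phi> (F \<omega> + f x))
        = expectation (\<lambda>\<omega>. \<phi> (F \<omega>) * ?m + \<phi>' (F \<omega>) * s + (LINT x|lborel. kernel2 x * \<phi>'' (F \<omega> + f x)))"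
      unfolding integral_expansion[OF \<phi>] s_def ..
    also have "\<dots> = ?m * expectation (\<lambda>\<omega>. \<phi> (F \<omega>)) + s * expectation (\<lambda>\<omega>. \<phi>' (F \<omega>)) + expectation (\<lambda>\<omega>. ?K \<omega> * \<phi>'' (F \<omega>))"
      using i int_k' by (simp add: mecke_k)
    finally have EF\<phi>: "expectation (\<lambda>\<omega>. F \<omega> * \<phi> (F \<omega>)) = s * expectation (\<lambda>\<omega>. \<phi>' (F \<omega>)) + expectation (\<lambda>\<omega>. ?K \<omega> * \<phi>'' (F \<omega>))"
      by simp
    have "1-lipschitz_on UNIV k" by (rule derivative_bound_lipschitz[OF k g(2)])
    then have ik: "integrable M (\<lambda>\<omega>. k (F \<omega>))"
      by (rule lipschitz_integrable[OF prob_space_axioms IF])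
    have "(LINT \<omega>|M. k (F \<omega>)) - (LINT x|std_normal_distribution. k x) = expectation (\<lambda>\<omega>. k (F \<omega>) - (LINT x|std_normal_distribution. k x))"
      using ik by (simp add: prob_space)
    also have "\<dots> = expectation (\<lambda>\<omega>. \<phi>' (F \<omega>)) - expectation (\<lambda>\<omega>. F \<omega> * \<phi> (F \<omega>))"
      unfolding stein[symmetric] using i iF\<phi> by simp
    also have "\<dots> = (1 - s) * expectation (\<lambda>\<omega>. \<phi>' (F \<omega>)) - ?k * expectation (\<lambda>\<omega>. \<phi>'' (F \<omega>)) - expectation (\<lambda>\<omega>. (?K \<omega> - ?k) * \<phi>'' (F \<omega>))"
      unfolding EF\<phi> using int_k i by (simp add: left_diff_distrib)
    finally have eq: "(LINT \<omega>|M. k (F \<omega>)) - (LINT x|std_normal_distribution. k x) =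
       (1 - s) * expectation (\<lambda>\<omega>. \<phi>' (F \<omega>)) - ?k * expectation (\<lambda>\<omega>. \<phi>'' (F \<omega>)) - expectation (\<lambda>\<omega>. (?K \<omega> - ?k) * \<phi>'' (F \<omega>))" .
    have e1: "\<bar>expectation (\<lambda>\<omega>. \<phi>' (F \<omega>))\<bar> \<le> 1"
      using expectation_diff_le[OF prob_space_axioms i(2), of "\<lambda>_. 0" 1] b by simp
    have e2: "\<bar>expectation (\<lambda>\<omega>. \<phi>'' (F \<omega>))\<bar> \<le> 2"
      using expectation_diff_le[OF prob_space_axioms i(3), of "\<lambda>_. 0" 2] b by simp
    have e3: "\<bar>expectation (\<lambda>\<omega>. (?K \<omega> - ?k) * \<phi>'' (F \<omega>))\<bar> \<le> 2 * c"
    proof -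
      have iz: "integrable M (\<lambda>\<omega>. (?K \<omega> - ?k) * \<phi>'' (F \<omega>))" unfolding left_diff_distrib using int_k i by simp
      have "\<bar>expectation (\<lambda>\<omega>. (?K \<omega> - ?k) * \<phi>'' (F \<omega>))\<bar> \<le> expectation (\<lambda>\<omega>. \<bar>(?K \<omega> - ?k) * \<phi>'' (F \<omega>)\<bar>)"
        by (rule integral_abs_bound)
      also have "\<dots> \<le> expectation (\<lambda>\<omega>. \<bar>?K \<omega> - ?k\<bar> * 2)"
      proof (rule integral_mono[OF integrable_abs[OF iz]])
        show "\<bar>(?K \<omega> - ?k) * \<phi>'' (F \<omega>)\<bar> \<le> \<bar>?K \<omega> - ?k\<bar> * 2" for \<omega>
          unfolding abs_mult by (intro mult_left_mono b) simp
      qed (use Ik in simp)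
      finally have "\<bar>expectation (\<lambda>\<omega>. (?K \<omega> - ?k) * \<phi>'' (F \<omega>))\<bar> \<le> expectation (\<lambda>\<omega>. \<bar>?K \<omega> - ?k\<bar> * 2)" .
      then show ?thesis using K1 Ik by simp
    qed
    have a1: "\<bar>(1 - s) * expectation (\<lambda>\<omega>. \<phi>' (F \<omega>))\<bar> \<le> \<bar>1 - s\<bar>"
      unfolding abs_mult using e1 by (intro mult_left_le) auto
    have "\<bar>?k * expectation (\<lambda>\<omega>. \<phi>'' (F \<omega>))\<bar> \<le> \<bar>?k\<bar> * 2"
      unfolding abs_mult by (intro mult_left_mono e2) auto
    then have a2: "\<bar>?k * expectation (\<lambda>\<omega>. \<phi>'' (F \<omega>))\<bar> \<le> \<bar>LINT x|lborel. (f x) ^ 3\<bar>"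
      unfolding integral_kernel2 by simp
    have a3: "\<bar>expectation (\<lambda>\<omega>. (?K \<omega> - ?k) * \<phi>'' (F \<omega>))\<bar> \<le> 2 * (2 * R * L)\<^sup>2 * sqrt s"
      using e3 by (simp add: c_def)
    have "\<bar>x - y - z\<bar> \<le> p + q + r" if "\<bar>x\<bar> \<le> p" "\<bar>y\<bar> \<le> q" "\<bar>z\<bar> \<le> r" for x y z p q r :: real
      using that by linarith
    from this[OF a1 a2 a3] show ?thesis unfolding eq s_def .
  qed
  show ?thesis
  proof (rule field_le_epsilon)
    fix \<epsilon> :: real assume \<epsilon>: "0 < \<epsilon>"
    obtain k g where k: "\<And>x. DERIV k x :> g x" "continuous_on UNIV g" "\<And>x. \<bar>g x\<bar> \<le> 1"
      and kh: "\<And>x. \<bar>k x - h x\<bar> \<le> \<epsilon> / 2"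
      using smooth_lipschitz_approx[OF h, of "\<epsilon> / 2"] \<epsilon> by auto
    have kl: "1-lipschitz_on UNIV k" by (rule derivative_bound_lipschitz[OF k(1,3)])
    have N: "prob_space std_normal_distribution" by (rule prob_space_normal_density) simp
    have "\<bar>(LINT \<omega>|M. k (F \<omega>)) - (LINT \<omega>|M. h (F \<omega>))\<bar> \<le> \<epsilon> / 2"
      by (rule expectation_diff_le[OF prob_space_axioms lipschitz_integrable[OF prob_space_axioms IF kl]
            lipschitz_integrable[OF prob_space_axioms IF h] AE_I2[OF kh]])
    moreover have "\<bar>(LINT x|std_normal_distribution. k x) - (LINT x|std_normal_distribution. h x)\<bar> \<le> \<epsilon> / 2"
      by (rule expectation_diff_le[OF N lipschitz_integrable[OF N integrable_std_normal_id kl]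
            lipschitz_integrable[OF N integrable_std_normal_id h] AE_I2[OF kh]])
    ultimately show "\<bar>(LINT \<omega>|M. h (F \<omega>)) - (LINT x|std_normal_distribution. h x)\<bar> \<le> ?bound + \<epsilon>"
      using smooth[OF k] by linarith
  qed
qed

section \<open>Test functions\<close>

lemma test_function_smooth:
  fixes \<phi> :: "'a::euclidean_space \<Rightarrow> real"
  assumes \<phi>: "\<phi> \<in> test_functions R"
  shows "continuous_on UNIV \<phi>" "\<And>x. R \<le> norm x \<Longrightarrow> \<phi> x = 0"
    and "e \<in> Basis \<Longrightarrow> continuous_on UNIV (\<lambda>x. frechet_derivative \<phi> (at x) e)"
    and "x \<notin> cball 0 R \<Longrightarrow> frechet_derivative \<phi> (at x) e = 0"
    and "\<And>x t. e \<in> Basis \<Longrightarrow> ((\<lambda>s. \<phi> (x + s *\<^sub>R e)) has_real_derivative frechet_derivative \<phi> (at (x + t *\<^sub>R e)) e) (at t)"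
proof -
  have "continuously_differentiable (Suc 0) \<phi>" using \<phi> unfolding test_functions_def by blast
  then have diff: "\<And>x. \<phi> differentiable (at x)"
    and "\<And>b. b \<in> Basis \<Longrightarrow> continuous_on UNIV (\<lambda>x. frechet_derivative \<phi> (at x) b)" by auto
  then show "e \<in> Basis \<Longrightarrow> continuous_on UNIV (\<lambda>x. frechet_derivative \<phi> (at x) e)" by blast
  show "continuous_on UNIV \<phi>"
    using diff differentiable_imp_continuous_within continuous_at_imp_continuous_on by blast
  let ?S = "closure (support_on UNIV \<phi>)"
  have S: "?S \<subseteq> ball 0 R" using \<phi> by (simp add: test_functions_def)
  have off: "\<phi> x = 0" if "x \<notin> ?S" for x
    using that closure_subset[of "support_on UNIV \<phi>"] by (auto simp: support_on_def)
  show "\<phi> x = 0" if "R \<le> norm x" for x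
    by (rule off) (use S that in auto)
  show "frechet_derivative \<phi> (at x) e = 0" if "x \<notin> cball 0 R"
  proof -
    have "((\<lambda>_. 0) has_derivative (\<lambda>_. 0)) (at x)" by (rule has_derivative_const)
    then have "(\<phi> has_derivative (\<lambda>_. 0)) (at x)"
    proof (rule has_derivative_transform_within_open)
      show "open (- ?S)" by (intro open_Compl closed_closure)
      show "x \<in> - ?S" using S that by auto
      show "0 = \<phi> y" if "y \<in> - ?S" for y using off that by simp
    qed
    from frechet_derivative_at[OF this] show ?thesis by metis
  qed
  show "((\<lambda>s. \<phi> (x + s *\<^sub>R e)) has_real_derivative frechet_derivative \<phi> (at (x + t *\<^sub>R e)) e) (at t)" for x t
  proof -
    let ?D = "frechet_derivative \<phi> (at (x + t *\<^sub>R e))"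
    have D: "(\<phi> has_derivative ?D) (at (x + t *\<^sub>R e))"
      using diff frechet_derivative_works by blast
    have "((\<lambda>s. x + s *\<^sub>R e) has_derivative (\<lambda>s. s *\<^sub>R e)) (at t)"
      by (auto intro!: derivative_eq_intros)
    from has_derivative_compose[OF this D]
    have "((\<lambda>s. \<phi> (x + s *\<^sub>R e)) has_derivative (\<lambda>s. ?D (s *\<^sub>R e))) (at t)" .
    moreover have "?D (s *\<^sub>R e) = ?D e * s" for s
      using linear_scale[OF has_derivative_linear[OF D]] by simp
    ultimately show ?thesis by (simp add: has_field_derivative_def)
  qed
qed

lemma continuous_off_ball_bounded:
  fixes g :: "'a::euclidean_space \<Rightarrow> real"
  assumes "continuous_on UNIV g" "\<And>x. x \<notin> cball 0 R \<Longrightarrow> g x = 0"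
  obtains C where "0 \<le> C" "\<And>x. \<bar>g x\<bar> \<le> C"
proof -
  have "compact (g ` cball 0 R)"
    by (intro compact_continuous_image continuous_on_subset[OF assms(1)]) auto
  then obtain C where C: "\<And>x. x \<in> cball 0 R \<Longrightarrow> \<bar>g x\<bar> \<le> C"
    using compact_imp_bounded bounded_iff by (metis imageI real_norm_def)
  have "\<bar>g x\<bar> \<le> max C 0" for x using C[of x] assms(2)[of x] by (cases "x \<in> cball 0 R") auto
  then show ?thesis by (intro that[of "max C 0"]) auto
qed

lemma test_function_supported:
  fixes \<phi> :: "'a::euclidean_space \<Rightarrow> real"
  assumes \<phi>: "\<phi> \<in> test_functions R" and R: "0 < R" and e: "e \<in> Basis"
  obtains C D where "supported_function \<phi> (\<lambda>x. frechet_derivative \<phi> (at x) e) e R C D"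
proof -
  note t = test_function_smooth[OF \<phi>]
  have off: "x \<notin> cball 0 R \<Longrightarrow> \<phi> x = 0" for x by (rule t(2)) simp
  obtain C where C: "\<And>x. \<bar>\<phi> x\<bar> \<le> C" using continuous_off_ball_bounded[OF t(1) off] by metis
  obtain D where D: "\<And>x. \<bar>frechet_derivative \<phi> (at x) e\<bar> \<le> D"
    using continuous_off_ball_bounded[OF t(3)[OF e] t(4)] by metis
  have "supported_function \<phi> (\<lambda>x. frechet_derivative \<phi> (at x) e) e R C D"
    by unfold_locales (use t e R C D in auto)
  then show ?thesis by (rule that)
qed

lemma gradient_inner:
  assumes e: "e \<in> Basis"
  shows "gradient \<phi> x \<bullet> e = frechet_derivative \<phi> (at x) e"
proof -
  have "gradient \<phi> x \<bullet> e = (\<Sum>b\<in>Basis. if b = e then frechet_derivative \<phi> (at x) b else 0)"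
    unfolding gradient_def inner_sum_left using e by (intro sum.cong) (auto simp: inner_Basis)
  then show ?thesis using e by simp
qed

lemma partial_le_gradient: "e \<in> Basis \<Longrightarrow> \<bar>frechet_derivative \<phi> (at x) e\<bar> \<le> norm (gradient \<phi> x)"
  by (metis Basis_le_norm gradient_inner)

lemma test_function_gradient_bounded:
  fixes \<phi> :: "'a::euclidean_space \<Rightarrow> real"
  assumes \<phi>: "\<phi> \<in> test_functions R"
  obtains E where "\<And>x. norm (gradient \<phi> x) \<le> E"
proof -
  have "\<exists>D. \<forall>x. \<bar>frechet_derivative \<phi> (at x) b\<bar> \<le> D" if "b \<in> Basis" for b
    using continuous_off_ball_bounded[OF test_function_smooth(3)[OF \<phi> that] test_function_smooth(4)[OF \<phi>]] by metis
  then obtain D where D: "\<And>b x. b \<in> Basis \<Longrightarrow> \<bar>frechet_derivative \<phi> (at x) b\<bar> \<le> D b" by metis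
  have "norm (gradient \<phi> x) \<le> (\<Sum>b\<in>Basis. D b)" for x
    unfolding gradient_def by (intro sum_norm_le) (simp add: D)
  then show ?thesis by (rule that)
qed

section \<open>Passage to the Sobolev space\<close>

lemma integral_perturbation:
  fixes u v :: "'a \<Rightarrow> real"
  assumes B: "B \<in> sets M" "emeasure M B < \<infinity>" and [measurable]: "u \<in> borel_measurable M" and v: "integrable M v"
    and le: "AE x in M. \<bar>u x - v x\<bar> \<le> \<delta> * indicator B x"
  shows "integrable M u" "\<bar>(LINT x|M. u x) - (LINT x|M. v x)\<bar> \<le> \<delta> * measure M B"
proof -
  have [measurable]: "v \<in> borel_measurable M" using v by auto
  have iB: "integrable M (\<lambda>x. \<delta> * indicator B x)" using B by (simp add: integrable_real_indicator)
  have d: "integrable M (\<lambda>x. u x - v x)"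
    by (rule Bochner_Integration.integrable_bound[OF iB]) (use le in auto)
  from Bochner_Integration.integrable_add[OF d v] show u: "integrable M u" by simp
  have "\<bar>(LINT x|M. u x) - (LINT x|M. v x)\<bar> = \<bar>LINT x|M. u x - v x\<bar>" using u v by simp
  also have "\<dots> \<le> (LINT x|M. \<bar>u x - v x\<bar>)" by simp
  also have "\<dots> \<le> (LINT x|M. \<delta> * indicator B x)"
    by (intro integral_mono_AE integrable_abs d iB le)
  finally show "\<bar>(LINT x|M. u x) - (LINT x|M. v x)\<bar> \<le> \<delta> * measure M B"
    using sets.sets_into_space[OF B(1)] by (simp add: Int_absorb2)
qed

context poisson_process
begin

text \<open>
  A null set almost surely contains no point of the configuration, because its count is a Poisson
  variable of mean 0. Hence almost everywhere equal functions have almost surely equal integrals.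
\<close>

lemma AE_config:
  assumes "AE x in \<mu>. P x"
  shows "AE \<omega> in M. AE x in \<gamma> \<omega>. P x"
proof -
  obtain N where N: "{x \<in> space \<mu>. \<not> P x} \<subseteq> N" "emeasure \<mu> N = 0" "N \<in> sets \<mu>"
    using assms by (rule AE_E)
  show ?thesis
    using AE_null_config[OF N(3,2)] AE_space
  proof eventually_elim
    case (elim \<omega>)
    show ?case by (rule AE_I[of _ _ N]) (use elim N in \<open>auto simp: sets_config space_config\<close>)
  qed
qed

text \<open>
  Changing the integrand by at most \<open>\<delta>\<close> on \<open>B\<close> changes the compensated integral by at most \<open>\<delta>\<close> times the
  number of points plus the intensity of \<open>B\<close>.
\<close>

lemma compensated_perturbation:
  fixes u v :: "'a \<Rightarrow> real"
  assumes B: "B \<in> sets \<mu>" "emeasure \<mu> B < \<infinity>"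
    and u: "u \<in> borel_measurable \<mu>" and v: "v \<in> borel_measurable \<mu>" "\<And>x. \<bar>v x\<bar> \<le> C" "\<And>x. x \<notin> B \<Longrightarrow> v x = 0"
    and le: "AE x in \<mu>. \<bar>u x - v x\<bar> \<le> \<delta> * indicator B x" and "0 \<le> \<delta>"
  defines "U \<equiv> \<lambda>\<omega>. (LINT x|\<gamma> \<omega>. u x) - (LINT x|\<mu>. u x)" and "V \<equiv> \<lambda>\<omega>. (LINT x|\<gamma> \<omega>. v x) - (LINT x|\<mu>. v x)"
  shows "integrable M U" "integrable M V" "expectation (\<lambda>\<omega>. \<bar>U \<omega> - V \<omega>\<bar>) \<le> 2 * \<delta> * measure \<mu> B"
proof -
  show V: "integrable M V"
    unfolding V_def using integrable_config_integral(2)[OF B v] by simp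
  have Um: "U \<in> borel_measurable M"
    unfolding U_def using integral_config_measurable[OF u] by simp
  let ?w = "\<lambda>\<omega>. \<delta> * measure (\<gamma> \<omega>) B + \<delta> * measure \<mu> B"
  have iw: "integrable M ?w" using integrable_count[OF B] by simp
  have \<mu>: "\<bar>(LINT x|\<mu>. u x) - (LINT x|\<mu>. v x)\<bar> \<le> \<delta> * measure \<mu> B"
    by (rule integral_perturbation[OF B u integral_supported_bound(1)[OF B v] le])
  have ae: "AE \<omega> in M. \<bar>U \<omega> - V \<omega>\<bar> \<le> ?w \<omega>"
    using AE_config[OF le] AE_count_finite[OF B] AE_space
  proof eventually_elim
    case (elim \<omega>)
    have B\<omega>: "B \<in> sets (\<gamma> \<omega>)" using B elim by (simp add: sets_config)
    have "integrable (\<gamma> \<omega>) v"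
      by (rule integral_supported_bound(1)[OF B\<omega> elim(2) measurable_config[OF elim(3) v(1)] v(2,3)])
    then have "\<bar>(LINT x|\<gamma> \<omega>. u x) - (LINT x|\<gamma> \<omega>. v x)\<bar> \<le> \<delta> * measure (\<gamma> \<omega>) B"
      by (rule integral_perturbation[OF B\<omega> elim(2) measurable_config[OF elim(3) u] _ elim(1)])
    then show ?case using \<mu> unfolding U_def V_def by linarith
  qed
  have d: "integrable M (\<lambda>\<omega>. U \<omega> - V \<omega>)"
    by (rule Bochner_Integration.integrable_bound[OF iw]) (use ae Um V in auto)
  from Bochner_Integration.integrable_add[OF d V] show "integrable M U" by simp
  have "expectation (\<lambda>\<omega>. \<bar>U \<omega> - V \<omega>\<bar>) \<le> expectation ?w"
    by (intro integral_mono_AE integrable_abs d iw ae)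
  then show "expectation (\<lambda>\<omega>. \<bar>U \<omega> - V \<omega>\<bar>) \<le> 2 * \<delta> * measure \<mu> B"
    using integrable_count[OF B] by (simp add: prob_space)
qed

end

lemma Linf_norm_AE:
  assumes "Linf_norm R u \<le> ennreal c" "0 \<le> c"
  shows "AE x in lborel. x \<in> cball 0 R \<longrightarrow> norm (u x) \<le> c"
proof -
  have "AE x in restrict_space lborel (cball 0 R). ennreal (norm (u x)) \<le> Linf_norm R u"
    unfolding Linf_norm_def by (rule esssup_AE)
  then have "AE x in restrict_space lborel (cball 0 R). norm (u x) \<le> c"
    by eventually_elim (meson assms ennreal_le_iff order_trans)
  then show ?thesis by (subst (asm) AE_restrict_space_iff) auto
qed

lemma Linf_norm_leI:
  fixes u :: "'a::euclidean_space \<Rightarrow> 'b::euclidean_space"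
  assumes u: "set_borel_measurable borel (cball 0 R) u" and le: "AE x in lborel. x \<in> cball 0 R \<longrightarrow> norm (u x) \<le> c"
  shows "Linf_norm R u \<le> ennreal c"
  unfolding Linf_norm_def
proof (rule esssup_I)
  have "u \<in> borel_measurable (restrict_space borel (cball 0 R))"
    using u by (subst borel_measurable_restrict_space_iff) (auto simp: set_borel_measurable_def)
  then have "u \<in> borel_measurable (restrict_space lborel (cball 0 R))"
    by (simp cong: measurable_cong_sets add: sets_restrict_space)
  then show "(\<lambda>x. ennreal (norm (u x))) \<in> borel_measurable (restrict_space lborel (cball 0 R))"
    by measurable
  show "AE x in restrict_space lborel (cball 0 R). ennreal (norm (u x)) \<le> ennreal c"
    using le by (subst AE_restrict_space_iff) (auto intro: ennreal_leI)
qed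

lemma power_integral_tendsto:
  fixes u :: "'a \<Rightarrow> real"
  assumes B: "B \<in> sets M" "emeasure M B < \<infinity>" and k: "0 < k"
    and [measurable]: "u \<in> borel_measurable M" "\<And>n. v n \<in> borel_measurable M"
    and le: "\<And>n::nat. AE x in M. \<bar>u x - v n x\<bar> \<le> \<delta> n * indicator B x" and \<delta>: "\<delta> \<longlonglongrightarrow> 0" "\<And>n. \<delta> n \<le> 1"
    and C: "\<And>x. \<bar>v 0 x\<bar> \<le> C" "\<And>x. x \<notin> B \<Longrightarrow> v 0 x = 0"
  shows "(\<lambda>n. LINT x|M. (v n x) ^ k) \<longlonglongrightarrow> (LINT x|M. (u x) ^ k)"
proof (rule integral_dominated_convergence[where w="\<lambda>x. (C + 2) ^ k * indicator B x"])
  show "integrable M (\<lambda>x. (C + 2) ^ k * indicator B x)" using B by (simp add: integrable_real_indicator)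
  have all: "AE x in M. \<forall>n. \<bar>u x - v n x\<bar> \<le> \<delta> n * indicator B x"
    using le by (simp add: AE_all_countable)
  then show "AE x in M. (\<lambda>n. (v n x) ^ k) \<longlonglongrightarrow> (u x) ^ k"
  proof eventually_elim
    case (elim x)
    have "(\<lambda>n. \<delta> n * indicator B x) \<longlonglongrightarrow> 0" by (rule tendsto_mult_left_zero[OF \<delta>(1)])
    then have "(\<lambda>n. u x - v n x) \<longlonglongrightarrow> 0"
      by (rule Lim_null_comparison[rotated]) (use elim in auto)
    from tendsto_diff[OF tendsto_const[of "u x"] this] have "(\<lambda>n. v n x) \<longlonglongrightarrow> u x" by simp
    then show ?case by (rule tendsto_power)
  qed
  show "AE x in M. norm ((v n x) ^ k) \<le> (C + 2) ^ k * indicator B x" for n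
    using all
  proof eventually_elim
    case (elim x)
    show ?case
    proof (cases "x \<in> B")
      case True
      have "\<bar>u x - v n x\<bar> \<le> 1" "\<bar>u x - v 0 x\<bar> \<le> 1"
        using elim[rule_format, of n] elim[rule_format, of 0] \<delta>(2)[of n] \<delta>(2)[of 0] True by auto
      then have "\<bar>v n x\<bar> \<le> C + 2" using C(1)[of x] by linarith
      then have "\<bar>v n x\<bar> ^ k \<le> (C + 2) ^ k" by (intro power_mono) auto
      then show ?thesis using True by (simp add: power_abs)
    next
      case False
      then have "v n x = 0" using elim[rule_format, of n] elim[rule_format, of 0] C(2)[of x] by simp
      then show ?thesis using k False by (simp add: zero_power)
    qed
  qed
qed measurable

text \<open>
  A sequence of test functions converging to \<open>f\<close> satisfies \<open>stein_bound\<close>. Its gradients are bounded by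
  the norm of \<open>g\<close> plus an error tending to zero, so the bounds converge to the one for \<open>f\<close>. Outside the ball
  \<open>f\<close> is arbitrary; it is replaced by \<open>u\<close>, which vanishes there.
\<close>

theorem wasserstein_bound:
  fixes f :: "'a::euclidean_space \<Rightarrow> real" and g :: "'a \<Rightarrow> 'a" and \<gamma> :: "'w \<Rightarrow> 'a measure"
  assumes R: "0 < R" and fg: "sobolev0_inf_gradient R f g" and \<gamma>: "poisson_random_measure M lborel \<gamma>"
  shows "wasserstein_dist M (compensated_integral R f \<gamma>) std_normal_distribution (\<lambda>x. x)
        \<le> ennreal \<bar>1 - (L2_norm R f)\<^sup>2\<bar> + ennreal \<bar>LINT x:cball 0 R|lborel. (f x) ^ 3\<bar>
          + ennreal (2 * (2 * R)\<^sup>2 * L2_norm R f) * (Linf_norm R g)\<^sup>2"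
proof -
  have pp: "poisson_process M lborel \<gamma>" by unfold_locales fact
  interpret poisson_process M lborel \<gamma> by fact
  let ?B = "cball (0::'a) R"
  have B: "?B \<in> sets lborel" "emeasure lborel ?B < \<infinity>"
    using emeasure_bounded_finite[OF bounded_cball, of "0::'a" R] by auto
  obtain e :: 'a where e: "e \<in> Basis" using nonempty_Basis by blast
  define u where "u = (\<lambda>x. indicator ?B x * f x)"
  have um: "u \<in> borel_measurable lborel"
    using fg unfolding sobolev0_inf_gradient_def set_borel_measurable_def u_def by simp
  have gm: "set_borel_measurable borel ?B g" using fg by (simp add: sobolev0_inf_gradient_def)
  obtain \<psi> where \<psi>: "\<And>n. \<psi> n \<in> test_functions R"
    and lim: "(\<lambda>n. Linf_norm R (\<lambda>x. \<psi> n x - f x) + Linf_norm R (\<lambda>x. gradient (\<psi> n) x - g x)) \<longlonglongrightarrow> 0"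
    using fg by (auto simp: sobolev0_inf_gradient_def)
  have "\<forall>\<^sub>F n in sequentially. Linf_norm R (\<lambda>x. \<psi> n x - f x) + Linf_norm R (\<lambda>x. gradient (\<psi> n) x - g x) < 1"
    by (rule order_tendstoD(2)[OF lim]) simp
  then obtain N where N: "\<And>n. N \<le> n \<Longrightarrow> Linf_norm R (\<lambda>x. \<psi> n x - f x) + Linf_norm R (\<lambda>x. gradient (\<psi> n) x - g x) < 1"
    by (auto simp: eventually_sequentially)
  \<comment> \<open>the shift makes all errors at most 1, hence all powers uniformly bounded\<close>
  define v where "v n = \<psi> (n + N)" for n
  define d where "d n = Linf_norm R (\<lambda>x. v n x - f x) + Linf_norm R (\<lambda>x. gradient (v n) x - g x)" for n
  define \<delta> where "\<delta> n = enn2real (d n)" for n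
  have v: "v n \<in> test_functions R" for n by (simp add: v_def \<psi>)
  have d1: "d n < 1" for n unfolding d_def v_def by (rule N) simp
  have d\<delta>: "d n = ennreal (\<delta> n)" for n
    unfolding \<delta>_def using order.strict_trans[OF d1[of n] ennreal_one_less_top] by simp
  have \<delta>0: "0 \<le> \<delta> n" for n by (simp add: \<delta>_def)
  have \<delta>1: "\<delta> n \<le> 1" for n using d1[of n] \<delta>0[of n] unfolding d\<delta> by (simp add: ennreal_less_one_iff)
  have dlim: "d \<longlonglongrightarrow> 0" unfolding d_def v_def by (rule LIMSEQ_ignore_initial_segment[OF lim])
  have \<delta>lim: "\<delta> \<longlonglongrightarrow> 0"
    using dlim \<delta>0 unfolding d\<delta>[abs_def] by (simp add: tendsto_ennreal_iff[of _ _ 0, simplified])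
  have dist: "AE x in lborel. x \<in> ?B \<longrightarrow> norm (v n x - f x) \<le> \<delta> n"
    and gdist: "AE x in lborel. x \<in> ?B \<longrightarrow> norm (gradient (v n) x - g x) \<le> \<delta> n" for n
    by (rule Linf_norm_AE[OF _ \<delta>0]; simp add: d\<delta>[symmetric] d_def)+
  have off: "x \<notin> ?B \<Longrightarrow> v n x = 0" for n x by (rule test_function_smooth(2)[OF v]) simp
  have le: "AE x in lborel. \<bar>u x - v n x\<bar> \<le> \<delta> n * indicator ?B x" for n
    using dist[of n]
  proof eventually_elim
    case (elim x)
    then show ?case using off[of x n] by (cases "x \<in> ?B") (auto simp: u_def abs_minus_commute)
  qed
  have vm: "v n \<in> borel_measurable lborel" for n
    using borel_measurable_continuous_onI[OF test_function_smooth(1)[OF v]] by simp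
  define G where "G = enn2real (Linf_norm R g)"
  have G: "Linf_norm R g = ennreal G"
  proof -
    \<comment> \<open>finiteness matters: otherwise the right-hand side could be \<open>0 * \<infinity> = 0\<close>\<close>
    obtain E where E: "\<And>x. norm (gradient (v 0) x) \<le> E"
      using test_function_gradient_bounded[OF v] by blast
    have "AE x in lborel. x \<in> ?B \<longrightarrow> norm (g x) \<le> E + \<delta> 0"
      using gdist[of 0]
    proof eventually_elim
      case (elim x)
      have "norm (g x) \<le> norm (gradient (v 0) x) + norm (gradient (v 0) x - g x)"
        by (metis norm_minus_commute norm_triangle_sub)
      then show ?case using elim E[of x] by auto
    qed
    then have "Linf_norm R g \<le> ennreal (E + \<delta> 0)" by (rule Linf_norm_leI[OF gm])
    then show ?thesis unfolding G_def by (simp add: ennreal_enn2real le_less_trans)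
  qed
  have G0: "0 \<le> G" by (simp add: G_def)
  have gbd: "AE x in lborel. x \<in> ?B \<longrightarrow> norm (g x) \<le> G"
    by (rule Linf_norm_AE[OF _ G0]) (simp add: G)
  let ?L = "\<lambda>n. G + \<delta> n"
  have dL: "AE x in lborel. \<bar>frechet_derivative (v n) (at x) e\<bar> \<le> ?L n" for n
    using gbd gdist[of n]
  proof eventually_elim
    case (elim x)
    show ?case
    proof (cases "x \<in> ?B")
      case True
      have "\<bar>frechet_derivative (v n) (at x) e\<bar> \<le> norm (gradient (v n) x)" by (rule partial_le_gradient[OF e])
      also have "\<dots> \<le> norm (g x) + norm (gradient (v n) x - g x)"
        by (metis norm_triangle_sub)
      finally show ?thesis using elim True by simp
    next
      case False
      then show ?thesis using test_function_smooth(4)[OF v, of x n e] G0 \<delta>0[of n] by simp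
    qed
  qed
  let ?bd = "\<lambda>L s t. \<bar>1 - s\<bar> + \<bar>t\<bar> + 2 * (2 * R * L)\<^sup>2 * sqrt s"
  let ?s = "\<lambda>n. LINT x|lborel. (v n x)\<^sup>2" and ?t = "\<lambda>n. LINT x|lborel. (v n x) ^ 3"
  let ?su = "LINT x|lborel. (u x)\<^sup>2" and ?tu = "LINT x|lborel. (u x) ^ 3"
  let ?F = "\<lambda>\<omega>. (LINT x|\<gamma> \<omega>. u x) - (LINT x|lborel. u x)"
  let ?Fn = "\<lambda>n \<omega>. (LINT x|\<gamma> \<omega>. v n x) - (LINT x|lborel. v n x)"
  have F: "compensated_integral R f \<gamma> = ?F"
    by (simp add: compensated_integral_def[abs_def] set_lebesgue_integral_def u_def)
  have main: "\<bar>(LINT \<omega>|M. h (?F \<omega>)) - (LINT x|std_normal_distribution. h x)\<bar> \<le> ?bd G ?su ?tu"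
    if h: "1-lipschitz_on UNIV h" for h
  proof -
    have bn: "\<bar>(LINT \<omega>|M. h (?F \<omega>)) - (LINT x|std_normal_distribution. h x)\<bar>
        \<le> 2 * \<delta> n * measure lborel ?B + ?bd (?L n) (?s n) (?t n)" for n
    proof -
      obtain C D where sf: "supported_function (v n) (\<lambda>x. frechet_derivative (v n) (at x) e) e R C D"
        using test_function_supported[OF v R e] by blast
      then have C: "\<bar>v n x\<bar> \<le> C" for x by (simp add: supported_function_def)
      note pert = compensated_perturbation[OF B um vm[of n] C off le[of n] \<delta>0]
      have i: "integrable M ?F" "integrable M (?Fn n)"
        by (rule pert; assumption)+
      have "expectation (\<lambda>\<omega>. \<bar>?F \<omega> - ?Fn n \<omega>\<bar>) \<le> 2 * \<delta> n * measure lborel ?B"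
        by (rule pert; assumption)
      with lipschitz_expectation_diff[OF prob_space_axioms i h]
      have "\<bar>(LINT \<omega>|M. h (?F \<omega>)) - (LINT \<omega>|M. h (?Fn n \<omega>))\<bar> \<le> 2 * \<delta> n * measure lborel ?B"
        by linarith
      with stein_bound[OF pp sf dL h] show ?thesis by linarith
    qed
    obtain C where C: "\<And>x. \<bar>v 0 x\<bar> \<le> C"
      using continuous_off_ball_bounded[OF test_function_smooth(1)[OF v] off] by metis
    have s: "?s \<longlonglongrightarrow> ?su" and t: "?t \<longlonglongrightarrow> ?tu"
      by (rule power_integral_tendsto[OF B _ um vm le \<delta>lim \<delta>1 C off]; simp)+
    have "(\<lambda>n. 2 * \<delta> n * measure lborel ?B + ?bd (?L n) (?s n) (?t n))
        \<longlonglongrightarrow> 2 * 0 * measure lborel ?B + ?bd (G + 0) ?su ?tu"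
      by (intro tendsto_intros s t \<delta>lim)
    from tendsto_lowerbound[OF this always_eventually[OF allI[OF bn]]]
    show ?thesis by simp
  qed
  have "wasserstein_dist M (compensated_integral R f \<gamma>) std_normal_distribution (\<lambda>x. x) \<le> ennreal (?bd G ?su ?tu)"
    unfolding wasserstein_dist_def F
  proof (rule SUP_least)
    fix h :: "real \<Rightarrow> real" assume "h \<in> {h. 1-lipschitz_on UNIV h}"
    then have "1-lipschitz_on UNIV h" by simp
    from main[OF this]
    show "ennreal \<bar>(LINT \<omega>|M. h (?F \<omega>)) - (LINT x|std_normal_distribution. h x)\<bar> \<le> ennreal (?bd G ?su ?tu)"
      by (rule ennreal_leI)
  qed
  moreover have pow: "indicator ?B x *\<^sub>R (f x) ^ k = (u x) ^ k" if "0 < k" for x k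
    using that by (cases "x \<in> ?B") (simp_all add: u_def zero_power)
  have L2: "L2_norm R f = sqrt ?su"
    unfolding L2_norm_def set_lebesgue_integral_def by (simp only: pow zero_less_numeral)
  moreover have "(L2_norm R f)\<^sup>2 = ?su" unfolding L2 by (rule real_sqrt_pow2) simp
  moreover have "(LINT x:?B|lborel. (f x) ^ 3) = ?tu"
    unfolding set_lebesgue_integral_def by (simp only: pow zero_less_numeral)
  moreover have "ennreal (?bd G ?su ?tu) = ennreal \<bar>1 - ?su\<bar> + ennreal \<bar>?tu\<bar> + ennreal (2 * (2 * R)\<^sup>2 * sqrt ?su) * (ennreal G)\<^sup>2"
  proof -
    have "0 \<le> sqrt ?su" by simp
    then have nn: "0 \<le> 2 * (2 * R)\<^sup>2 * sqrt ?su" "0 \<le> 2 * (2 * R * G)\<^sup>2 * sqrt ?su" by (intro mult_nonneg_nonneg; simp)+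
    have "ennreal (2 * (2 * R)\<^sup>2 * sqrt ?su) * (ennreal G)\<^sup>2 = ennreal (2 * (2 * R)\<^sup>2 * sqrt ?su * G\<^sup>2)"
      unfolding ennreal_power[OF G0] by (rule ennreal_mult[symmetric]) (use nn in simp_all)
    also have "2 * (2 * R)\<^sup>2 * sqrt ?su * G\<^sup>2 = 2 * (2 * R * G)\<^sup>2 * sqrt ?su"
      by (simp only: power_mult_distrib mult_ac)
    finally show ?thesis using nn by (simp only: ennreal_plus abs_ge_zero add_nonneg_nonneg)
  qed
  ultimately show ?thesis unfolding G by (simp only:)
qed

theorem corollary5p3:
  assumes "DIM('a::euclidean_space) \<ge> 2"
  shows "\<exists>K::real. K > 0 \<and>
    (\<forall>(R::real) (f :: 'a \<Rightarrow> real) (g :: 'a \<Rightarrow> 'a) (M :: 'w measure) (\<gamma> :: 'w \<Rightarrow> 'a measure).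
      R > 0 \<longrightarrow> sobolev0_inf_gradient R f g \<longrightarrow> poisson_random_measure M lborel \<gamma> \<longrightarrow>
      wasserstein_dist M (compensated_integral R f \<gamma>) std_normal_distribution (\<lambda>x. x)
        \<le> ennreal \<bar>1 - (L2_norm R f)\<^sup>2\<bar>
          + ennreal \<bar>LINT x:cball 0 R|lborel. (f x) ^ 3\<bar>
          + ennreal (2 * (K * measure lborel (cball (0::'a) 1) * (2 * R))\<^sup>2 * L2_norm R f)
            * (Linf_norm R g)\<^sup>2)"
proof -
  \<comment> \<open>\<open>K\<close> is the inverse of the volume of the unit ball, so that \<open>K * ?v * (2 * R) = 2 * R\<close>\<close>
  let ?v = "measure lborel (cball (0::'a) 1)"
  have "?v = unit_ball_vol (real DIM('a)) * 1 ^ DIM('a)" by (rule content_cball) simp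
  then have v: "0 < ?v" using unit_ball_vol_pos[of "real DIM('a)"] by (metis mult_1_right of_nat_0_le_iff power_one)
  then have one: "1 / ?v * ?v * r = r" for r by (metis less_irrefl mult_1 nonzero_eq_divide_eq)
  have "1 / ?v > 0" using v by (rule divide_pos_pos[OF zero_less_one])
  moreover note wasserstein_bound
  ultimately show ?thesis
    by (intro exI[of _ "1 / ?v"]) (simp only: one simp_thms; blast)
qed

end
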